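(* Assume the setting described in the context, and assume that Condition D and Condition C hold and that $\mathbb E(|\epsilon_{\mathbf 0}|^\alpha)<\infty$ for some $\alpha>2$. Then for every $x\in\mathbb R$, \[ (n^db_n)^{1/2}\big(f_n(x)-\mathbb E f_n(x)\big)\Rightarrow \mathcal N(0,\sigma_x^2)\quad\text{as } n\to\infty, \] where $\sigma_x^2=p(x)\int_{\mathbb R}K^2(s)\,ds$ and $\Rightarrow$ denotes convergence in distribution.
   Context: Let $d\in\mathbb N$. For $i,k\in\mathbb Z^d$ write $i\succeq k$ (equivalently $k\preceq i$) if $i_\tau\ge k_\tau$ for all $\tau=1,\dots,d$; write $\mathbf 0=(0,\dots,0)$, $\mathbf 1=(1,\dots,1)\in\mathbb Z^d$, $|i|_\infty=\max_\tau|i_\tau|$, and $[\![a,b]\!]=\{a,a+1,\dots,b\}$ for integers $a\le b$. Let $(\epsilon_i)_{i\in\mathbb Z^d}$ be i.i.d. real random variables with mean zero and finite second moment, let $(a_k)_{k\in\mathbb Z^d,k\succeq\mathbf 0}$ be real numbers with $\sum_{k\succeq \mathbf 0}a_k^2<\infty$, and let $X_i=\sum_{k\succeq\mathbf 0}a_k\epsilon_{i-k}$, $i\in\mathbb Z^d$ (a causal linear random field). The kernel $K:\mathbb R\to\mathbb R$ is a bounded Lipschitz-continuous probability density; the bandwidths $b_n>0$ satisfy $b_n\to0$ and $n^db_n\to\infty$. The kernel density estimator is $f_n(x)=\frac{1}{n^db_n}\sum_{i\in[\![1,n]\!]^d}K\big(\frac{x-X_i}{b_n}\big)$. For $m\in\mathbb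 N$ set $X_{i,m}=\sum_{k\in[\![0,m-1]\!]^d}a_k\epsilon_{i-k}$. Let $p$, $p_m$ denote the densities of $X_{\mathbf 0}$, $X_{\mathbf 0,m}$, and for $i\ne\mathbf 0$ let $p_i$, $p_{i,m}$ denote the joint densities of $(X_{\mathbf 0},X_i)$ and $(X_{\mathbf 0,m},X_{i,m})$; write $\bar p=\sup_xp(x)$, $\bar p_m=\sup_x p_m(x)$, $\bar p_i=\sup_{x,y}p_i(x,y)$, $\bar p_{i,m}=\sup_{x,y}p_{i,m}(x,y)$. Condition D: (i) the densities $p$ and $p_m$ ($m\in\mathbb N$) exist and there is $c_0<\infty$ independent of $m$ with $|p(x)-p(y)|\le c_0|x-y|$ and $|p_m(x)-p_m(y)|\le c_0|x-y|$ for all $x,y$; moreover $\bar p<\infty$ and $\sup_m\bar p_m<\infty$. (ii) The joint densities $p_i$ and $p_{i,m}$ exist for all $i\ne\mathbf 0$, $m\in\mathbb N$, and $\sup_{i\ne\mathbf 0}\bar p_i<\infty$, $\sup_m\sup_{i\neq\mathbf 0}\bar p_{i,m}<\infty$. Define $A_k=\big(\sum_{i\succeq k}a_i^2\big)^{1/2}$ for $k\in\mathbb Z^d$, $B_m=\big(\sum_{i\in[\![0,\infty)^d,\,|i|_\infty\ge m}a_i^2\big)^{1/2}$ for $m\in\mathbb N$, and $\Delta_n=\sum_{k\in[\![1,n]\!]^d}\frac{A_{k-\mathbf 1}}{\prod_{\tau=1}^dk_\tau^{1/2}}$. Condition C: there is a sequence of positive integers $(m_n)$ with $m_n\to\infty$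 such that (C1) $b_n^{1/2}\Delta_n\to0$, (C2) $B_{m_n}/b_n\to0$, (C3) $m_n^db_n\to0$, (C4) $\frac{m_n^d\log^dn}{n^db_n}\to0$, as $n\to\infty$. *)

theory Defs
  imports "HOL-Probability.Probability"
begin

text \<open>Lattice points of Z^d are represented as functions 'd \<Rightarrow> int with 'd a finite type, d = CARD('d).\<close>

definition box :: "int \<Rightarrow> int \<Rightarrow> ('d::finite \<Rightarrow> int) set" where
  "box lo hi = {i. \<forall>\<tau>. lo \<le> i \<tau> \<and> i \<tau> \<le> hi}"

definition nonneg_idx :: "('d::finite \<Rightarrow> int) set" where
  "nonneg_idx = {i. \<forall>\<tau>. 0 \<le> i \<tau>}"

definition zero_idx :: "'d::finite \<Rightarrow> int" where
  "zero_idx = (\<lambda>_. 0)"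

definition Xtrunc :: "(('d::finite \<Rightarrow> int) \<Rightarrow> real) \<Rightarrow> (('d \<Rightarrow> int) \<Rightarrow> 'a \<Rightarrow> real)
    \<Rightarrow> nat \<Rightarrow> ('d \<Rightarrow> int) \<Rightarrow> 'a \<Rightarrow> real" where
  "Xtrunc a eps m i \<omega> = (\<Sum>k\<in>box 0 (int m - 1). a k * eps (\<lambda>\<tau>. i \<tau> - k \<tau>) \<omega>)"

text \<open>A_k = (sum_{i \<succeq> k} a_i^2)^{1/2}  (a is only given on nonnegative indices)\<close>
definition A_coef :: "(('d::finite \<Rightarrow> int) \<Rightarrow> real) \<Rightarrow> ('d \<Rightarrow> int) \<Rightarrow> real" where
  "A_coef a k = sqrt (infsum (\<lambda>i. (a i)\<^sup>2) {i \<in> nonneg_idx. \<forall>\<tau>. k \<tau> \<le> i \<tau>})"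

definition B_coef :: "(('d::finite \<Rightarrow> int) \<Rightarrow> real) \<Rightarrow> nat \<Rightarrow> real" where
  "B_coef a m = sqrt (infsum (\<lambda>i. (a i)\<^sup>2) {i \<in> nonneg_idx. \<exists>\<tau>. int m \<le> i \<tau>})"

definition Delta :: "(('d::finite \<Rightarrow> int) \<Rightarrow> real) \<Rightarrow> nat \<Rightarrow> real" where
  "Delta a n = (\<Sum>k\<in>(box 1 (int n) :: ('d \<Rightarrow> int) set).
       A_coef a (\<lambda>\<tau>. k \<tau> - 1) / (\<Prod>\<tau>\<in>UNIV. sqrt (real_of_int (k \<tau>))))"

definition kde :: "(real \<Rightarrow> real) \<Rightarrow> (nat \<Rightarrow> real) \<Rightarrow> (('d::finite \<Rightarrow> int) \<Rightarrow> 'a \<Rightarrow> real)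
    \<Rightarrow> nat \<Rightarrow> real \<Rightarrow> 'a \<Rightarrow> real" where
  "kde K b X n x \<omega> = (1 / (real n ^ CARD('d) * b n)) *
      (\<Sum>i\<in>(box 1 (int n) :: ('d \<Rightarrow> int) set). K ((x - X i \<omega>) / b n))"

definition normal_law :: "real \<Rightarrow> real \<Rightarrow> real measure" where
  "normal_law \<mu> s2 = (if s2 = 0 then return borel \<mu>
      else density lborel (\<lambda>x. ennreal (normal_density \<mu> (sqrt s2) x)))"

definition lipschitz_with :: "real \<Rightarrow> (real \<Rightarrow> real) \<Rightarrow> bool" where
  "lipschitz_with c f \<longleftrightarrow> (\<forall>x y. \<bar>f x - f y\<bar> \<le> c * \<bar>x - y\<bar>)"

end

theory Submission
  imports Defs
begin

text \<open>
  With \<open>h u = K ((x - u) / b n)\<close>, the centred estimator is the sum over the box \<open>[1,n]^d\<close> of the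
  centred variables \<open>h (X i)\<close>, divided by \<open>sqrt (n^d b n)\<close>. By the Lipschitz continuity of \<open>K\<close>,
  \<open>X i\<close> may be replaced by \<open>Xtrunc N i\<close> with a very large \<open>N\<close>, so that only finitely many
  innovations matter.

  Passing from \<open>N\<close> to \<open>m = m n\<close>: put \<open>D i = h (Xtrunc N i) - h (Xtrunc m i)\<close>, centred. The conditional
  expectation \<open>V i k\<close> of \<open>D i\<close> given the innovations with index \<open>\<preceq> k\<close> has norm \<open>O(b n * A (i - k))\<close> for
  \<open>k \<noteq> i\<close>, because integrating out a box of innovations turns \<open>h\<close> into a function with Lipschitz
  constant \<open>b n * c0\<close>, while \<open>D i\<close> itself has norm \<open>O(sqrt (B m))\<close>. Along the dyadic times
  \<open>i - 2^s + 1\<close> (\<open>s\<close> ranging over \<open>N^d\<close>), \<open>D i\<close> telescopes in each of the \<open>d\<close> directions into increments of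
  \<open>V i\<close>; increments of scale \<open>r\<close> at lattice points more than \<open>2^r\<close> apart in some direction are
  orthogonal. Summing over the scales gives the bound \<open>O(n^(d/2) (b n * Delta n + sqrt (B m)))\<close>,
  which is what (C1) and (C2) control.

  The field \<open>h (Xtrunc m i)\<close> is \<open>m\<close>-dependent. Cut the box into cubes of side \<open>l\<close> separated by corridors
  of width \<open>m\<close>, where \<open>m / l \<rightarrow> 0\<close>, \<open>l / n \<rightarrow> 0\<close> and \<open>l^d b n \<rightarrow> 0\<close>. The corridors are
  negligible in mean square and the cube sums are i.i.d. As \<open>h \<ge> 0\<close> and \<open>l^d b n \<rightarrow> 0\<close>, the bound
  \<open>E (h (Xtrunc m i) h (Xtrunc m j)) = O((b n)^2)\<close> for \<open>i \<noteq> j\<close> makes all off-diagonal terms in a cube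
  negligible; this yields the Lindeberg condition, and the limit follows from the third order
  expansion of the characteristic function and from Levy's theorem.
\<close>

subsection \<open>Square-integrable random variables\<close>

text \<open>Two obstacles shape the estimates. The Lipschitz constant \<open>L / b n\<close> of
  \<open>h\<close> explodes; averaging over any full window of innovations moves a shift of the
  argument onto a density, so that \<open>c0\<close> times the integral \<open>b n\<close> of
  \<open>h\<close> takes its place. The windows left for averaging can be arbitrarily short, which
  is why one \<open>c0\<close> serves all truncation levels. Secondly, adding norms site by site
  would lose the square root gained from orthogonality. At scale \<open>r\<close> a site can only
  correlate with about \<open>2 ^ r \<tau>\<close> sites per direction; the square root of that
  count, times the tail \<open>A_coef\<close> at that distance, summed over the scales, is a Cauchy
  condensation of \<open>Delta\<close>. Conditional expectations are partial integrals over finitely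
  many innovations, and \<open>N\<close> is chosen after \<open>n\<close> with an arbitrary error,
  against bounds that do not involve \<open>N\<close>. After division by
  \<open>sqrt (n^d b n)\<close> the long-range bound becomes (C1) plus the square root of (C2); (C3)
  makes room for the cube length \<open>l\<close> and keeps the variance per site in the corridors
  bounded, and (C4) gives \<open>m / n \<rightarrow> 0\<close>.\<close>

context prob_space
begin

definition L2 :: "('a \<Rightarrow> real) set" where
  "L2 = {f \<in> borel_measurable M. integrable M (\<lambda>\<omega>. (f \<omega>)\<^sup>2)}"

definition l2 :: "('a \<Rightarrow> real) \<Rightarrow> real" where
  "l2 f = sqrt (expectation (\<lambda>\<omega>. (f \<omega>)\<^sup>2))"

lemma L2_measurable: "f \<in> L2 \<Longrightarrow> f \<in> borel_measurable M"
  and L2_square: "f \<in> L2 \<Longrightarrow> integrable M (\<lambda>\<omega>. (f \<omega>)\<^sup>2)"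
  by (auto simp: L2_def)

lemma L2_mult:
  assumes "f \<in> L2" "g \<in> L2"
  shows "integrable M (\<lambda>\<omega>. f \<omega> * g \<omega>)"
proof (rule Bochner_Integration.integrable_bound)
  show "integrable M (\<lambda>\<omega>. (f \<omega>)\<^sup>2 + (g \<omega>)\<^sup>2)"
    using assms by (auto simp: L2_def)
  show "(\<lambda>\<omega>. f \<omega> * g \<omega>) \<in> borel_measurable M"
    using assms by (auto simp: L2_def)
  show "AE \<omega> in M. norm (f \<omega> * g \<omega>) \<le> norm ((f \<omega>)\<^sup>2 + (g \<omega>)\<^sup>2)"
  proof (rule AE_I2)
    fix \<omega>
    have "2 * (\<bar>f \<omega>\<bar> * \<bar>g \<omega>\<bar>) \<le> (f \<omega>)\<^sup>2 + (g \<omega>)\<^sup>2"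
      using sum_squares_bound[of "\<bar>f \<omega>\<bar>" "\<bar>g \<omega>\<bar>"] by simp
    moreover have "0 \<le> \<bar>f \<omega>\<bar> * \<bar>g \<omega>\<bar>" by simp
    ultimately show "norm (f \<omega> * g \<omega>) \<le> norm ((f \<omega>)\<^sup>2 + (g \<omega>)\<^sup>2)"
      unfolding real_norm_def abs_mult by linarith
  qed
qed

lemma L2_bounded:
  assumes "f \<in> borel_measurable M" "\<And>\<omega>. \<bar>f \<omega>\<bar> \<le> B"
  shows "f \<in> L2"
proof -
  have "integrable M (\<lambda>\<omega>. (f \<omega>)\<^sup>2)"
  proof (rule integrable_const_bound[where B = "B\<^sup>2"])
    have "(f \<omega>)\<^sup>2 \<le> B\<^sup>2" for \<omega>
      using assms(2)[of \<omega>] by (metis abs_ge_zero power2_abs power_mono)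
    then show "AE \<omega> in M. norm ((f \<omega>)\<^sup>2) \<le> B\<^sup>2" by auto
    show "(\<lambda>\<omega>. (f \<omega>)\<^sup>2) \<in> borel_measurable M" using assms by auto
  qed
  then show ?thesis using assms by (auto simp: L2_def)
qed

lemma L2_const: "(\<lambda>\<omega>. c) \<in> L2"
  by (rule L2_bounded[where B = "\<bar>c\<bar>"]) auto

lemma L2_cmult: "f \<in> L2 \<Longrightarrow> (\<lambda>\<omega>. c * f \<omega>) \<in> L2"
  by (auto simp: L2_def power_mult_distrib)

lemma L2_add:
  assumes "f \<in> L2" "g \<in> L2"
  shows "(\<lambda>\<omega>. f \<omega> + g \<omega>) \<in> L2"
  using assms L2_mult[OF assms] unfolding L2_def
  by (auto simp: power2_sum mult.assoc)

lemma L2_diff: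
  assumes "f \<in> L2" "g \<in> L2"
  shows "(\<lambda>\<omega>. f \<omega> - g \<omega>) \<in> L2"
  using L2_add[OF assms(1) L2_cmult[OF assms(2), of "-1"]] by simp

lemma L2_sum: "(\<And>j. j \<in> J \<Longrightarrow> f j \<in> L2) \<Longrightarrow> (\<lambda>\<omega>. \<Sum>j\<in>J. f j \<omega>) \<in> L2"
  by (induction J rule: infinite_finite_induct) (auto intro: L2_const L2_add)

lemma L2_integrable: "f \<in> L2 \<Longrightarrow> integrable M f"
  using L2_mult[OF _ L2_const[of 1]] by simp

lemma l2_nonneg: "0 \<le> l2 f"
  by (simp add: l2_def)

lemma l2_square: "(l2 f)\<^sup>2 = expectation (\<lambda>\<omega>. (f \<omega>)\<^sup>2)"
  by (simp add: l2_def)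

lemma l2_leI: "expectation (\<lambda>\<omega>. (f \<omega>)\<^sup>2) \<le> c\<^sup>2 \<Longrightarrow> 0 \<le> c \<Longrightarrow> l2 f \<le> c"
  unfolding l2_def by (rule real_le_lsqrt) auto

text \<open>Cauchy-Schwarz from the nonnegative quadratic form \<open>q\<close> in \<open>s\<close>
  and \<open>t\<close>. For \<open>b \<noteq> 0\<close> the choice \<open>s = b\<close>,
  \<open>t = - c\<close> gives \<open>b * (a * b - c\<^sup>2)\<close>; for \<open>b = 0\<close> the
  form at \<open>s = 1\<close> is affine in \<open>t\<close> and would take the value -1 unless
  \<open>c = 0\<close>.\<close>

lemma expectation_mult_le_l2:
  assumes f: "f \<in> L2" and g: "g \<in> L2"
  shows "\<bar>expectation (\<lambda>\<omega>. f \<omega> * g \<omega>)\<bar> \<le> l2 f * l2 g"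
proof -
  define a where "a = expectation (\<lambda>\<omega>. (f \<omega>)\<^sup>2)"
  define b where "b = expectation (\<lambda>\<omega>. (g \<omega>)\<^sup>2)"
  define c where "c = expectation (\<lambda>\<omega>. f \<omega> * g \<omega>)"
  have a0: "0 \<le> a" and b0: "0 \<le> b" by (auto simp: a_def b_def)
  have q: "0 \<le> s\<^sup>2 * a + 2 * s * t * c + t\<^sup>2 * b" for s t
  proof -
    have "0 \<le> expectation (\<lambda>\<omega>. (s * f \<omega> + t * g \<omega>)\<^sup>2)" by simp
    also have "(\<lambda>\<omega>. (s * f \<omega> + t * g \<omega>)\<^sup>2)
        = (\<lambda>\<omega>. s\<^sup>2 * (f \<omega>)\<^sup>2 + 2 * s * t * (f \<omega> * g \<omega>) + t\<^sup>2 * (g \<omega>)\<^sup>2)"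
      by (auto simp: power2_eq_square algebra_simps)
    also have "expectation \<dots> = s\<^sup>2 * a + 2 * s * t * c + t\<^sup>2 * b"
      unfolding a_def b_def c_def
      using L2_square[OF f] L2_square[OF g] L2_mult[OF f g] by simp
    finally show ?thesis .
  qed
  have "c\<^sup>2 \<le> a * b"
  proof (cases "b = 0")
    case True
    have "c = 0"
    proof (rule ccontr)
      assume "c \<noteq> 0"
      have "0 \<le> a + 2 * (- (a + 1) / (2 * c)) * c"
        using q[of 1 "- (a + 1) / (2 * c)"] True by simp
      also have "\<dots> = - 1" using \<open>c \<noteq> 0\<close> by (simp add: field_simps)
      finally show False by simp
    qed
    then show ?thesis using a0 b0 by simp
  next
    case False
    have "0 \<le> b\<^sup>2 * a + 2 * b * (- c) * c + (- c)\<^sup>2 * b" by (rule q)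
    also have "\<dots> = b * (a * b - c\<^sup>2)" by (simp add: power2_eq_square algebra_simps)
    finally show ?thesis using False b0 by (simp add: zero_le_mult_iff)
  qed
  then have "sqrt (c\<^sup>2) \<le> sqrt (a * b)" by (rule real_sqrt_le_mono)
  then show ?thesis by (simp add: real_sqrt_mult a_def b_def c_def l2_def)
qed

lemma l2_sum:
  assumes f: "\<And>j. j \<in> J \<Longrightarrow> f j \<in> L2"
  shows "l2 (\<lambda>\<omega>. \<Sum>j\<in>J. f j \<omega>) \<le> (\<Sum>j\<in>J. l2 (f j))"
proof (rule l2_leI)
  have "expectation (\<lambda>\<omega>. (\<Sum>j\<in>J. f j \<omega>)\<^sup>2) = (\<Sum>i\<in>J. \<Sum>j\<in>J. expectation (\<lambda>\<omega>. f i \<omega> * f j \<omega>))"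
    unfolding power2_eq_square sum_product
    using L2_mult f by (subst Bochner_Integration.integral_sum, force intro!: Bochner_Integration.integrable_sum)
      (auto intro!: sum.cong Bochner_Integration.integral_sum)
  also have "\<dots> \<le> (\<Sum>i\<in>J. \<Sum>j\<in>J. l2 (f i) * l2 (f j))"
    using expectation_mult_le_l2 f by (intro sum_mono) (meson abs_le_D1)
  also have "\<dots> = (\<Sum>j\<in>J. l2 (f j))\<^sup>2"
    by (simp add: power2_eq_square sum_product)
  finally show "expectation (\<lambda>\<omega>. (\<Sum>j\<in>J. f j \<omega>)\<^sup>2) \<le> (\<Sum>j\<in>J. l2 (f j))\<^sup>2" .
qed (simp add: sum_nonneg l2_nonneg)

lemma l2_cmult: "l2 (\<lambda>\<omega>. c * f \<omega>) = \<bar>c\<bar> * l2 f"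
  by (simp add: l2_def power_mult_distrib real_sqrt_mult)

lemma l2_add:
  assumes "f \<in> L2" "g \<in> L2"
  shows "l2 (\<lambda>\<omega>. f \<omega> + g \<omega>) \<le> l2 f + l2 g"
  using l2_sum[of "{False, True}" "\<lambda>j. if j then f else g"] assms by (simp add: add.commute)

lemma l2_diff:
  assumes "f \<in> L2" "g \<in> L2"
  shows "l2 (\<lambda>\<omega>. f \<omega> - g \<omega>) \<le> l2 f + l2 g"
  using l2_add[OF assms(1) L2_cmult[OF assms(2), of "-1"]] l2_cmult[of "-1" g] by simp

lemma expectation_abs_le_l2:
  assumes "f \<in> L2"
  shows "expectation (\<lambda>\<omega>. \<bar>f \<omega>\<bar>) \<le> l2 f"
proof -
  have "(\<lambda>\<omega>. \<bar>f \<omega>\<bar>) \<in> L2" using assms by (auto simp: L2_def)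
  from expectation_mult_le_l2[OF this L2_const[of 1]] show ?thesis
    by (simp add: l2_def prob_space)
qed

text \<open>The mean is the best constant in mean square. A centred variable can therefore be
  bounded with any convenient reference value in place of its mean.\<close>

lemma variance_le_square:
  assumes "f \<in> L2"
  shows "expectation (\<lambda>\<omega>. (f \<omega> - expectation f)\<^sup>2) \<le> expectation (\<lambda>\<omega>. (f \<omega> - c)\<^sup>2)"
proof -
  have [simp]: "integrable M f" "integrable M (\<lambda>\<omega>. (f \<omega>)\<^sup>2)"
    using L2_integrable L2_square assms by auto
  have *: "expectation (\<lambda>\<omega>. (f \<omega> - e)\<^sup>2) = expectation (\<lambda>\<omega>. (f \<omega>)\<^sup>2) - 2 * e * expectation f + e\<^sup>2" for e
    by (simp add: power2_diff prob_space algebra_simps)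
  show ?thesis
    unfolding * using zero_le_power2[of "expectation f - c"]
    by (simp add: power2_eq_square algebra_simps)
qed

text \<open>Fubini for the product law of an independent pair. The inner expectation over
  \<open>\<omega>'\<close> is the conditional expectation given \<open>X\<close>, in a version
  defined at every \<open>\<omega>\<close>.\<close>

lemma indep_var_expectation:
  fixes F :: "'b \<times> 'b \<Rightarrow> real"
  assumes ind: "indep_var S X T Y" and F[measurable]: "F \<in> borel_measurable (S \<Otimes>\<^sub>M T)"
    and B: "\<And>z. \<bar>F z\<bar> \<le> B"
  shows "expectation (\<lambda>\<omega>. F (X \<omega>, Y \<omega>)) = expectation (\<lambda>\<omega>. expectation (\<lambda>\<omega>'. F (X \<omega>, Y \<omega>')))"
proof -
  from ind have [measurable]: "random_variable S X" "random_variable T Y"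
    and eq: "distr M S X \<Otimes>\<^sub>M distr M T Y = distr M (S \<Otimes>\<^sub>M T) (\<lambda>x. (X x, Y x))"
    by (auto simp: indep_var_distribution_eq)
  interpret PX: prob_space "distr M S X" by (rule prob_space_distr) simp
  interpret PY: prob_space "distr M T Y" by (rule prob_space_distr) simp
  interpret P: pair_prob_space "distr M S X" "distr M T Y" ..
  have int: "integrable (distr M S X \<Otimes>\<^sub>M distr M T Y) F"
    by (rule P.integrable_const_bound[where B = B]) (use B in auto)
  have "expectation (\<lambda>\<omega>. F (X \<omega>, Y \<omega>)) = (\<integral>z. F z \<partial>(distr M S X \<Otimes>\<^sub>M distr M T Y))"
    unfolding eq by (subst integral_distr) auto
  also have "\<dots> = (\<integral>x. \<integral>y. F (x, y) \<partial>distr M T Y \<partial>distr M S X)"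
    by (rule P.integral_fst'[symmetric, OF int])
  also have "\<dots> = expectation (\<lambda>\<omega>. \<integral>y. F (X \<omega>, y) \<partial>distr M T Y)"
    by (subst integral_distr) auto
  also have "\<dots> = expectation (\<lambda>\<omega>. expectation (\<lambda>\<omega>'. F (X \<omega>, Y \<omega>')))"
    by (intro Bochner_Integration.integral_cong refl, subst integral_distr)
       (use measurable_space[of X M S] in auto)
  finally show ?thesis .
qed

end

subsection \<open>Almost orthogonal sums over a box\<close>

text \<open>Pairing \<open>D\<close> with \<open>insert t D\<close> cancels the signs. A mixed
  difference therefore vanishes as soon as its argument ignores one direction; both the telescoping
  and the orthogonality of the increments come from this.\<close>

lemma alternating_sum_Pow_eq_0:
  fixes g :: "'b set \<Rightarrow> real"
  assumes "finite A" "t \<in> A" and g: "\<And>D. D \<subseteq> A - {t} \<Longrightarrow> g (insert t D) = g D"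
  shows "(\<Sum>D\<in>Pow A. (-1) ^ card D * g D) = 0"
proof -
  let ?A = "A - {t}"
  have A: "A = insert t ?A" using assms by auto
  have fin: "finite ?A" using assms by auto
  have inj: "inj_on (insert t) (Pow ?A)"
    by (rule inj_onI) blast
  have "(\<Sum>D\<in>Pow A. (-1) ^ card D * g D)
      = (\<Sum>D\<in>Pow ?A. (-1) ^ card D * g D) + (\<Sum>D\<in>insert t ` Pow ?A. (-1) ^ card D * g D)"
    by (subst A, subst Pow_insert, rule sum.union_disjoint) (use fin in auto)
  also have "(\<Sum>D\<in>insert t ` Pow ?A. (-1) ^ card D * g D)
      = (\<Sum>D\<in>Pow ?A. (-1) ^ card (insert t D) * g (insert t D))"
    using inj by (simp add: sum.reindex)
  also have "\<dots> = (\<Sum>D\<in>Pow ?A. - ((-1) ^ card D * g D))"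
  proof (rule sum.cong[OF refl])
    fix D assume D: "D \<in> Pow ?A"
    then have "finite D" "t \<notin> D" using fin finite_subset by auto
    then show "(-1) ^ card (insert t D) * g (insert t D) = - ((-1) ^ card D * g D)"
      using g D by simp
  qed
  finally show ?thesis by (simp add: sum_negf)
qed

text \<open>The inner sum is a mixed first difference of \<open>f\<close> at \<open>r\<close>, one
  difference per direction, so summing over the box telescopes in all directions at once. Only the
  corner at the origin survives, because \<open>f\<close> vanishes beyond \<open>R\<close>.\<close>

lemma alternating_telescope:
  fixes f :: "('d::finite \<Rightarrow> nat) \<Rightarrow> real"
  assumes zero: "\<And>s t. s t > R \<Longrightarrow> f s = 0"
  shows "(\<Sum>r\<in>PiE UNIV (\<lambda>_. {..R}). \<Sum>D\<in>Pow UNIV. (-1) ^ card D * f (\<lambda>\<tau>. r \<tau> + of_bool (\<tau> \<in> D)))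
    = f (\<lambda>_. 0)"
proof -
  let ?B = "PiE (UNIV :: 'd set) (\<lambda>_. {..R})"
  let ?sup = "\<lambda>s :: 'd \<Rightarrow> nat. {\<tau>. 0 < s \<tau>}"
  have finB: "finite ?B" by (intro finite_PiE) auto
  \<comment> \<open>Shifting by \<open>D\<close> reaches the box points that are positive on
    \<open>D\<close>, and besides them only points outside the box, where \<open>f\<close> is
    zero.\<close>
  have shift: "(\<Sum>r\<in>?B. f (\<lambda>\<tau>. r \<tau> + of_bool (\<tau> \<in> D))) = (\<Sum>s\<in>?B. if D \<subseteq> ?sup s then f s else 0)" for D
  proof -
    let ?h = "\<lambda>r \<tau>. r \<tau> + of_bool (\<tau> \<in> D) :: nat"
    have inj: "inj_on ?h ?B" by (rule inj_onI) (auto simp: fun_eq_iff)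
    have "(\<Sum>r\<in>?B. f (?h r)) = (\<Sum>s\<in>?h ` ?B. f s)"
      using inj by (simp add: sum.reindex)
    also have "\<dots> = (\<Sum>s\<in>{s\<in>?B. D \<subseteq> ?sup s}. f s)"
    proof (rule sum.mono_neutral_right)
      show "{s \<in> ?B. D \<subseteq> ?sup s} \<subseteq> ?h ` ?B"
      proof
        fix s assume s: "s \<in> {s \<in> ?B. D \<subseteq> ?sup s}"
        then have "s = ?h (\<lambda>\<tau>. s \<tau> - of_bool (\<tau> \<in> D))" by (auto simp: fun_eq_iff)
        moreover have "(\<lambda>\<tau>. s \<tau> - of_bool (\<tau> \<in> D)) \<in> ?B"
          using s by (auto simp: PiE_def Pi_def extensional_def intro: le_trans[OF diff_le_self])
        ultimately show "s \<in> ?h ` ?B" by (rule image_eqI)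
      qed
      show "\<forall>s\<in>?h ` ?B - {s \<in> ?B. D \<subseteq> ?sup s}. f s = 0"
      proof
        fix s assume s: "s \<in> ?h ` ?B - {s \<in> ?B. D \<subseteq> ?sup s}"
        then have "D \<subseteq> ?sup s" by auto
        with s have "s \<notin> ?B" by auto
        then obtain t where "s t > R" by (auto simp: PiE_def Pi_def extensional_def not_le)
        then show "f s = 0" by (rule zero)
      qed
    qed (use finB in auto)
    also have "\<dots> = (\<Sum>s\<in>?B. if D \<subseteq> ?sup s then f s else 0)"
      using finB by (simp add: sum.inter_filter)
    finally show ?thesis .
  qed
  \<comment> \<open>The weight of \<open>f s\<close> is now a signed count of the subsets of its
    support, which is zero unless the support is empty.\<close>
  have alt: "(\<Sum>D\<in>Pow UNIV. (-1) ^ card D * (if D \<subseteq> ?sup s then f s else 0)) = (if s = (\<lambda>_. 0) then f s else 0)"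
    for s
  proof -
    have "(\<Sum>D\<in>Pow UNIV. (-1) ^ card D * (if D \<subseteq> ?sup s then f s else 0))
        = (\<Sum>D\<in>Pow UNIV. if D \<subseteq> ?sup s then (-1) ^ card D * f s else 0)"
      by (intro sum.cong) auto
    also have "\<dots> = (\<Sum>D\<in>Pow (?sup s). (-1) ^ card D * f s)"
      by (subst sum.inter_filter[symmetric]) (auto intro!: sum.cong)
    also have "\<dots> = (if s = (\<lambda>_. 0) then f s else 0)"
    proof (cases "?sup s = {}")
      case True
      then have s: "s = (\<lambda>_. 0)" by auto
      then show ?thesis by simp
    next
      case False
      then obtain t where t: "t \<in> ?sup s" by blast
      then have "s \<noteq> (\<lambda>_. 0)" by auto
      then show ?thesis using alternating_sum_Pow_eq_0[OF _ t, of "\<lambda>_. f s"] by simp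
    qed
    finally show ?thesis .
  qed
  have "(\<Sum>r\<in>?B. \<Sum>D\<in>Pow UNIV. (-1) ^ card D * f (\<lambda>\<tau>. r \<tau> + of_bool (\<tau> \<in> D)))
      = (\<Sum>D\<in>Pow UNIV. (-1) ^ card D * (\<Sum>r\<in>?B. f (\<lambda>\<tau>. r \<tau> + of_bool (\<tau> \<in> D))))"
    by (subst sum.swap) (simp add: sum_distrib_left)
  also have "\<dots> = (\<Sum>s\<in>?B. \<Sum>D\<in>Pow UNIV. (-1) ^ card D * (if D \<subseteq> ?sup s then f s else 0))"
    unfolding shift by (subst sum.swap) (simp add: sum_distrib_left)
  also have "\<dots> = f (\<lambda>_. 0)"
    unfolding alt using finB by (simp add: PiE_def Pi_def extensional_def)
  finally show ?thesis .
qed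

lemma box_eq_PiE: "box lo hi = PiE UNIV (\<lambda>_. {lo..hi})"
  by (auto simp: box_def PiE_def Pi_def extensional_def)

lemma finite_box [simp]: "finite (box lo hi)"
  unfolding box_eq_PiE by (intro finite_PiE) auto

lemma card_box: "card (box lo hi :: ('d::finite \<Rightarrow> int) set) = nat (hi + 1 - lo) ^ CARD('d)"
  unfolding box_eq_PiE by (subst card_PiE) (auto simp: algebra_simps)

lemma PiE_UNIV_iff: "f \<in> PiE UNIV A \<longleftrightarrow> (\<forall>x. f x \<in> A x)"
  by (auto simp: PiE_def Pi_def extensional_def)

context prob_space
begin

text \<open>Expand the square: pairs outside \<open>N i\<close> drop out, and each of the remaining
  at most \<open>card I * q\<close> pairs contributes at most \<open>G * G\<close> by
  Cauchy-Schwarz.\<close>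

lemma l2_sum_almost_orthogonal:
  assumes fin: "finite I" and L2: "\<And>i. i \<in> I \<Longrightarrow> Z i \<in> L2"
    and G: "\<And>i. i \<in> I \<Longrightarrow> l2 (Z i) \<le> G"
    and near: "\<And>i. i \<in> I \<Longrightarrow> N i \<subseteq> I \<and> real (card (N i)) \<le> q"
    and orth: "\<And>i j. i \<in> I \<Longrightarrow> j \<in> I - N i \<Longrightarrow> expectation (\<lambda>\<omega>. Z i \<omega> * Z j \<omega>) = 0"
  shows "expectation (\<lambda>\<omega>. (\<Sum>i\<in>I. Z i \<omega>)\<^sup>2) \<le> real (card I) * q * G\<^sup>2"
proof -
  have "expectation (\<lambda>\<omega>. (\<Sum>i\<in>I. Z i \<omega>)\<^sup>2) = (\<Sum>i\<in>I. \<Sum>j\<in>I. expectation (\<lambda>\<omega>. Z i \<omega> * Z j \<omega>))"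
    unfolding power2_eq_square sum_product
    using L2_mult L2 by (subst Bochner_Integration.integral_sum, force intro!: Bochner_Integration.integrable_sum)
      (auto intro!: sum.cong Bochner_Integration.integral_sum)
  also have "\<dots> = (\<Sum>i\<in>I. \<Sum>j\<in>N i. expectation (\<lambda>\<omega>. Z i \<omega> * Z j \<omega>))"
    using fin near orth by (intro sum.cong refl sum.mono_neutral_right) auto
  also have "\<dots> \<le> (\<Sum>i\<in>I. \<Sum>j\<in>N i. G * G)"
  proof (intro sum_mono)
    fix i j assume i: "i \<in> I" and j: "j \<in> N i"
    then have jI: "j \<in> I" using near by auto
    have "expectation (\<lambda>\<omega>. Z i \<omega> * Z j \<omega>) \<le> l2 (Z i) * l2 (Z j)"
      using expectation_mult_le_l2[OF L2[OF i] L2[OF jI]] by linarith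
    also have "\<dots> \<le> G * G"
      using G[OF i] G[OF jI] l2_nonneg by (intro mult_mono) (auto intro: order_trans[OF l2_nonneg])
    finally show "expectation (\<lambda>\<omega>. Z i \<omega> * Z j \<omega>) \<le> G * G" .
  qed
  also have "\<dots> = (\<Sum>i\<in>I. real (card (N i)) * G\<^sup>2)"
    by (simp add: power2_eq_square)
  also have "\<dots> \<le> (\<Sum>i\<in>I. q * G\<^sup>2)"
    using near by (intro sum_mono mult_right_mono) auto
  finally show ?thesis by simp
qed

text \<open>\<open>inner\<close> is the abstract trace of conditional expectation: projections onto
  the pasts of lattice points commute, so an inner product sees only the componentwise minimum of
  the two times. \<open>Z r i\<close> is the mixed dyadic increment of \<open>V i\<close> at scale
  \<open>r\<close>; orthogonality leaves only pairs of sites at distance below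
  \<open>2 ^ r \<tau>\<close> in every direction, whose number appears under the root.\<close>

lemma l2_box_sum_dyadic:
  fixes V :: "('d::finite \<Rightarrow> int) \<Rightarrow> ('d \<Rightarrow> int) \<Rightarrow> 'a \<Rightarrow> real"
  assumes L2: "\<And>i k. V i k \<in> L2"
    and inner: "\<And>i i' k k'. expectation (\<lambda>\<omega>. V i k \<omega> * V i' k' \<omega>) = \<Phi> i i' (\<lambda>\<tau>. min (k \<tau>) (k' \<tau>))"
    and bound: "\<And>i s. l2 (V i (\<lambda>\<tau>. i \<tau> - 2 ^ s \<tau> + 1)) \<le> g s"
    and anti: "\<And>r s. (\<And>\<tau>. r \<tau> \<le> s \<tau>) \<Longrightarrow> g s \<le> g r"
    and n: "n < 2 ^ (R + 1)"
  shows "l2 (\<lambda>\<omega>. \<Sum>i\<in>box 1 (int n). V i i \<omega>)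
    \<le> (\<Sum>r\<in>PiE UNIV (\<lambda>_. {..R}). sqrt (real n ^ CARD('d) * (\<Prod>\<tau>\<in>UNIV. 2 * 2 ^ r \<tau>)) * (2 ^ CARD('d) * g r))"
proof -
  let ?B = "PiE (UNIV :: 'd set) (\<lambda>_. {..R})"
  let ?I = "box 1 (int n) :: ('d \<Rightarrow> int) set"
  have finB: "finite ?B" by (intro finite_PiE) auto
  define k where "k i s = (\<lambda>\<tau>. i \<tau> - 2 ^ s \<tau> + 1)" for i :: "'d \<Rightarrow> int" and s :: "'d \<Rightarrow> nat"
  \<comment> \<open>Beyond \<open>R\<close> the conditional expectation is replaced by zero, which
    makes the telescope finite. Directions with \<open>r \<tau> = R\<close> lose orthogonality, but
    there the whole side of the box fits into the count, as \<open>n < 2 * 2 ^ R\<close>.\<close>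
  define f where "f i s \<omega> = (if \<exists>\<tau>. s \<tau> > R then 0 else V i (k i s) \<omega>)" for i s \<omega>
  define up where "up r D = (\<lambda>\<tau>. r \<tau> + of_bool (\<tau> \<in> D) :: nat)" for r :: "'d \<Rightarrow> nat" and D
  define Z where "Z r i \<omega> = (\<Sum>D\<in>Pow UNIV. (-1) ^ card D * f i (up r D) \<omega>)" for r i \<omega>
  have g0: "0 \<le> g s" for s using order_trans[OF l2_nonneg bound] .
  have fL2: "f i s \<in> L2" for i s
    using L2 L2_const[of 0] by (cases "\<exists>\<tau>. s \<tau> > R") (auto simp: f_def[abs_def])
  have ZL2: "Z r i \<in> L2" for r i
    unfolding Z_def by (intro L2_sum L2_cmult fL2)
  have dec: "V i i \<omega> = (\<Sum>r\<in>?B. Z r i \<omega>)" for i \<omega>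
  proof -
    have "(\<Sum>r\<in>?B. Z r i \<omega>) = f i (\<lambda>_. 0) \<omega>"
      unfolding Z_def up_def by (rule alternating_telescope[where f = "\<lambda>s. f i s \<omega>"]) (auto simp: f_def)
    then show ?thesis by (simp add: f_def k_def)
  qed
  have fbound: "l2 (f i (up r D)) \<le> g r" for i r D
  proof -
    have "l2 (f i (up r D)) \<le> g (up r D)"
      using bound[of i "up r D"] g0[of "up r D"]
      by (cases "\<exists>\<tau>. up r D \<tau> > R") (simp_all add: f_def[abs_def] k_def l2_def)
    also have "\<dots> \<le> g r" by (rule anti) (auto simp: up_def)
    finally show ?thesis .
  qed
  have Zbound: "l2 (Z r i) \<le> 2 ^ CARD('d) * g r" for r i
  proof -
    have "l2 (Z r i) \<le> (\<Sum>D\<in>Pow UNIV. l2 (\<lambda>\<omega>. (-1) ^ card D * f i (up r D) \<omega>))"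
      unfolding Z_def by (intro l2_sum L2_cmult fL2)
    also have "\<dots> = (\<Sum>D\<in>Pow UNIV. l2 (f i (up r D)))"
      by (simp add: l2_cmult power_abs)
    also have "\<dots> \<le> (\<Sum>D\<in>Pow (UNIV :: 'd set). g r)"
      by (intro sum_mono fbound)
    also have "\<dots> = 2 ^ CARD('d) * g r" by (simp add: card_Pow)
    finally show ?thesis .
  qed
  have orth1: "expectation (\<lambda>\<omega>. Z r i \<omega> * Z r j \<omega>) = 0"
    if rt: "r t < R" and ij: "j t + 2 ^ r t \<le> i t" for r i j t
  proof -
    have "expectation (\<lambda>\<omega>. Z r i \<omega> * Z r j \<omega>)
        = expectation (\<lambda>\<omega>. \<Sum>D\<in>Pow UNIV. \<Sum>D'\<in>Pow UNIV. ((-1) ^ card D * (-1) ^ card D') * (f i (up r D) \<omega> * f j (up r D') \<omega>))"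
      unfolding Z_def sum_product by (intro Bochner_Integration.integral_cong sum.cong) (auto simp: mult_ac)
    also have "\<dots> = (\<Sum>D\<in>Pow UNIV. \<Sum>D'\<in>Pow UNIV. ((-1) ^ card D * (-1) ^ card D') *
        expectation (\<lambda>\<omega>. f i (up r D) \<omega> * f j (up r D') \<omega>))"
      by (simp add: Bochner_Integration.integral_sum
        Bochner_Integration.integrable_sum L2_mult fL2)
    also have "\<dots> = (\<Sum>D'\<in>Pow UNIV. (-1) ^ card D' * (\<Sum>D\<in>Pow UNIV. (-1) ^ card D *
        expectation (\<lambda>\<omega>. f i (up r D) \<omega> * f j (up r D') \<omega>)))"
      by (subst sum.swap) (simp add: sum_distrib_left mult_ac)
    also have "\<dots> = (\<Sum>D'\<in>Pow (UNIV :: 'd set). 0)"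
    proof (intro sum.cong refl)
      fix D' :: "'d set"
      have "(\<Sum>D\<in>Pow UNIV. (-1) ^ card D * expectation (\<lambda>\<omega>. f i (up r D) \<omega> * f j (up r D') \<omega>)) = 0"
      proof (rule alternating_sum_Pow_eq_0[where t = t])
        fix D :: "'d set" assume D: "D \<subseteq> UNIV - {t}"
        \<comment> \<open>\<open>r t < R\<close> keeps the raised exponent \<open>r t + 1\<close> in
          range, so inserting \<open>t\<close> cannot trigger the cut-off in
          \<open>f\<close>.\<close>
        have same: "(\<exists>\<tau>. up r (insert t D) \<tau> > R) \<longleftrightarrow> (\<exists>\<tau>. up r D \<tau> > R)"
        proof -
          have "up r (insert t D) \<tau> > R \<longleftrightarrow> up r D \<tau> > R" for \<tau>
            using rt by (cases "\<tau> = t") (auto simp: up_def)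
          then show ?thesis by simp
        qed
        \<comment> \<open>The site \<open>i\<close> is at least \<open>2 ^ r t\<close> ahead of
          \<open>j\<close> in direction \<open>t\<close>. Even at exponent \<open>r t + 1\<close>
          its time there is no earlier than either time of \<open>j\<close>, so the minimum is the
          time of \<open>j\<close> whether or not \<open>t\<close> was inserted.\<close>
        have "min (k i (up r (insert t D)) \<tau>) (k j (up r D') \<tau>) = min (k i (up r D) \<tau>) (k j (up r D') \<tau>)" for \<tau>
        proof (cases "\<tau> = t")
          case True
          define p :: int where "p = 2 ^ r t"
          have "p > 0" by (simp add: p_def)
          then show ?thesis using True ij D
            by (cases "t \<in> D'") (auto simp: k_def up_def min_def p_def[symmetric])
        qed (auto simp: k_def up_def)
        then have "expectation (\<lambda>\<omega>. V i (k i (up r (insert t D))) \<omega> * V j (k j (up r D')) \<omega>)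
            = expectation (\<lambda>\<omega>. V i (k i (up r D)) \<omega> * V j (k j (up r D')) \<omega>)"
          by (simp add: inner)
        then show "expectation (\<lambda>\<omega>. f i (up r (insert t D)) \<omega> * f j (up r D') \<omega>)
            = expectation (\<lambda>\<omega>. f i (up r D) \<omega> * f j (up r D') \<omega>)"
          by (cases "\<exists>\<tau>. up r D \<tau> > R"; cases "\<exists>\<tau>. up r D' \<tau> > R") (simp_all add: f_def same)
      qed auto
      then show "(-1) ^ card D' * (\<Sum>D\<in>Pow UNIV. (-1) ^ card D * expectation (\<lambda>\<omega>. f i (up r D) \<omega> * f j (up r D') \<omega>)) = 0"
        by simp
    qed
    finally show ?thesis by simp
  qed
  have main: "l2 (\<lambda>\<omega>. \<Sum>i\<in>?I. Z r i \<omega>)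
      \<le> sqrt (real n ^ CARD('d) * (\<Prod>\<tau>\<in>UNIV. 2 * 2 ^ r \<tau>)) * (2 ^ CARD('d) * g r)" if r: "r \<in> ?B" for r
  proof -
    \<comment> \<open>Being close in every direction is a product condition, so the neighbours of
      \<open>i\<close> are counted direction by direction.\<close>
    define W where "W i \<tau> = {l \<in> {1..int n}. r \<tau> < R \<longrightarrow> \<bar>l - i \<tau>\<bar> < 2 ^ r \<tau>}" for i :: "'d \<Rightarrow> int" and \<tau>
    have cW: "card (W i \<tau>) \<le> 2 * 2 ^ r \<tau>" for i \<tau>
    proof (cases "r \<tau> < R")
      case True
      have "card (W i \<tau>) \<le> card {i \<tau> - 2 ^ r \<tau> <..< i \<tau> + 2 ^ r \<tau>}"
        using True by (intro card_mono) (auto simp: W_def)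
      also have "\<dots> = nat (2 * 2 ^ r \<tau> - 1)" by simp
      also have "\<dots> \<le> 2 * 2 ^ r \<tau>" by (simp add: nat_le_iff)
      finally show ?thesis .
    next
      case False
      then have rR: "r \<tau> = R" using r by (auto simp: PiE_UNIV_iff not_less intro: antisym)
      have "card (W i \<tau>) \<le> card {1..int n}" by (intro card_mono) (auto simp: W_def)
      also have "\<dots> = n" by simp
      also have "\<dots> \<le> 2 * 2 ^ r \<tau>" using n rR by simp
      finally show ?thesis .
    qed
    have "expectation (\<lambda>\<omega>. (\<Sum>i\<in>?I. Z r i \<omega>)\<^sup>2)
        \<le> real (card ?I) * (\<Prod>\<tau>\<in>UNIV. 2 * 2 ^ r \<tau>) * (2 ^ CARD('d) * g r)\<^sup>2"
    proof (rule l2_sum_almost_orthogonal[where N = "\<lambda>i. PiE UNIV (W i)"])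
      fix i assume "i \<in> ?I"
      have "card (PiE UNIV (W i)) = (\<Prod>\<tau>\<in>UNIV. card (W i \<tau>))" by (rule card_PiE) simp
      also have "\<dots> \<le> (\<Prod>\<tau>\<in>UNIV. 2 * 2 ^ r \<tau>)" using cW by (intro prod_mono) auto
      finally have "real (card (PiE UNIV (W i))) \<le> real (\<Prod>\<tau>\<in>UNIV. 2 * 2 ^ r \<tau>)"
        by (rule of_nat_mono)
      then show "PiE UNIV (W i) \<subseteq> ?I \<and> real (card (PiE UNIV (W i))) \<le> (\<Prod>\<tau>\<in>UNIV. 2 * 2 ^ r \<tau>)"
        by (auto simp: W_def box_eq_PiE PiE_UNIV_iff)
    next
      fix i j assume "i \<in> ?I" and j: "j \<in> ?I - PiE UNIV (W i)"
      then obtain t where "j t \<notin> W i t" by (auto simp: PiE_UNIV_iff)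
      with j have rt: "r t < R" and "\<bar>j t - i t\<bar> \<ge> 2 ^ r t"
        by (auto simp: W_def box_def)
      then consider "j t + 2 ^ r t \<le> i t" | "i t + 2 ^ r t \<le> j t" by linarith
      then show "expectation (\<lambda>\<omega>. Z r i \<omega> * Z r j \<omega>) = 0"
      proof cases
        case 1 then show ?thesis using orth1[of r t j i] rt by simp
      next
        case 2 then show ?thesis using orth1[of r t i j] rt by (simp add: mult.commute)
      qed
    qed (use ZL2 Zbound in auto)
    also have "\<dots> = (sqrt (real n ^ CARD('d) * (\<Prod>\<tau>\<in>UNIV. 2 * 2 ^ r \<tau>)) * (2 ^ CARD('d) * g r))\<^sup>2"
      by (simp add: card_box power_mult_distrib prod_nonneg)
    finally show ?thesis
      by (rule l2_leI) (simp add: g0 prod_nonneg)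
  qed
  have "l2 (\<lambda>\<omega>. \<Sum>i\<in>?I. V i i \<omega>) = l2 (\<lambda>\<omega>. \<Sum>r\<in>?B. \<Sum>i\<in>?I. Z r i \<omega>)"
    unfolding dec by (subst sum.swap) simp
  also have "\<dots> \<le> (\<Sum>r\<in>?B. l2 (\<lambda>\<omega>. \<Sum>i\<in>?I. Z r i \<omega>))"
    by (intro l2_sum L2_sum ZL2)
  also have "\<dots> \<le> (\<Sum>r\<in>?B. sqrt (real n ^ CARD('d) * (\<Prod>\<tau>\<in>UNIV. 2 * 2 ^ r \<tau>)) * (2 ^ CARD('d) * g r))"
    by (intro sum_mono main)
  finally show ?thesis .
qed

end

subsection \<open>Conditional expectations of linear forms in i.i.d. variables\<close>

lemma summable_on_sq_subset:
  assumes "(\<lambda>k. (a k)\<^sup>2 :: real) summable_on nonneg_idx"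
  shows "(\<lambda>k. (a k)\<^sup>2) summable_on {i \<in> nonneg_idx. P i}"
  by (rule summable_on_subset_banach[OF assms]) auto

lemma A_coef_nonneg: "0 \<le> A_coef a k"
  unfolding A_coef_def by (simp add: infsum_nonneg)

lemma A_coef_antimono:
  assumes "(\<lambda>k. (a k)\<^sup>2) summable_on nonneg_idx" and "\<And>\<tau>. k \<tau> \<le> l \<tau>"
  shows "A_coef a l \<le> A_coef a k"
  unfolding A_coef_def
proof (intro real_sqrt_le_mono infsum_mono2 summable_on_sq_subset[OF assms(1)])
  show "{i \<in> nonneg_idx. \<forall>\<tau>. l \<tau> \<le> i \<tau>} \<subseteq> {i \<in> nonneg_idx. \<forall>\<tau>. k \<tau> \<le> i \<tau>}"
    using assms(2) by (auto intro: order_trans)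
qed auto

lemma sum_sq_le_A_coef:
  assumes "(\<lambda>k. (a k)\<^sup>2) summable_on nonneg_idx" "finite T"
    "T \<subseteq> {i \<in> nonneg_idx. \<forall>\<tau>. k \<tau> \<le> i \<tau>}"
  shows "(\<Sum>i\<in>T. (a i)\<^sup>2) \<le> (A_coef a k)\<^sup>2"
proof -
  have "(\<Sum>i\<in>T. (a i)\<^sup>2) \<le> infsum (\<lambda>i. (a i)\<^sup>2) {i \<in> nonneg_idx. \<forall>\<tau>. k \<tau> \<le> i \<tau>}"
    using assms by (intro finite_sum_le_infsum summable_on_sq_subset) auto
  then show ?thesis by (simp add: A_coef_def infsum_nonneg)
qed

lemma sum_sq_le_B_coef:
  assumes "(\<lambda>k. (a k)\<^sup>2) summable_on nonneg_idx" "finite T"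
    "T \<subseteq> {i \<in> nonneg_idx. \<exists>\<tau>. int m \<le> i \<tau>}"
  shows "(\<Sum>i\<in>T. (a i)\<^sup>2) \<le> (B_coef a m)\<^sup>2"
proof -
  have "(\<Sum>i\<in>T. (a i)\<^sup>2) \<le> infsum (\<lambda>i. (a i)\<^sup>2) {i \<in> nonneg_idx. \<exists>\<tau>. int m \<le> i \<tau>}"
    using assms by (intro finite_sum_le_infsum summable_on_sq_subset) auto
  then show ?thesis by (simp add: B_coef_def infsum_nonneg)
qed

text \<open>Cauchy condensation in each of the \<open>d\<close> directions. On the dyadic block
  \<open>Q r\<close> every term of \<open>Delta\<close> is at least its value at the upper corner
  \<open>k \<tau> = 2 ^ r \<tau>\<close>, and the block has at least \<open>2 ^ r \<tau> / 2\<close>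
  points per direction; these halves make up the factor \<open>2 ^ CARD('d)\<close>.\<close>

lemma sum_dyadic_le_Delta:
  fixes a :: "('d::finite \<Rightarrow> int) \<Rightarrow> real"
  assumes a: "(\<lambda>k. (a k)\<^sup>2) summable_on nonneg_idx" and n: "2 ^ R \<le> n"
  shows "(\<Sum>r\<in>PiE UNIV (\<lambda>_. {..R}). (\<Prod>\<tau>\<in>UNIV. sqrt (2 ^ r \<tau>)) * A_coef a (\<lambda>\<tau>. 2 ^ r \<tau> - 1))
    \<le> 2 ^ CARD('d) * Delta a n"
proof -
  let ?B = "PiE (UNIV :: 'd set) (\<lambda>_. {..R})"
  \<comment> \<open>For exponent zero, \<open>1 div 2 = 0\<close> makes the side the single point 1;
    otherwise it is the upper half of \<open>{1..2 ^ r \<tau>}\<close>. Hence the blocks are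
    disjoint.\<close>
  define Q where "Q r = PiE UNIV (\<lambda>\<tau>. {2 ^ r \<tau> div 2 + 1 .. 2 ^ r \<tau> :: int})" for r :: "'d \<Rightarrow> nat"
  define F where "F k = A_coef a (\<lambda>\<tau>. k \<tau> - 1) / (\<Prod>\<tau>\<in>UNIV. sqrt (real_of_int (k \<tau>)))" for k :: "'d \<Rightarrow> int"
  have finB: "finite ?B" by (intro finite_PiE) auto
  have finQ: "finite (Q r)" for r unfolding Q_def by (intro finite_PiE) auto
  have pos: "1 \<le> k \<tau>" if "k \<in> Q r" for k r \<tau>
  proof -
    have "(2 :: int) ^ r \<tau> div 2 + 1 \<le> k \<tau>" using that by (auto simp: Q_def PiE_UNIV_iff)
    moreover have "0 \<le> (2 :: int) ^ r \<tau> div 2" by (simp add: div_int_pos_iff)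
    ultimately show ?thesis by linarith
  qed
  have block: "(\<Prod>\<tau>\<in>UNIV. sqrt (2 ^ r \<tau>)) * A_coef a (\<lambda>\<tau>. 2 ^ r \<tau> - 1) \<le> 2 ^ CARD('d) * (\<Sum>k\<in>Q r. F k)" for r
  proof -
    define P where "P = (\<Prod>\<tau>\<in>UNIV. sqrt (2 ^ r \<tau>))"
    have P0: "P > 0" unfolding P_def by (intro prod_pos) simp
    have PP: "P * P = (\<Prod>\<tau>\<in>UNIV. 2 ^ r \<tau>)"
      unfolding P_def prod.distrib[symmetric] by simp
    have "A_coef a (\<lambda>\<tau>. 2 ^ r \<tau> - 1) / P \<le> F k" if k: "k \<in> Q r" for k
      unfolding F_def
    proof (rule frac_le)
      have le: "k \<tau> \<le> 2 ^ r \<tau>" for \<tau> using k by (auto simp: Q_def PiE_UNIV_iff)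
      show "A_coef a (\<lambda>\<tau>. 2 ^ r \<tau> - 1) \<le> A_coef a (\<lambda>\<tau>. k \<tau> - 1)"
        using le by (intro A_coef_antimono[OF a]) (simp only: diff_right_mono)
      show "(\<Prod>\<tau>\<in>UNIV. sqrt (real_of_int (k \<tau>))) \<le> P" unfolding P_def
      proof (intro prod_mono conjI real_sqrt_le_mono)
        fix \<tau> show "real_of_int (k \<tau>) \<le> 2 ^ r \<tau>" using le[of \<tau>] by (metis of_int_le_iff of_int_numeral of_int_power)
        show "0 \<le> sqrt (real_of_int (k \<tau>))" using pos[OF k, of \<tau>] by simp
      qed
      show "0 < (\<Prod>\<tau>\<in>UNIV. sqrt (real_of_int (k \<tau>)))"
      proof (rule prod_pos)
        fix \<tau> show "0 < sqrt (real_of_int (k \<tau>))" using pos[OF k, of \<tau>] by simp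
      qed
    qed (rule A_coef_nonneg)
    then have "(\<Sum>k\<in>Q r. A_coef a (\<lambda>\<tau>. 2 ^ r \<tau> - 1) / P) \<le> (\<Sum>k\<in>Q r. F k)"
      by (rule sum_mono)
    then have 1: "real (card (Q r)) * (A_coef a (\<lambda>\<tau>. 2 ^ r \<tau> - 1) / P) \<le> (\<Sum>k\<in>Q r. F k)"
      by simp
    have "(\<Prod>\<tau>\<in>UNIV. 2 ^ r \<tau>) \<le> (\<Prod>\<tau>\<in>UNIV. 2 * real (card {2 ^ r \<tau> div 2 + 1 .. 2 ^ r \<tau> :: int}))"
    proof (intro prod_mono conjI)
      fix \<tau>
      have "x \<le> 2 * (x - x div 2)" for x :: int by presburger
      then have "(2::int) ^ r \<tau> \<le> 2 * (2 ^ r \<tau> - 2 ^ r \<tau> div 2)" .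
      moreover have "(2 ^ r \<tau> - 2 ^ r \<tau> div 2 :: int) = int (card {2 ^ r \<tau> div 2 + 1 .. 2 ^ r \<tau> :: int})"
      proof -
        have "x div 2 \<le> x" if "0 \<le> x" for x :: int using that by presburger
        then have "(2::int) ^ r \<tau> div 2 \<le> 2 ^ r \<tau>" by simp
        then show ?thesis by simp
      qed
      ultimately have "(2::int) ^ r \<tau> \<le> 2 * int (card {2 ^ r \<tau> div 2 + 1 .. 2 ^ r \<tau> :: int})"
        by (simp only:)
      then have "real_of_int (2 ^ r \<tau>) \<le> real_of_int (2 * int (card {2 ^ r \<tau> div 2 + 1 .. 2 ^ r \<tau> :: int}))"
        by (rule of_int_le_iff[THEN iffD2])
      then show "(2::real) ^ r \<tau> \<le> 2 * real (card {2 ^ r \<tau> div 2 + 1 .. 2 ^ r \<tau> :: int})"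
        by (simp only: of_int_mult of_int_of_nat_eq of_int_numeral of_int_power)
    qed simp
    also have "\<dots> = 2 ^ CARD('d) * real (card (Q r))"
      unfolding Q_def by (simp add: card_PiE prod.distrib)
    finally have "P * P \<le> 2 ^ CARD('d) * real (card (Q r))" unfolding PP .
    then have "P * P * (A_coef a (\<lambda>\<tau>. 2 ^ r \<tau> - 1) / P)
        \<le> 2 ^ CARD('d) * real (card (Q r)) * (A_coef a (\<lambda>\<tau>. 2 ^ r \<tau> - 1) / P)"
      using P0 by (intro mult_right_mono divide_nonneg_pos A_coef_nonneg)
    then have "P * A_coef a (\<lambda>\<tau>. 2 ^ r \<tau> - 1) \<le> 2 ^ CARD('d) * (real (card (Q r)) * (A_coef a (\<lambda>\<tau>. 2 ^ r \<tau> - 1) / P))"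
      using P0 by (simp add: mult_ac)
    also have "\<dots> \<le> 2 ^ CARD('d) * (\<Sum>k\<in>Q r. F k)" using 1 by (intro mult_left_mono) auto
    finally show ?thesis by (simp add: P_def)
  qed
  have disj: "Q r \<inter> Q s = {}" if "r \<noteq> s" for r s
  proof -
    from that obtain t where t: "r t \<noteq> s t" by auto
    have aux: "False" if "(2::int) ^ v div 2 + 1 \<le> l" "l \<le> 2 ^ u" "u < v" for u v :: nat and l
    proof -
      from \<open>u < v\<close> have "(2::int) ^ Suc u \<le> 2 ^ v" by (intro power_increasing) auto
      then have "(2::int) ^ u \<le> 2 ^ v div 2" by simp
      then show False using that by linarith
    qed
    show ?thesis
    proof (rule ccontr)
      assume "Q r \<inter> Q s \<noteq> {}"
      then obtain k where "k \<in> Q r" "k \<in> Q s" by auto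
      then have "2 ^ r t div 2 + 1 \<le> k t" "k t \<le> 2 ^ r t" "2 ^ s t div 2 + 1 \<le> k t" "k t \<le> 2 ^ s t"
        by (auto simp: Q_def PiE_UNIV_iff)
      then show False using t aux[of "s t" "k t" "r t"] aux[of "r t" "k t" "s t"] by linarith
    qed
  qed
  have sub: "(\<Union>r\<in>?B. Q r) \<subseteq> box 1 (int n)"
  proof
    fix k assume "k \<in> (\<Union>r\<in>?B. Q r)"
    then obtain r where r: "r \<in> ?B" and k: "k \<in> Q r" by auto
    have "k \<tau> \<le> int n" for \<tau>
    proof -
      have "k \<tau> \<le> 2 ^ r \<tau>" using k by (auto simp: Q_def PiE_UNIV_iff)
      also have "(2::int) ^ r \<tau> \<le> 2 ^ R" using r by (intro power_increasing) (auto simp: PiE_UNIV_iff)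
      also have "\<dots> = int (2 ^ R)" by simp
      also have "\<dots> \<le> int n" using n by (simp only: of_nat_le_iff)
      finally show ?thesis .
    qed
    then show "k \<in> box 1 (int n)" using pos[OF k] by (auto simp: box_def)
  qed
  have "(\<Sum>r\<in>?B. (\<Prod>\<tau>\<in>UNIV. sqrt (2 ^ r \<tau>)) * A_coef a (\<lambda>\<tau>. 2 ^ r \<tau> - 1))
      \<le> (\<Sum>r\<in>?B. 2 ^ CARD('d) * (\<Sum>k\<in>Q r. F k))"
    by (intro sum_mono block)
  also have "\<dots> = 2 ^ CARD('d) * (\<Sum>k\<in>(\<Union>r\<in>?B. Q r). F k)"
    using finB finQ disj by (subst sum.UNION_disjoint) (auto simp: sum_distrib_left)
  also have "\<dots> \<le> 2 ^ CARD('d) * (\<Sum>k\<in>box 1 (int n). F k)"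
  proof (intro mult_left_mono sum_mono2 sub)
    fix k assume k: "k \<in> box 1 (int n) - (\<Union>r\<in>?B. Q r)"
    show "0 \<le> F k" unfolding F_def
    proof (intro divide_nonneg_nonneg A_coef_nonneg prod_nonneg)
      fix \<tau>
      have "1 \<le> k \<tau>" using k by (auto simp: box_def)
      then show "0 \<le> sqrt (real_of_int (k \<tau>))" by simp
    qed
  qed auto
  also have "(\<Sum>k\<in>box 1 (int n). F k) = Delta a n"
    by (simp add: Delta_def F_def)
  finally show ?thesis .
qed

section \<open>The innovation field and conditional means of its finite linear forms\<close>

locale iid_field = prob_space M for M :: "'a measure" +
  fixes eps :: "('d::finite \<Rightarrow> int) \<Rightarrow> 'a \<Rightarrow> real"
  assumes indep: "indep_vars (\<lambda>_. borel) eps UNIV"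
    and ident: "\<And>i. distr M borel (eps i) = distr M borel (eps zero_idx)"
    and mean0: "expectation (eps zero_idx) = 0"
    and sq_int: "integrable M (\<lambda>\<omega>. (eps zero_idx \<omega>)\<^sup>2)"
begin

definition sd :: real where "sd = l2 (eps zero_idx)"

definition lin :: "('d \<Rightarrow> int) set \<Rightarrow> (('d \<Rightarrow> int) \<Rightarrow> real) \<Rightarrow> 'a \<Rightarrow> real" where
  "lin T c \<omega> = (\<Sum>j\<in>T. c j * eps j \<omega>)"

lemma eps_measurable [measurable]: "eps i \<in> borel_measurable M"
  using indep by (auto simp: indep_vars_def)

lemma lin_measurable [measurable]: "lin T c \<in> borel_measurable M"
  unfolding lin_def[abs_def] by measurable

lemma eps_transfer:
  fixes f :: "real \<Rightarrow> real"
  assumes [measurable]: "f \<in> borel_measurable borel"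
  shows "integrable M (\<lambda>\<omega>. f (eps i \<omega>)) \<longleftrightarrow> integrable M (\<lambda>\<omega>. f (eps zero_idx \<omega>))"
    and "expectation (\<lambda>\<omega>. f (eps i \<omega>)) = expectation (\<lambda>\<omega>. f (eps zero_idx \<omega>))"
proof -
  have "integrable (distr M borel (eps i)) f \<longleftrightarrow> integrable (distr M borel (eps zero_idx)) f"
    by (simp only: ident[of i])
  then show "integrable M (\<lambda>\<omega>. f (eps i \<omega>)) \<longleftrightarrow> integrable M (\<lambda>\<omega>. f (eps zero_idx \<omega>))"
    by (simp add: integrable_distr_eq)
  have "integral\<^sup>L (distr M borel (eps i)) f = integral\<^sup>L (distr M borel (eps zero_idx)) f"
    by (simp only: ident[of i])
  then show "expectation (\<lambda>\<omega>. f (eps i \<omega>)) = expectation (\<lambda>\<omega>. f (eps zero_idx \<omega>))"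
    by (simp add: integral_distr)
qed

lemma eps_L2: "eps i \<in> L2"
  using eps_transfer(1)[of "\<lambda>x. x\<^sup>2" i] sq_int by (auto simp: L2_def)

lemma eps_mean: "expectation (eps i) = 0"
  using eps_transfer(2)[of "\<lambda>x. x" i] mean0 by simp

lemma eps_second_moment: "expectation (\<lambda>\<omega>. (eps i \<omega>)\<^sup>2) = sd\<^sup>2"
  using eps_transfer(2)[of "\<lambda>x. x\<^sup>2" i] by (simp add: sd_def l2_square)

lemma sd_nonneg: "0 \<le> sd"
  by (simp add: sd_def l2_nonneg)

lemma lin_L2: "lin T c \<in> L2"
  unfolding lin_def[abs_def] by (intro L2_sum L2_cmult eps_L2)

lemma eps_uncorrelated:
  assumes "i \<noteq> j"
  shows "expectation (\<lambda>\<omega>. eps i \<omega> * eps j \<omega>) = 0"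
proof -
  have "indep_vars (\<lambda>_. borel) eps {i, j}" by (rule indep_vars_subset[OF indep]) simp
  then have "expectation (\<lambda>\<omega>. \<Prod>k\<in>{i, j}. eps k \<omega>) = (\<Prod>k\<in>{i, j}. expectation (eps k))"
    by (intro indep_vars_lebesgue_integral) (auto intro: L2_integrable eps_L2)
  then show ?thesis using assms by (simp add: eps_mean)
qed

lemma lin_l2:
  assumes "finite T"
  shows "l2 (lin T c) = sd * sqrt (\<Sum>j\<in>T. (c j)\<^sup>2)"
proof -
  have "expectation (\<lambda>\<omega>. (lin T c \<omega>)\<^sup>2)
      = (\<Sum>i\<in>T. \<Sum>j\<in>T. expectation (\<lambda>\<omega>. (c i * c j) * (eps i \<omega> * eps j \<omega>)))"
    unfolding power2_eq_square sum_product lin_def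
    by (subst Bochner_Integration.integral_sum)
      (auto intro!: Bochner_Integration.integrable_sum L2_mult L2_cmult eps_L2 sum.cong
          simp: Bochner_Integration.integral_sum L2_mult L2_cmult eps_L2 mult_ac)
  also have "\<dots> = (\<Sum>i\<in>T. \<Sum>j\<in>T. if i = j then (c i)\<^sup>2 * sd\<^sup>2 else 0)"
  proof (intro sum.cong refl)
    fix i j
    show "expectation (\<lambda>\<omega>. c i * c j * (eps i \<omega> * eps j \<omega>)) = (if i = j then (c i)\<^sup>2 * sd\<^sup>2 else 0)"
      using eps_uncorrelated[of i j] eps_second_moment[of i] by (auto simp: power2_eq_square)
  qed
  also have "\<dots> = sd\<^sup>2 * (\<Sum>j\<in>T. (c j)\<^sup>2)"
    using assms by (simp add: sum_distrib_left mult.commute)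
  finally show ?thesis
    using sd_nonneg by (simp add: l2_def real_sqrt_mult)
qed

lemma lin_split:
  assumes "finite T"
  shows "lin T c \<omega> = lin (T \<inter> J) c \<omega> + lin (T - J) c \<omega>"
proof -
  have "lin T c \<omega> = lin ((T \<inter> J) \<union> (T - J)) c \<omega>" by (simp add: Int_Diff_Un)
  also have "\<dots> = lin (T \<inter> J) c \<omega> + lin (T - J) c \<omega>"
    unfolding lin_def using assms by (subst sum.union_disjoint) auto
  finally show ?thesis .
qed

text \<open>The innovations in \<open>S\<close> are integrated out while those in \<open>W\<close>
  and \<open>Q\<close> stay frozen. Two frozen forms are provided because a conditioned variable and
  its test function may share innovations; the empty form fills an idle slot.\<close>

lemma expectation_lin_indep:
  fixes G :: "real \<times> real \<times> real \<Rightarrow> real"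
  assumes disj: "(W \<union> Q) \<inter> S = {}"
    and G[measurable]: "G \<in> borel_measurable borel" and B: "\<And>z. \<bar>G z\<bar> \<le> B"
  shows "expectation (\<lambda>\<omega>. G (lin W c \<omega>, lin Q e \<omega>, lin S f \<omega>))
    = expectation (\<lambda>\<omega>. expectation (\<lambda>\<omega>'. G (lin W c \<omega>, lin Q e \<omega>, lin S f \<omega>')))"
proof -
  let ?P = "\<lambda>A. PiM A (\<lambda>_. borel) :: (('d \<Rightarrow> int) \<Rightarrow> real) measure"
  let ?X = "\<lambda>A \<omega>. restrict (\<lambda>i. eps i \<omega>) A"
  have ind: "indep_var (?P (W \<union> Q)) (?X (W \<union> Q)) (?P S) (?X S)"
    by (rule indep_var_restrict[OF indep disj]) auto
  let ?F = "\<lambda>z. G (\<Sum>j\<in>W. c j * fst z j, \<Sum>j\<in>Q. e j * fst z j, \<Sum>j\<in>S. f j * snd z j)"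
  have fst_m: "(\<lambda>z. fst z j) \<in> borel_measurable (?P (W \<union> Q) \<Otimes>\<^sub>M ?P S)" if "j \<in> W \<union> Q" for j
    by (rule measurable_compose[OF measurable_fst measurable_component_singleton[OF that]])
  have snd_m: "(\<lambda>z. snd z j) \<in> borel_measurable (?P (W \<union> Q) \<Otimes>\<^sub>M ?P S)" if "j \<in> S" for j
    by (rule measurable_compose[OF measurable_snd measurable_component_singleton[OF that]])
  have "?F \<in> borel_measurable (?P (W \<union> Q) \<Otimes>\<^sub>M ?P S)"
    using fst_m snd_m
    by (intro measurable_compose[OF _ G] borel_measurable_Pair borel_measurable_sum
          borel_measurable_times borel_measurable_const) auto
  from indep_var_expectation[OF ind this B] show ?thesis
    by (simp add: lin_def)
qed

definition rest_mean :: "(real \<Rightarrow> real) \<Rightarrow> ('d \<Rightarrow> int) set \<Rightarrow> (('d \<Rightarrow> int) \<Rightarrow> real) \<Rightarrow> real \<Rightarrow> real" where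
  "rest_mean h S c y = expectation (\<lambda>\<omega>. h (y + lin S c \<omega>))"

text \<open>For finite \<open>T\<close> this is the conditional expectation of
  \<open>h (lin T c)\<close> given the innovations with index in \<open>J\<close>: the part of the
  form inside \<open>J\<close> is kept and the rest is averaged. It is an explicit function of a
  linear form, so no choice of version arises.\<close>

definition cexp :: "(real \<Rightarrow> real) \<Rightarrow> ('d \<Rightarrow> int) set \<Rightarrow> (('d \<Rightarrow> int) \<Rightarrow> real) \<Rightarrow> ('d \<Rightarrow> int) set \<Rightarrow> 'a \<Rightarrow> real" where
  "cexp h T c J \<omega> = rest_mean h (T - J) c (lin (T \<inter> J) c \<omega>)"

context
  fixes h :: "real \<Rightarrow> real" and B :: real
  assumes h[measurable]: "h \<in> borel_measurable borel" and hB: "\<And>y. \<bar>h y\<bar> \<le> B"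
begin

lemma bounded_integrable:
  assumes [measurable]: "f \<in> borel_measurable M"
  shows "integrable M (\<lambda>\<omega>. h (f \<omega>))"
  by (rule integrable_const_bound[where B = B]) (use hB in auto)

lemma rest_mean_measurable [measurable]: "rest_mean h S c \<in> borel_measurable borel"
  unfolding rest_mean_def[abs_def] by measurable

lemma rest_mean_bounded: "\<bar>rest_mean h S c y\<bar> \<le> B"
proof -
  have "\<bar>rest_mean h S c y\<bar> \<le> expectation (\<lambda>\<omega>. \<bar>h (y + lin S c \<omega>)\<bar>)"
    unfolding rest_mean_def by (rule integral_abs_bound)
  also have "\<dots> \<le> expectation (\<lambda>\<omega>. B)"
    using hB by (intro integral_mono integrable_abs bounded_integrable) auto
  finally show ?thesis by (simp add: prob_space)
qed

lemma cexp_measurable [measurable]: "cexp h T c J \<in> borel_measurable M"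
  unfolding cexp_def[abs_def] by measurable

lemma cexp_bounded: "\<bar>cexp h T c J \<omega>\<bar> \<le> B"
  unfolding cexp_def by (rule rest_mean_bounded)

lemma cexp_L2: "cexp h T c J \<in> L2"
  by (rule L2_bounded[OF cexp_measurable cexp_bounded])

text \<open>The test function depends on innovations in \<open>G\<close> only. Those in
  \<open>T \<inter> J - G\<close> are independent of it and of the part kept in
  \<open>J \<inter> G\<close>, so they can be integrated out; what remains is the conditional
  expectation given \<open>J \<inter> G\<close>.\<close>

lemma cexp_project:
  fixes g :: "real \<Rightarrow> real"
  assumes T: "finite T" and Q: "Q \<subseteq> G"
    and g[measurable]: "g \<in> borel_measurable borel" and gB: "\<And>y. \<bar>g y\<bar> \<le> C"
  shows "expectation (\<lambda>\<omega>. cexp h T c J \<omega> * g (lin Q e \<omega>))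
    = expectation (\<lambda>\<omega>. cexp h T c (J \<inter> G) \<omega> * g (lin Q e \<omega>))"
proof -
  let ?W = "T \<inter> (J \<inter> G)" and ?S = "T \<inter> J - G"
  let ?H = "rest_mean h (T - J) c"
  have B0: "0 \<le> B" using hB[of 0] by simp
  have bd: "\<bar>?H (fst z + snd (snd z)) * g (fst (snd z))\<bar> \<le> B * C" for z :: "real \<times> real \<times> real"
    unfolding abs_mult using B0 by (intro mult_mono rest_mean_bounded gB) auto
  \<comment> \<open>Tower property: averaging over \<open>T - J\<close> and then over
    \<open>T \<inter> J - G\<close> is a single average over
    \<open>T - (J \<inter> G)\<close>.\<close>
  have rest: "rest_mean h (T - (J \<inter> G)) c y = expectation (\<lambda>\<omega>'. ?H (y + lin ?S c \<omega>'))" for y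
  proof -
    have "(T - (J \<inter> G)) \<inter> J = ?S" "T - (J \<inter> G) - J = T - J" by blast+
    then have "lin (T - (J \<inter> G)) c \<omega> = lin ?S c \<omega> + lin (T - J) c \<omega>" for \<omega>
      using lin_split[of "T - (J \<inter> G)" c \<omega> J] T by simp
    then have "rest_mean h (T - (J \<inter> G)) c y = expectation (\<lambda>\<omega>. (\<lambda>z. h (y + fst z + snd (snd z))) (lin ?S c \<omega>, lin {} c \<omega>, lin (T - J) c \<omega>))"
      by (simp add: rest_mean_def add.assoc)
    also have "\<dots> = expectation (\<lambda>\<omega>. expectation (\<lambda>\<omega>'. (\<lambda>z. h (y + fst z + snd (snd z))) (lin ?S c \<omega>, lin {} c \<omega>, lin (T - J) c \<omega>')))"
    proof (rule expectation_lin_indep)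
      show "(\<lambda>z :: real \<times> real \<times> real. h (y + fst z + snd (snd z))) \<in> borel_measurable borel"
        by (intro measurable_compose[OF _ h] borel_measurable_continuous_onI continuous_intros)
    qed (use hB in auto)
    finally show ?thesis by (simp add: rest_mean_def)
  qed
  have "expectation (\<lambda>\<omega>. cexp h T c J \<omega> * g (lin Q e \<omega>))
      = expectation (\<lambda>\<omega>. (\<lambda>z. ?H (fst z + snd (snd z)) * g (fst (snd z))) (lin ?W c \<omega>, lin Q e \<omega>, lin ?S c \<omega>))"
    using lin_split[of "T \<inter> J" c _ G] T by (simp add: cexp_def Int_assoc)
  also have "\<dots> = expectation (\<lambda>\<omega>. expectation (\<lambda>\<omega>'. (\<lambda>z. ?H (fst z + snd (snd z)) * g (fst (snd z))) (lin ?W c \<omega>, lin Q e \<omega>, lin ?S c \<omega>')))"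
  proof (rule expectation_lin_indep[OF _ _ bd])
    show "(\<lambda>z :: real \<times> real \<times> real. ?H (fst z + snd (snd z)) * g (fst (snd z))) \<in> borel_measurable borel"
      by (intro borel_measurable_times measurable_compose[OF _ g] measurable_compose[OF _ rest_mean_measurable]
          borel_measurable_continuous_onI continuous_intros)
  qed (use Q in auto)
  also have "\<dots> = expectation (\<lambda>\<omega>. cexp h T c (J \<inter> G) \<omega> * g (lin Q e \<omega>))"
    by (simp add: cexp_def rest)
  finally show ?thesis .
qed

lemma cexp_expectation:
  assumes T: "finite T"
  shows "expectation (cexp h T c J) = expectation (\<lambda>\<omega>. h (lin T c \<omega>))"
  using cexp_project[OF T, of "{}" "{}" "\<lambda>_. 1" 1 c J]
  by (simp add: cexp_def[abs_def] rest_mean_def lin_def prob_space)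

text \<open>The mean is exchanged for the value of \<open>rest_mean\<close> at 0; the Lipschitz
  bound then leaves the second moment of the linear form over \<open>T \<inter> J\<close>.\<close>

lemma cexp_l2:
  assumes T: "finite T" and lip: "\<And>y z. \<bar>rest_mean h (T - J) c y - rest_mean h (T - J) c z\<bar> \<le> C * \<bar>y - z\<bar>"
    and C: "0 \<le> C"
  shows "l2 (\<lambda>\<omega>. cexp h T c J \<omega> - expectation (\<lambda>\<omega>. h (lin T c \<omega>)))
    \<le> C * (sd * sqrt (\<Sum>j\<in>T \<inter> J. (c j)\<^sup>2))"
proof (rule l2_leI)
  let ?U = "lin (T \<inter> J) c" and ?c = "rest_mean h (T - J) c 0"
  have "expectation (\<lambda>\<omega>. (cexp h T c J \<omega> - expectation (\<lambda>\<omega>. h (lin T c \<omega>)))\<^sup>2)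
      \<le> expectation (\<lambda>\<omega>. (cexp h T c J \<omega> - ?c)\<^sup>2)"
    using variance_le_square[OF cexp_L2[of T c J], of ?c] cexp_expectation[OF T, of c J] by simp
  also have "\<dots> \<le> expectation (\<lambda>\<omega>. C\<^sup>2 * (?U \<omega>)\<^sup>2)"
  proof (rule integral_mono)
    show "integrable M (\<lambda>\<omega>. (cexp h T c J \<omega> - ?c)\<^sup>2)"
      using L2_diff[OF cexp_L2 L2_const] L2_square by blast
    show "integrable M (\<lambda>\<omega>. C\<^sup>2 * (?U \<omega>)\<^sup>2)"
      using L2_square[OF lin_L2] by simp
    fix \<omega>
    have "(cexp h T c J \<omega> - ?c)\<^sup>2 = \<bar>cexp h T c J \<omega> - ?c\<bar>\<^sup>2" by simp
    also have "\<dots> \<le> (C * \<bar>?U \<omega>\<bar>)\<^sup>2"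
      using lip[of "?U \<omega>" 0] by (intro power_mono) (auto simp: cexp_def)
    finally show "(cexp h T c J \<omega> - ?c)\<^sup>2 \<le> C\<^sup>2 * (?U \<omega>)\<^sup>2"
      by (simp add: power_mult_distrib)
  qed
  also have "\<dots> = (C * (sd * sqrt (\<Sum>j\<in>T \<inter> J. (c j)\<^sup>2)))\<^sup>2"
    using T lin_l2[of "T \<inter> J" c] by (simp add: l2_square[symmetric] power_mult_distrib)
  finally show "expectation (\<lambda>\<omega>. (cexp h T c J \<omega> - expectation (\<lambda>\<omega>. h (lin T c \<omega>)))\<^sup>2)
      \<le> (C * (sd * sqrt (\<Sum>j\<in>T \<inter> J. (c j)\<^sup>2)))\<^sup>2" .
qed (use C sd_nonneg in \<open>auto intro!: mult_nonneg_nonneg sum_nonneg\<close>)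

text \<open>Each factor is a bounded function of one linear form and can serve as the test function
  for the other, so two projections restrict both factors to \<open>J \<inter> J'\<close>. For pasts
  of lattice points this becomes the hypothesis \<open>inner\<close> of
  \<open>l2_box_sum_dyadic\<close>.\<close>

lemma cexp_inner:
  assumes T: "finite T" "finite T'"
  shows "expectation (\<lambda>\<omega>. cexp h T c J \<omega> * cexp h T' c' J' \<omega>)
    = expectation (\<lambda>\<omega>. cexp h T c (J \<inter> J') \<omega> * cexp h T' c' (J \<inter> J') \<omega>)"
proof -
  have "expectation (\<lambda>\<omega>. cexp h T c J \<omega> * cexp h T' c' J' \<omega>)
      = expectation (\<lambda>\<omega>. cexp h T c (J \<inter> J') \<omega> * cexp h T' c' J' \<omega>)"
    unfolding cexp_def[of h T'] by (rule cexp_project[OF T(1)]) (auto intro: rest_mean_bounded)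
  also have "\<dots> = expectation (\<lambda>\<omega>. cexp h T' c' J' \<omega> * cexp h T c (J \<inter> J') \<omega>)"
    by (simp add: mult.commute)
  also have "\<dots> = expectation (\<lambda>\<omega>. cexp h T' c' (J' \<inter> (J \<inter> J')) \<omega> * cexp h T c (J \<inter> J') \<omega>)"
    unfolding cexp_def[of h T] by (rule cexp_project[OF T(2)]) (auto intro: rest_mean_bounded)
  also have "J' \<inter> (J \<inter> J') = J \<inter> J'" by blast
  finally show ?thesis by (simp add: mult.commute)
qed

end

section \<open>Stationarity of the innovation field\<close>

definition shift :: "('d \<Rightarrow> int) \<Rightarrow> ('d \<Rightarrow> int) \<Rightarrow> 'd \<Rightarrow> int" where
  "shift v j = (\<lambda>\<tau>. j \<tau> + v \<tau>)"

text \<open>The joint law is a product of identical marginals, and reindexing such a product along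
  the injection \<open>shift v\<close> does not change it.\<close>

lemma distr_shift: "distr M (PiM UNIV (\<lambda>_. borel)) (\<lambda>\<omega> j. eps (shift v j) \<omega>)
    = PiM UNIV (\<lambda>_. distr M borel (eps zero_idx))"
proof -
  let ?P = "PiM UNIV (\<lambda>_. borel) :: (('d \<Rightarrow> int) \<Rightarrow> real) measure"
  let ?N = "PiM UNIV (\<lambda>_. distr M borel (eps zero_idx)) :: (('d \<Rightarrow> int) \<Rightarrow> real) measure"
  have inj: "inj (shift v)" by (rule injI) (auto simp: shift_def fun_eq_iff)
  have joint: "distr M ?P (\<lambda>\<omega> j. eps j \<omega>) = ?N"
  proof -
    have "distr M ?P (\<lambda>\<omega>. \<lambda>j\<in>UNIV. eps j \<omega>) = PiM UNIV (\<lambda>j. distr M borel (eps j))"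
      using indep by (subst (asm) indep_vars_iff_distr_eq_PiM) auto
    also have "\<dots> = ?N" by (intro PiM_cong refl) (rule ident)
    finally show ?thesis by (simp add: restrict_UNIV)
  qed
  have m: "(\<lambda>\<omega> j. eps j \<omega>) \<in> measurable M ?P" "(\<lambda>w j. w (shift v j)) \<in> measurable ?P ?P"
    by (rule measurable_PiM_single'; auto)+
  have sN: "sets ?N = sets ?P" by (intro sets_PiM_cong) auto
  have "distr M ?P (\<lambda>\<omega> j. eps (shift v j) \<omega>) = distr (distr M ?P (\<lambda>\<omega> j. eps j \<omega>)) ?P (\<lambda>w j. w (shift v j))"
    by (subst distr_distr[OF m(2,1)]) (simp add: comp_def)
  also have "\<dots> = distr ?N ?P (\<lambda>w j. w (shift v j))" unfolding joint ..
  also have "\<dots> = distr ?N ?N (\<lambda>w. \<lambda>j\<in>UNIV. w (shift v j))"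
    by (intro distr_cong) (auto simp: restrict_UNIV sN)
  also have "\<dots> = ?N"
    by (rule distr_PiM_reindex) (use inj in \<open>auto intro: prob_space_distr\<close>)
  finally show ?thesis .
qed

lemma expectation_shift:
  fixes \<Psi> :: "(('d \<Rightarrow> int) \<Rightarrow> real) \<Rightarrow> 'b::{banach, second_countable_topology}"
  assumes [measurable]: "\<Psi> \<in> borel_measurable (PiM UNIV (\<lambda>_. borel))"
  shows "expectation (\<lambda>\<omega>. \<Psi> (\<lambda>j. eps (shift v j) \<omega>)) = expectation (\<lambda>\<omega>. \<Psi> (\<lambda>j. eps j \<omega>))"
proof -
  have m: "(\<lambda>\<omega> j. eps (shift v j) \<omega>) \<in> measurable M (PiM UNIV (\<lambda>_. borel))" for v
    by (rule measurable_PiM_single') auto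
  have "expectation (\<lambda>\<omega>. \<Psi> (\<lambda>j. eps (shift v j) \<omega>)) = integral\<^sup>L (PiM UNIV (\<lambda>_. distr M borel (eps zero_idx))) \<Psi>" for v
    unfolding distr_shift[of v, symmetric] by (subst integral_distr[OF m]) auto
  from this[of v] this[of "\<lambda>_. 0"] show ?thesis by (simp add: shift_def)
qed

end

subsection \<open>Truncated linear fields and their kernel transforms\<close>

text \<open>The innovations that enter \<open>Xtrunc a eps m i\<close>, listed by their own index
  instead of the index of the coefficient.\<close>

definition win :: "nat \<Rightarrow> ('d::finite \<Rightarrow> int) \<Rightarrow> ('d \<Rightarrow> int) set" where
  "win m i = PiE UNIV (\<lambda>\<tau>. {i \<tau> - int m <.. i \<tau>})"

text \<open>For fixed \<open>i\<close> this reflection is an involution; it translates in both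
  directions between coefficient indices and innovation indices.\<close>

definition lag :: "('d \<Rightarrow> int) \<Rightarrow> ('d \<Rightarrow> int) \<Rightarrow> 'd \<Rightarrow> int" where
  "lag i j = (\<lambda>\<tau>. i \<tau> - j \<tau>)"

definition past :: "('d \<Rightarrow> int) \<Rightarrow> ('d \<Rightarrow> int) set" where
  "past k = {j. \<forall>\<tau>. j \<tau> \<le> k \<tau>}"

lemma win_iff: "j \<in> win m i \<longleftrightarrow> (\<forall>\<tau>. i \<tau> - int m < j \<tau> \<and> j \<tau> \<le> i \<tau>)"
  by (simp add: win_def PiE_UNIV_iff)

lemma finite_win [simp]: "finite (win m i)"
  unfolding win_def by (intro finite_PiE) auto

lemma win_mono: "m \<le> n \<Longrightarrow> win m i \<subseteq> win n i"
  unfolding win_def by (intro PiE_mono) auto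

lemma win_subset_past: "win m i \<subseteq> past i"
  by (auto simp: win_iff past_def)

lemma past_Int: "past k \<inter> past l = past (\<lambda>\<tau>. min (k \<tau>) (l \<tau>))"
  by (auto simp: past_def)

lemma lag_lag [simp]: "lag i (lag i j) = j"
  by (simp add: lag_def)

lemma inj_lag: "inj_on (lag i) S"
  by (rule inj_on_inverseI[where g = "lag i"]) simp

lemma lag_box_eq_win: "lag i ` box 0 (int m - 1) = win m i"
proof
  show "lag i ` box 0 (int m - 1) \<subseteq> win m i"
    by (force simp: box_def lag_def win_iff)
  show "win m i \<subseteq> lag i ` box 0 (int m - 1)"
  proof
    fix j assume "j \<in> win m i"
    then have "lag i j \<in> box 0 (int m - 1)" by (simp add: box_def lag_def win_iff) (smt (verit))
    then show "j \<in> lag i ` box 0 (int m - 1)" by (rule rev_image_eqI) simp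
  qed
qed

lemma Xtrunc_measurable_PiM:
  "(\<lambda>w. Xtrunc a (\<lambda>j w. w j) m i w) \<in> borel_measurable (PiM UNIV (\<lambda>_. borel))"
  unfolding Xtrunc_def by measurable

text \<open>The constants are shared by all truncation levels \<open>m \<ge> 1\<close>:
  \<open>c0\<close> for every density, \<open>C\<close> for marginal and joint densities alike. This
  uniformity is used when windows are shortened. The evaluation point \<open>x\<close> is fixed, so
  that \<open>h\<close> below depends on the bandwidth alone.\<close>

locale linear_field = iid_field M eps
  for M :: "'a measure" and eps :: "('d::finite \<Rightarrow> int) \<Rightarrow> 'a \<Rightarrow> real" +
  fixes a :: "('d \<Rightarrow> int) \<Rightarrow> real"
    and pm :: "nat \<Rightarrow> real \<Rightarrow> real"
    and pjm :: "nat \<Rightarrow> ('d \<Rightarrow> int) \<Rightarrow> real \<Rightarrow> real \<Rightarrow> real"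
    and c0 C :: real
    and K :: "real \<Rightarrow> real" and B L x :: real
  assumes a_sq: "(\<lambda>k. (a k)\<^sup>2) summable_on nonneg_idx"
    and pm_nonneg: "\<And>m y. 0 \<le> pm m y"
    and pm_dens: "\<And>m. m \<ge> 1 \<Longrightarrow> distributed M lborel (Xtrunc a eps m zero_idx) (\<lambda>y. ennreal (pm m y))"
    and pm_lip: "\<And>m. m \<ge> 1 \<Longrightarrow> lipschitz_with c0 (pm m)"
    and pm_le: "\<And>m y. m \<ge> 1 \<Longrightarrow> pm m y \<le> C"
    and pjm_nonneg: "\<And>m i y z. 0 \<le> pjm m i y z"
    and pjm_dens: "\<And>m i. m \<ge> 1 \<Longrightarrow> i \<noteq> zero_idx \<Longrightarrow>
        distributed M lborel (\<lambda>\<omega>. (Xtrunc a eps m zero_idx \<omega>, Xtrunc a eps m i \<omega>))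
          (\<lambda>w. ennreal (pjm m i (fst w) (snd w)))"
    and pjm_le: "\<And>m i y z. m \<ge> 1 \<Longrightarrow> i \<noteq> zero_idx \<Longrightarrow> pjm m i y z \<le> C"
    and K_nonneg: "\<And>s. 0 \<le> K s"
    and K_int: "integrable lborel K"
    and K_one: "integral\<^sup>L lborel K = 1"
    and K_le: "\<And>s. K s \<le> B"
    and K_lip: "lipschitz_with L K"
begin

lemma constants_nonneg: "0 \<le> c0" "0 \<le> C" "0 \<le> B" "0 \<le> L"
proof -
  show "0 \<le> c0" using pm_lip[of 1] unfolding lipschitz_with_def
    by (metis abs_ge_zero diff_zero abs_one mult.right_neutral order_trans order_refl)
  show "0 \<le> C" using pm_nonneg pm_le[of 1] by (meson order_refl order_trans)
  show "0 \<le> B" using K_nonneg K_le by (meson order_trans)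
  show "0 \<le> L" using K_lip unfolding lipschitz_with_def
    by (metis abs_ge_zero diff_zero abs_one mult.right_neutral order_trans)
qed

definition co :: "('d \<Rightarrow> int) \<Rightarrow> ('d \<Rightarrow> int) \<Rightarrow> real" where
  "co i j = a (lag i j)"

lemma Xtrunc_eq_lin: "Xtrunc a eps m i = lin (win m i) (co i)"
proof
  fix \<omega>
  show "Xtrunc a eps m i \<omega> = lin (win m i) (co i) \<omega>"
    unfolding Xtrunc_def lin_def lag_box_eq_win[symmetric]
    by (subst sum.reindex[OF inj_lag]) (simp add: co_def, simp add: lag_def)
qed

lemma Xtrunc_measurable [measurable]: "Xtrunc a eps m i \<in> borel_measurable M"
  unfolding Xtrunc_eq_lin by simp

lemma sum_co_le_A:
  assumes "finite S" "S \<subseteq> past i" "S \<subseteq> past k"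
  shows "(\<Sum>j\<in>S. (co i j)\<^sup>2) \<le> (A_coef a (lag i k))\<^sup>2"
proof -
  have "(\<Sum>j\<in>S. (co i j)\<^sup>2) = (\<Sum>l\<in>lag i ` S. (a l)\<^sup>2)"
    by (subst sum.reindex[OF inj_lag]) (simp add: co_def)
  also have "\<dots> \<le> (A_coef a (lag i k))\<^sup>2"
    using assms by (intro sum_sq_le_A_coef[OF a_sq]) (auto simp: lag_def nonneg_idx_def past_def)
  finally show ?thesis .
qed

lemma sum_co_le_B:
  assumes "finite S" "S \<subseteq> past i" "S \<inter> win m i = {}"
  shows "(\<Sum>j\<in>S. (co i j)\<^sup>2) \<le> (B_coef a m)\<^sup>2"
proof -
  have "(\<Sum>j\<in>S. (co i j)\<^sup>2) = (\<Sum>l\<in>lag i ` S. (a l)\<^sup>2)"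
    by (subst sum.reindex[OF inj_lag]) (simp add: co_def)
  also have "\<dots> \<le> (B_coef a m)\<^sup>2"
  proof (intro sum_sq_le_B_coef[OF a_sq] subsetI)
    fix l assume "l \<in> lag i ` S"
    then obtain j where j: "j \<in> S" "l = lag i j" by auto
    then have past: "\<And>\<tau>. j \<tau> \<le> i \<tau>" and "j \<notin> win m i" using assms by (auto simp: past_def)
    then obtain t where "j t \<le> i t - int m" by (force simp: win_iff not_less)
    then have "int m \<le> l t" by (simp add: j lag_def)
    then show "l \<in> {i \<in> nonneg_idx. \<exists>\<tau>. int m \<le> i \<tau>}"
      using past j by (auto simp: lag_def nonneg_idx_def)
  qed (use assms in auto)
  finally show ?thesis .
qed

lemma B_coef_nonneg: "0 \<le> B_coef a m"
  by (simp add: B_coef_def infsum_nonneg)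

lemma Xtrunc_shift: "Xtrunc a eps m (shift v i) \<omega> = Xtrunc a (\<lambda>j w. w j) m i (\<lambda>j. eps (shift v j) \<omega>)"
  unfolding Xtrunc_def shift_def by (simp add: algebra_simps)

lemma expectation_Xtrunc_shift:
  fixes f :: "real \<Rightarrow> real \<Rightarrow> real"
  assumes f: "(\<lambda>z. f (fst z) (snd z)) \<in> borel_measurable borel"
  shows "expectation (\<lambda>\<omega>. f (Xtrunc a eps m (shift v i) \<omega>) (Xtrunc a eps l (shift v j) \<omega>))
    = expectation (\<lambda>\<omega>. f (Xtrunc a eps m i \<omega>) (Xtrunc a eps l j \<omega>))"
proof -
  let ?\<Psi> = "\<lambda>w. f (Xtrunc a (\<lambda>j w. w j) m i w) (Xtrunc a (\<lambda>j w. w j) l j w)"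
  have m: "?\<Psi> \<in> borel_measurable (PiM UNIV (\<lambda>_. borel))"
    using measurable_compose[OF borel_measurable_Pair[OF Xtrunc_measurable_PiM Xtrunc_measurable_PiM] f] by simp
  have "Xtrunc a (\<lambda>j w. w j) m i (\<lambda>j. eps j \<omega>) = Xtrunc a eps m i \<omega>" for m i \<omega>
    by (simp add: Xtrunc_def)
  then show ?thesis using expectation_shift[OF m, of v] by (simp add: Xtrunc_shift)
qed

lemma shift_zero: "shift v zero_idx = v"
  by (simp add: shift_def zero_idx_def)

lemma expectation_Xtrunc:
  fixes f :: "real \<Rightarrow> real"
  assumes f[measurable]: "f \<in> borel_measurable borel" and m: "m \<ge> 1"
  shows "expectation (\<lambda>\<omega>. f (Xtrunc a eps m i \<omega>)) = (\<integral>y. pm m y * f y \<partial>lborel)"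
proof -
  have "(\<lambda>z :: real \<times> real. f (fst z)) \<in> borel_measurable borel"
    by (intro measurable_compose[OF _ f] borel_measurable_continuous_onI continuous_intros)
  then have "expectation (\<lambda>\<omega>. f (Xtrunc a eps m i \<omega>)) = expectation (\<lambda>\<omega>. f (Xtrunc a eps m zero_idx \<omega>))"
    using expectation_Xtrunc_shift[of "\<lambda>u v. f u" m i zero_idx m zero_idx] by (simp add: shift_zero)
  also have "\<dots> = (\<integral>y. pm m y * f y \<partial>lborel)"
    by (rule distributed_integral[OF pm_dens[OF m], symmetric]) (use pm_nonneg in auto)
  finally show ?thesis .
qed

lemma pm_measurable: "m \<ge> 1 \<Longrightarrow> pm m \<in> borel_measurable borel"
proof -
  assume m: "m \<ge> 1"
  have "continuous_on UNIV (pm m)"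
  proof (rule continuous_onI)
    fix y e :: real assume "0 < e"
    then show "\<exists>d>0. \<forall>x'\<in>UNIV. dist x' y < d \<longrightarrow> dist (pm m x') (pm m y) \<le> e"
    proof (intro exI[of _ "e / (c0 + 1)"] conjI ballI impI)
      show "0 < e / (c0 + 1)" using \<open>0 < e\<close> constants_nonneg(1) by simp
      fix z assume "dist z y < e / (c0 + 1)"
      then have "(c0 + 1) * \<bar>z - y\<bar> \<le> e"
        using constants_nonneg(1) by (simp add: dist_real_def field_simps)
      moreover have "c0 * \<bar>z - y\<bar> \<le> (c0 + 1) * \<bar>z - y\<bar>" by (intro mult_right_mono) auto
      moreover have "\<bar>pm m z - pm m y\<bar> \<le> c0 * \<bar>z - y\<bar>"
        using pm_lip[OF m] unfolding lipschitz_with_def by blast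
      ultimately show "dist (pm m z) (pm m y) \<le> e" by (simp add: dist_real_def)
    qed
  qed
  then show ?thesis by (rule borel_measurable_continuous_onI)
qed

section \<open>Moments and smoothness of the kernel transforms\<close>

definition h :: "real \<Rightarrow> real \<Rightarrow> real" where
  "h \<beta> u = K ((x - u) / \<beta>)"

lemma K_measurable [measurable]: "K \<in> borel_measurable borel"
  using K_int by auto

lemma h_measurable [measurable]: "h \<beta> \<in> borel_measurable borel"
  unfolding h_def[abs_def] by measurable

lemma h_nonneg: "0 \<le> h \<beta> u" and h_le: "h \<beta> u \<le> B" and h_bounded: "\<bar>h \<beta> u\<bar> \<le> B"
  using K_nonneg K_le by (auto simp: h_def)

lemma h_lip: "0 < \<beta> \<Longrightarrow> \<bar>h \<beta> u - h \<beta> v\<bar> \<le> L / \<beta> * \<bar>u - v\<bar>"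
proof -
  assume "0 < \<beta>"
  have "\<bar>h \<beta> u - h \<beta> v\<bar> \<le> L * \<bar>(x - u) / \<beta> - (x - v) / \<beta>\<bar>"
    using K_lip unfolding lipschitz_with_def h_def by blast
  also have "(x - u) / \<beta> - (x - v) / \<beta> = (v - u) / \<beta>" by (simp add: diff_divide_distrib[symmetric])
  finally show ?thesis using \<open>0 < \<beta>\<close> by (simp add: abs_minus_commute)
qed

lemma h_integrable: "0 < \<beta> \<Longrightarrow> integrable lborel (h \<beta>)"
  and h_integral: "0 < \<beta> \<Longrightarrow> integral\<^sup>L lborel (h \<beta>) = \<beta>"
proof -
  assume b: "0 < \<beta>"
  have eq: "h \<beta> (x + (- \<beta>) * s) = K s" for s using b by (simp add: h_def)
  show "integrable lborel (h \<beta>)"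
    using lborel_integrable_real_affine_iff[of "- \<beta>" "h \<beta>" x] b K_int unfolding eq by simp
  show "integral\<^sup>L lborel (h \<beta>) = \<beta>"
    using lborel_integral_real_affine[of "- \<beta>" "h \<beta>" x] b K_one unfolding eq by simp
qed

lemma h_shift_integrable: "0 < \<beta> \<Longrightarrow> integrable lborel (\<lambda>y. h \<beta> (r + y))"
  and h_shift_integral: "0 < \<beta> \<Longrightarrow> (\<integral>y. h \<beta> (r + y) \<partial>lborel) = \<beta>"
  using lborel_integrable_real_affine_iff[of 1 "h \<beta>" r] lborel_integral_real_affine[of 1 "h \<beta>" r]
    h_integrable h_integral by auto

lemma integral_pm_le:
  assumes m: "m \<ge> 1" and f: "integrable lborel f" "\<And>y. 0 \<le> f y"
  shows "(\<integral>y. pm m y * f y \<partial>lborel) \<le> C * integral\<^sup>L lborel f"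
proof -
  have "(\<integral>y. pm m y * f y \<partial>lborel) \<le> (\<integral>y. C * f y \<partial>lborel)"
  proof (rule integral_mono)
    show "integrable lborel (\<lambda>y. pm m y * f y)"
    proof (rule Bochner_Integration.integrable_bound)
      show "integrable lborel (\<lambda>y. C * f y)" using f by simp
      show "(\<lambda>y. pm m y * f y) \<in> borel_measurable lborel"
        using f pm_measurable[OF m] by simp
      show "AE y in lborel. norm (pm m y * f y) \<le> norm (C * f y)"
        using pm_le[OF m] pm_nonneg f(2) constants_nonneg by (auto simp: abs_mult intro!: mult_mono)
    qed
  qed (use f pm_le[OF m] in \<open>auto intro!: mult_right_mono\<close>)
  then show ?thesis by simp
qed

definition xi :: "real \<Rightarrow> nat \<Rightarrow> ('d \<Rightarrow> int) \<Rightarrow> 'a \<Rightarrow> real" where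
  "xi \<beta> m i \<omega> = h \<beta> (Xtrunc a eps m i \<omega>)"

lemma xi_measurable [measurable]: "xi \<beta> m i \<in> borel_measurable M"
  unfolding xi_def[abs_def] by measurable

lemma xi_nonneg: "0 \<le> xi \<beta> m i \<omega>" and xi_le: "xi \<beta> m i \<omega> \<le> B" and xi_bounded: "\<bar>xi \<beta> m i \<omega>\<bar> \<le> B"
  using h_nonneg h_le h_bounded by (auto simp: xi_def)

lemma xi_L2: "xi \<beta> m i \<in> L2"
  by (rule L2_bounded[OF xi_measurable xi_bounded])

lemma xi_mean_le:
  assumes "m \<ge> 1" "0 < \<beta>"
  shows "expectation (xi \<beta> m i) \<le> C * \<beta>"
  using integral_pm_le[OF assms(1) h_integrable[OF assms(2)] h_nonneg] assms
  by (simp add: xi_def[abs_def] expectation_Xtrunc h_integral)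

lemma xi_mean_nonneg: "0 \<le> expectation (xi \<beta> m i)"
  using xi_nonneg by (intro integral_nonneg_AE) auto

lemma xi_sq_le:
  assumes "m \<ge> 1" "0 < \<beta>"
  shows "expectation (\<lambda>\<omega>. (xi \<beta> m i \<omega>)\<^sup>2) \<le> B * C * \<beta>"
proof -
  have "expectation (\<lambda>\<omega>. (xi \<beta> m i \<omega>)\<^sup>2) \<le> expectation (\<lambda>\<omega>. B * xi \<beta> m i \<omega>)"
    using L2_square[OF xi_L2] L2_integrable[OF xi_L2] xi_le xi_nonneg
    by (intro integral_mono) (auto simp: power2_eq_square intro!: mult_right_mono)
  also have "\<dots> = B * expectation (xi \<beta> m i)" by simp
  also have "\<dots> \<le> B * (C * \<beta>)" using xi_mean_le[OF assms] constants_nonneg by (intro mult_left_mono)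
  finally show ?thesis by (simp add: mult.assoc)
qed

text \<open>Stationarity moves the pair to \<open>zero_idx\<close> and \<open>l\<close>, where the
  joint density is at most \<open>C\<close> and \<open>h\<close> contributes an integral
  \<open>\<beta>\<close> in each variable. Products over distinct sites are thus of order
  \<open>\<beta>\<^sup>2\<close>, against order \<open>\<beta>\<close> for squares.\<close>

lemma xi_mult_le:
  assumes m: "m \<ge> 1" and b: "0 < \<beta>" and ij: "i \<noteq> j"
  shows "expectation (\<lambda>\<omega>. xi \<beta> m i \<omega> * xi \<beta> m j \<omega>) \<le> C * \<beta>\<^sup>2"
proof -
  define l where "l = (\<lambda>\<tau>. j \<tau> - i \<tau>)"
  have l: "l \<noteq> zero_idx" "shift i l = j" using ij
    by (auto simp: l_def zero_idx_def shift_def fun_eq_iff) metis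
  have meas: "(\<lambda>z. h \<beta> (fst z) * h \<beta> (snd z)) \<in> borel_measurable (borel :: (real \<times> real) measure)"
    by (intro borel_measurable_times measurable_compose[OF _ h_measurable]
        borel_measurable_continuous_onI continuous_intros)
  have int: "integrable (lborel \<Otimes>\<^sub>M lborel) (\<lambda>w. h \<beta> (fst w) * h \<beta> (snd w))"
  proof (rule lborel_pair.Fubini_integrable)
    show "integrable lborel (\<lambda>y. \<integral>z. norm (h \<beta> (fst (y, z)) * h \<beta> (snd (y, z))) \<partial>lborel)"
      using h_integrable[OF b] h_nonneg by (simp add: abs_mult)
  qed (use h_integrable[OF b] in auto)
  have "expectation (\<lambda>\<omega>. xi \<beta> m i \<omega> * xi \<beta> m j \<omega>) = expectation (\<lambda>\<omega>. xi \<beta> m zero_idx \<omega> * xi \<beta> m l \<omega>)"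
    using expectation_Xtrunc_shift[of "\<lambda>u v. h \<beta> u * h \<beta> v" m i zero_idx m l, OF meas] l
    by (simp add: xi_def shift_zero)
  also have "\<dots> = (\<integral>w. pjm m l (fst w) (snd w) * (h \<beta> (fst w) * h \<beta> (snd w)) \<partial>lborel)"
    using distributed_integral[OF pjm_dens[OF m l(1)], of "\<lambda>w. h \<beta> (fst w) * h \<beta> (snd w)"] meas pjm_nonneg
    by (simp add: xi_def)
  also have "\<dots> \<le> (\<integral>w. C * (h \<beta> (fst w) * h \<beta> (snd w)) \<partial>lborel)"
  proof (rule integral_mono')
    show "integrable lborel (\<lambda>w. C * (h \<beta> (fst w) * h \<beta> (snd w)))"
      unfolding lborel_prod[symmetric] using int by simp
    show "pjm m l (fst w) (snd w) * (h \<beta> (fst w) * h \<beta> (snd w)) \<le> C * (h \<beta> (fst w) * h \<beta> (snd w))" for w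
      using pjm_le[OF m l(1)] h_nonneg by (intro mult_right_mono) auto
    show "0 \<le> C * (h \<beta> (fst w) * h \<beta> (snd w))" for w
      using constants_nonneg h_nonneg by auto
  qed
  also have "\<dots> = C * \<beta>\<^sup>2"
  proof -
    have "(\<integral>w. h \<beta> (fst w) * h \<beta> (snd w) \<partial>(lborel \<Otimes>\<^sub>M lborel)) = integral\<^sup>L lborel (h \<beta>) * integral\<^sup>L lborel (h \<beta>)"
      using lborel_pair.integral_fst'[OF int, symmetric]
      by (simp add: split_beta)
    then show ?thesis by (simp add: lborel_prod h_integral[OF b] power2_eq_square)
  qed
  finally show ?thesis .
qed

text \<open>A substitution moves the shift from \<open>h\<close> onto the density
  \<open>pm m\<close>, whose Lipschitz constant is \<open>c0\<close>; the factor
  \<open>\<beta>\<close> is the integral of \<open>h\<close>.\<close>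

lemma mean_h_lipschitz:
  assumes m: "m \<ge> 1" and b: "0 < \<beta>"
  shows "\<bar>expectation (\<lambda>\<omega>. h \<beta> (y + Xtrunc a eps m i \<omega>)) - expectation (\<lambda>\<omega>. h \<beta> (z + Xtrunc a eps m i \<omega>))\<bar>
    \<le> \<beta> * c0 * \<bar>y - z\<bar>"
proof -
  have eq: "expectation (\<lambda>\<omega>. h \<beta> (y + Xtrunc a eps m i \<omega>)) = (\<integral>u. pm m (u - y) * h \<beta> u \<partial>lborel)" for y
    using expectation_Xtrunc[of "\<lambda>u. h \<beta> (y + u)" m i] m
      lborel_integral_real_affine[of 1 "\<lambda>u. pm m (u - y) * h \<beta> u" y] by simp
  have int: "integrable lborel (\<lambda>u. pm m (u - y) * h \<beta> u)" for y
  proof (rule Bochner_Integration.integrable_bound)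
    show "integrable lborel (\<lambda>u. C * h \<beta> u)" using h_integrable[OF b] by simp
    show "(\<lambda>u. pm m (u - y) * h \<beta> u) \<in> borel_measurable lborel"
      using pm_measurable[OF m] by simp
    show "AE u in lborel. norm (pm m (u - y) * h \<beta> u) \<le> norm (C * h \<beta> u)"
      using pm_le[OF m] pm_nonneg h_nonneg constants_nonneg by (auto simp: abs_mult intro!: mult_mono)
  qed
  have "\<bar>(\<integral>u. pm m (u - y) * h \<beta> u \<partial>lborel) - (\<integral>u. pm m (u - z) * h \<beta> u \<partial>lborel)\<bar>
      = \<bar>\<integral>u. (pm m (u - y) - pm m (u - z)) * h \<beta> u \<partial>lborel\<bar>"
    using int[of y] int[of z] by (simp add: left_diff_distrib)
  also have "\<dots> \<le> (\<integral>u. \<bar>(pm m (u - y) - pm m (u - z)) * h \<beta> u\<bar> \<partial>lborel)"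
    by (rule integral_abs_bound)
  also have "\<dots> \<le> (\<integral>u. c0 * \<bar>y - z\<bar> * h \<beta> u \<partial>lborel)"
  proof (rule integral_mono')
    show "integrable lborel (\<lambda>u. c0 * \<bar>y - z\<bar> * h \<beta> u)" using h_integrable[OF b] by simp
    fix u
    have "\<bar>pm m (u - y) - pm m (u - z)\<bar> \<le> c0 * \<bar>(u - y) - (u - z)\<bar>"
      using pm_lip[OF m] unfolding lipschitz_with_def by blast
    then show "\<bar>(pm m (u - y) - pm m (u - z)) * h \<beta> u\<bar> \<le> c0 * \<bar>y - z\<bar> * h \<beta> u"
      using h_nonneg by (simp add: abs_mult abs_minus_commute mult_right_mono)
    show "0 \<le> c0 * \<bar>y - z\<bar> * h \<beta> u" using h_nonneg constants_nonneg by simp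
  qed
  also have "\<dots> = \<beta> * c0 * \<bar>y - z\<bar>" by (simp add: h_integral[OF b])
  finally show ?thesis by (simp add: eq)
qed

text \<open>One factor of the square is bounded by \<open>L / \<beta> * \<bar>r\<bar>\<close>, the
  other by the sum of the two nonnegative values, whose integral is \<open>2 * \<beta>\<close>. The
  bandwidth cancels, and the bound is linear in \<open>\<bar>r\<bar>\<close>, not quadratic.\<close>

lemma h_increment_le:
  assumes m: "m \<ge> 1" and b: "0 < \<beta>"
  shows "expectation (\<lambda>\<omega>. (h \<beta> (r + Xtrunc a eps m i \<omega>) - h \<beta> (Xtrunc a eps m i \<omega>))\<^sup>2) \<le> 2 * C * L * \<bar>r\<bar>"
proof -
  let ?f = "\<lambda>y. (L / \<beta> * \<bar>r\<bar>) * (h \<beta> (r + y) + h \<beta> y)"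
  have le: "(h \<beta> (r + y) - h \<beta> y)\<^sup>2 \<le> ?f y" for y
  proof -
    have "(h \<beta> (r + y) - h \<beta> y)\<^sup>2 = \<bar>h \<beta> (r + y) - h \<beta> y\<bar> * \<bar>h \<beta> (r + y) - h \<beta> y\<bar>"
      by (simp add: power2_eq_square)
    also have "\<dots> \<le> (L / \<beta> * \<bar>r\<bar>) * (h \<beta> (r + y) + h \<beta> y)"
      using h_lip[OF b, of "r + y" y] h_nonneg[of \<beta> y] h_nonneg[of \<beta> "r + y"] constants_nonneg b
      by (intro mult_mono) auto
    finally show ?thesis .
  qed
  have f_int: "integrable lborel ?f" using h_integrable[OF b] h_shift_integrable[OF b] by simp
  have "expectation (\<lambda>\<omega>. (h \<beta> (r + Xtrunc a eps m i \<omega>) - h \<beta> (Xtrunc a eps m i \<omega>))\<^sup>2)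
      = (\<integral>y. pm m y * (h \<beta> (r + y) - h \<beta> y)\<^sup>2 \<partial>lborel)"
    using expectation_Xtrunc[of "\<lambda>y. (h \<beta> (r + y) - h \<beta> y)\<^sup>2" m i] m by simp
  also have "\<dots> \<le> C * (\<integral>y. (h \<beta> (r + y) - h \<beta> y)\<^sup>2 \<partial>lborel)"
  proof (rule integral_pm_le[OF m])
    show "integrable lborel (\<lambda>y. (h \<beta> (r + y) - h \<beta> y)\<^sup>2)"
    proof (rule Bochner_Integration.integrable_bound[OF f_int])
      show "AE y in lborel. norm ((h \<beta> (r + y) - h \<beta> y)\<^sup>2) \<le> norm (?f y)"
        unfolding real_norm_def abs_power2 by (intro AE_I2 order_trans[OF le abs_ge_self])
    qed simp
  qed simp
  also have "\<dots> \<le> C * integral\<^sup>L lborel ?f"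
    using le f_int constants_nonneg by (intro mult_left_mono integral_mono') (rule f_int, rule le, rule order_trans[OF zero_le_power2 le], simp)
  also have "integral\<^sup>L lborel ?f = 2 * L * \<bar>r\<bar>"
    using h_integrable[OF b] h_shift_integrable[OF b] h_integral[OF b] h_shift_integral[OF b] b by simp
  finally show ?thesis by (simp add: mult_ac)
qed

text \<open>The longer window is the shorter one plus an independent increment. With the increment
  frozen, \<open>h_increment_le\<close> applies to the shorter window; the mean modulus of the
  increment is at most \<open>sd * B_coef a m\<close>.\<close>

lemma xi_diff_sq_le:
  assumes m: "m \<ge> 1" and mN: "m \<le> N" and b: "0 < \<beta>"
  shows "expectation (\<lambda>\<omega>. (xi \<beta> N i \<omega> - xi \<beta> m i \<omega>)\<^sup>2) \<le> 2 * C * L * (sd * B_coef a m)"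
proof -
  let ?R = "win N i - win m i"
  let ?G = "\<lambda>z :: real \<times> real \<times> real. (h \<beta> (fst (snd z) + snd (snd z)) - h \<beta> (snd (snd z)))\<^sup>2"
  have split: "lin (win N i) (co i) \<omega> = lin ?R (co i) \<omega> + lin (win m i) (co i) \<omega>" for \<omega>
    using lin_split[of "win N i" "co i" \<omega> "win m i"] win_mono[OF mN, of i] by (simp add: Int_absorb1)
  have Gb: "\<bar>?G z\<bar> \<le> B\<^sup>2" for z
  proof -
    have "\<bar>h \<beta> u - h \<beta> v\<bar> \<le> B" for u v
      using h_nonneg[of \<beta> u] h_nonneg[of \<beta> v] h_le[of \<beta> u] h_le[of \<beta> v] by linarith
    then show ?thesis unfolding abs_power2 by (subst power2_abs[symmetric]) (intro power_mono, auto)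
  qed
  have "expectation (\<lambda>\<omega>. (xi \<beta> N i \<omega> - xi \<beta> m i \<omega>)\<^sup>2)
      = expectation (\<lambda>\<omega>. ?G (lin {} (co i) \<omega>, lin ?R (co i) \<omega>, lin (win m i) (co i) \<omega>))"
    by (simp add: xi_def Xtrunc_eq_lin split)
  also have "\<dots> = expectation (\<lambda>\<omega>. expectation (\<lambda>\<omega>'. ?G (lin {} (co i) \<omega>, lin ?R (co i) \<omega>, lin (win m i) (co i) \<omega>')))"
  proof (rule expectation_lin_indep[OF _ _ Gb])
    show "?G \<in> borel_measurable borel"
      by (intro borel_measurable_power borel_measurable_diff measurable_compose[OF _ h_measurable]
          borel_measurable_continuous_onI continuous_intros)
  qed auto
  also have "\<dots> \<le> expectation (\<lambda>\<omega>. 2 * C * L * \<bar>lin ?R (co i) \<omega>\<bar>)"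
  proof (rule integral_mono')
    show "integrable M (\<lambda>\<omega>. 2 * C * L * \<bar>lin ?R (co i) \<omega>\<bar>)"
      using L2_integrable[OF lin_L2] by simp
    show "expectation (\<lambda>\<omega>'. ?G (lin {} (co i) \<omega>, lin ?R (co i) \<omega>, lin (win m i) (co i) \<omega>'))
        \<le> 2 * C * L * \<bar>lin ?R (co i) \<omega>\<bar>" for \<omega>
      using h_increment_le[OF m b, of "lin ?R (co i) \<omega>" i] by (simp add: Xtrunc_eq_lin)
  qed (use constants_nonneg in auto)
  also have "\<dots> = 2 * C * L * expectation (\<lambda>\<omega>. \<bar>lin ?R (co i) \<omega>\<bar>)" by simp
  also have "\<dots> \<le> 2 * C * L * (sd * B_coef a m)"
  proof (rule mult_left_mono)
    have "expectation (\<lambda>\<omega>. \<bar>lin ?R (co i) \<omega>\<bar>) \<le> l2 (lin ?R (co i))"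
      by (rule expectation_abs_le_l2[OF lin_L2])
    also have "\<dots> = sd * sqrt (\<Sum>j\<in>?R. (co i j)\<^sup>2)" by (rule lin_l2) simp
    also have "\<dots> \<le> sd * B_coef a m"
      using sum_co_le_B[of ?R i m] win_subset_past B_coef_nonneg sd_nonneg
      by (intro mult_left_mono real_le_lsqrt) (auto simp: sum_nonneg)
    finally show "expectation (\<lambda>\<omega>. \<bar>lin ?R (co i) \<omega>\<bar>) \<le> sd * B_coef a m" .
  qed (use constants_nonneg in auto)
  finally show ?thesis .
qed

text \<open>Averaging over \<open>S - win m i\<close> preserves a Lipschitz constant, so it is
  enough that \<open>S\<close> contains one full window, to which \<open>mean_h_lipschitz\<close>
  applies.\<close>

lemma rest_mean_lipschitz:
  assumes m: "m \<ge> 1" and b: "0 < \<beta>" and S: "finite S" "win m i \<subseteq> S"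
  shows "\<bar>rest_mean (h \<beta>) S (co i) y - rest_mean (h \<beta>) S (co i) z\<bar> \<le> \<beta> * c0 * \<bar>y - z\<bar>"
proof -
  let ?r = "lin (S - win m i) (co i)" and ?u = "lin (win m i) (co i)"
  have split: "lin S (co i) \<omega> = ?r \<omega> + ?u \<omega>" for \<omega>
    using lin_split[of S "co i" \<omega> "win m i"] S by (simp add: Int_absorb1)
  have eq: "rest_mean (h \<beta>) S (co i) y = expectation (\<lambda>\<omega>. expectation (\<lambda>\<omega>'. h \<beta> (y + ?r \<omega> + ?u \<omega>')))" for y
  proof -
    let ?G = "\<lambda>v :: real \<times> real \<times> real. h \<beta> (y + fst (snd v) + snd (snd v))"
    have "rest_mean (h \<beta>) S (co i) y = expectation (\<lambda>\<omega>. ?G (lin {} (co i) \<omega>, ?r \<omega>, ?u \<omega>))"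
      by (simp add: rest_mean_def split add.assoc)
    also have "\<dots> = expectation (\<lambda>\<omega>. expectation (\<lambda>\<omega>'. ?G (lin {} (co i) \<omega>, ?r \<omega>, ?u \<omega>')))"
    proof (rule expectation_lin_indep[where B = B])
      show "?G \<in> borel_measurable borel"
        by (intro measurable_compose[OF _ h_measurable] borel_measurable_continuous_onI continuous_intros)
    qed (use h_bounded in auto)
    finally show ?thesis by simp
  qed
  let ?H = "\<lambda>y \<omega>. expectation (\<lambda>\<omega>'. h \<beta> (y + ?r \<omega> + ?u \<omega>'))"
  have H_int: "integrable M (?H y)" for y
  proof (rule integrable_const_bound[where B = B])
    have "?H y \<omega> = rest_mean (h \<beta>) (win m i) (co i) (y + ?r \<omega>)" for \<omega> by (simp add: rest_mean_def)
    then show "?H y \<in> borel_measurable M" "AE \<omega> in M. norm (?H y \<omega>) \<le> B"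
      using rest_mean_bounded[OF h_measurable h_bounded] rest_mean_measurable[OF h_measurable h_bounded]
      by simp_all
  qed
  have "\<bar>rest_mean (h \<beta>) S (co i) y - rest_mean (h \<beta>) S (co i) z\<bar> = \<bar>expectation (\<lambda>\<omega>. ?H y \<omega> - ?H z \<omega>)\<bar>"
    unfolding eq using H_int by simp
  also have "\<dots> \<le> expectation (\<lambda>\<omega>. \<bar>?H y \<omega> - ?H z \<omega>\<bar>)"
    by (rule integral_abs_bound)
  also have "\<dots> \<le> expectation (\<lambda>\<omega>. \<beta> * c0 * \<bar>y - z\<bar>)"
  proof (rule integral_mono)
    show "integrable M (\<lambda>\<omega>. \<bar>?H y \<omega> - ?H z \<omega>\<bar>)" using H_int by simp
    show "\<bar>?H y \<omega> - ?H z \<omega>\<bar> \<le> \<beta> * c0 * \<bar>y - z\<bar>" for \<omega>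
      using mean_h_lipschitz[OF m b, of "y + ?r \<omega>" i "z + ?r \<omega>"] by (simp add: Xtrunc_eq_lin)
  qed simp
  finally show ?thesis by (simp add: prob_space)
qed

section \<open>Conditional expectations given the past of a lattice point\<close>

definition cxi :: "real \<Rightarrow> nat \<Rightarrow> ('d \<Rightarrow> int) \<Rightarrow> ('d \<Rightarrow> int) \<Rightarrow> 'a \<Rightarrow> real" where
  "cxi \<beta> m i k = cexp (h \<beta>) (win m i) (co i) (past k)"

lemma cxi_L2: "cxi \<beta> m i k \<in> L2"
  unfolding cxi_def by (rule cexp_L2[OF h_measurable h_bounded])

lemma cxi_mean: "expectation (cxi \<beta> m i k) = expectation (xi \<beta> m i)"
  unfolding cxi_def by (subst cexp_expectation[OF h_measurable h_bounded]) (auto simp: xi_def[abs_def] Xtrunc_eq_lin)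

lemma cxi_self: "cxi \<beta> m i i \<omega> = xi \<beta> m i \<omega>"
proof -
  have "win m i - past i = {}" "win m i \<inter> past i = win m i" using win_subset_past[of m i] by auto
  then have "cxi \<beta> m i i \<omega> = expectation (\<lambda>\<omega>'. h \<beta> (lin (win m i) (co i) \<omega> + lin {} (co i) \<omega>'))"
    by (simp only: cxi_def cexp_def rest_mean_def)
  then show ?thesis by (simp add: xi_def Xtrunc_eq_lin prob_space lin_def[of "{}"])
qed

lemma cxi_inner: "expectation (\<lambda>\<omega>. cxi \<beta> m i k \<omega> * cxi \<beta> n j l \<omega>)
   = expectation (\<lambda>\<omega>. cxi \<beta> m i (\<lambda>\<tau>. min (k \<tau>) (l \<tau>)) \<omega> * cxi \<beta> n j (\<lambda>\<tau>. min (k \<tau>) (l \<tau>)) \<omega>)"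
  unfolding cxi_def past_Int[symmetric] by (rule cexp_inner[OF h_measurable h_bounded]) auto

text \<open>Conditioning on the past of an earlier point leaves a whole window next to
  \<open>i\<close> to be averaged, and however short, it smooths \<open>h\<close> to the Lipschitz
  constant \<open>\<beta> * c0\<close>. The innovations that are kept precede \<open>k\<close>,
  hence the tail \<open>A_coef a (lag i k)\<close>.\<close>

lemma cxi_l2:
  assumes m: "m \<ge> 1" and b: "0 < \<beta>" and k: "\<And>\<tau>. k \<tau> \<le> i \<tau>" "k \<noteq> i"
  shows "l2 (\<lambda>\<omega>. cxi \<beta> m i k \<omega> - expectation (xi \<beta> m i)) \<le> \<beta> * c0 * (sd * A_coef a (lag i k))"
proof -
  obtain t where t: "k t < i t" using k by (metis ext order_le_less)
  \<comment> \<open>In direction \<open>t\<close> the points of \<open>win m' i\<close> lie strictly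
    above \<open>i t - m'\<close>, which is at least \<open>k t\<close>, so this window avoids
    \<open>past k\<close>. The cap by \<open>m\<close> keeps it inside
    \<open>win m i\<close>.\<close>
  define m' where "m' = min m (nat (i t - k t))"
  have m': "m' \<ge> 1" "m' \<le> m" using m t by (auto simp: m'_def)
  have "win m' i \<inter> past k = {}"
  proof -
    have "False" if "j \<in> win m' i" "j \<in> past k" for j
    proof -
      have "i t - int m' < j t" "j t \<le> k t" using that by (auto simp: win_iff past_def)
      then show False using t by (auto simp: m'_def min_def split: if_splits)
    qed
    then show ?thesis by blast
  qed
  then have sub: "win m' i \<subseteq> win m i - past k" using win_mono[OF m'(2), of i] by auto
  have "l2 (\<lambda>\<omega>. cxi \<beta> m i k \<omega> - expectation (\<lambda>\<omega>. h \<beta> (lin (win m i) (co i) \<omega>)))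
      \<le> \<beta> * c0 * (sd * sqrt (\<Sum>j\<in>win m i \<inter> past k. (co i j)\<^sup>2))"
    unfolding cxi_def
    using rest_mean_lipschitz[OF m'(1) b _ sub] b constants_nonneg
    by (intro cexp_l2[OF h_measurable h_bounded]) auto
  also have "\<dots> \<le> \<beta> * c0 * (sd * A_coef a (lag i k))"
    using sum_co_le_A[of "win m i \<inter> past k" i k] win_subset_past[of m i] A_coef_nonneg sd_nonneg b constants_nonneg
    by (intro mult_left_mono real_le_lsqrt) (auto simp: sum_nonneg)
  finally show ?thesis by (simp add: xi_def[abs_def] Xtrunc_eq_lin)
qed

end

subsection \<open>The long-range part\<close>

definition near :: "nat \<Rightarrow> ('d::finite \<Rightarrow> int) \<Rightarrow> ('d \<Rightarrow> int) set" where
  "near m i = {j. \<forall>\<tau>. \<bar>i \<tau> - j \<tau>\<bar> < int m}"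

lemma near_eq_PiE: "near m i = PiE UNIV (\<lambda>\<tau>. {i \<tau> - int m <..< i \<tau> + int m})"
  by (rule set_eqI) (simp add: near_def PiE_UNIV_iff, smt (verit))

lemma finite_near [simp]: "finite (near m i)"
  unfolding near_eq_PiE by (intro finite_PiE) auto

lemma card_near: "card (near m (i :: 'd::finite \<Rightarrow> int)) \<le> (2 * m) ^ CARD('d)"
proof -
  have "card (near m i) = (\<Prod>\<tau>\<in>(UNIV :: 'd set). nat (2 * int m - 1))"
    unfolding near_eq_PiE by (subst card_PiE) (auto intro!: prod.cong)
  also have "\<dots> \<le> (\<Prod>\<tau>\<in>(UNIV :: 'd set). 2 * m)" by (intro prod_mono) auto
  finally show ?thesis by simp
qed

lemma win_disjoint: "j \<notin> near m i \<Longrightarrow> win m i \<inter> win m j = {}"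
proof -
  assume "j \<notin> near m i"
  then obtain t where t: "\<bar>i t - j t\<bar> \<ge> int m" by (auto simp: near_def not_less)
  have "False" if "l \<in> win m i" "l \<in> win m j" for l
  proof -
    have "i t - int m < l t" "l t \<le> i t" "j t - int m < l t" "l t \<le> j t"
      using that by (auto simp: win_iff)
    then show False using t by linarith
  qed
  then show ?thesis by blast
qed

lemma sqrt_prod: "sqrt (\<Prod>x\<in>A. f x) = (\<Prod>x\<in>A. sqrt (f x))"
  by (induction A rule: infinite_finite_induct) (simp_all add: real_sqrt_mult)

context linear_field
begin

abbreviation approx_err :: "nat \<Rightarrow> real" where
  "approx_err m \<equiv> sqrt (2 * C * L * (sd * B_coef a m))"

lemma l2_xi_diff_le:
  assumes "m \<ge> 1" "m \<le> N" "0 < \<beta>"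
  shows "l2 (\<lambda>\<omega>. xi \<beta> N i \<omega> - xi \<beta> m i \<omega>) \<le> approx_err m"
  unfolding l2_def by (intro real_sqrt_le_mono xi_diff_sq_le assms)

text \<open>\<open>l2_box_sum_dyadic\<close> applied to the centred difference of the conditional
  expectations at the two truncation levels. The absence of \<open>N\<close> from the bound is what
  later lets the full field be reached by approximation.\<close>

lemma l2_long_range:
  assumes m: "m \<ge> 1" and mN: "m \<le> N" and b: "0 < \<beta>" and n: "n \<ge> 1"
  shows "l2 (\<lambda>\<omega>. \<Sum>i\<in>box 1 (int n). xi \<beta> N i \<omega> - xi \<beta> m i \<omega> - (expectation (xi \<beta> N i) - expectation (xi \<beta> m i)))
    \<le> sqrt (real n ^ CARD('d)) * 8 ^ CARD('d) * (2 * \<beta> * c0 * sd * Delta a n + approx_err m)"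
proof -
  obtain R where R: "2 ^ R \<le> n" "n < 2 ^ (R + 1)" using ex_power_ivl1[of 2 n] n by auto
  define e where "e i = expectation (xi \<beta> N i) - expectation (xi \<beta> m i)" for i
  define V where "V i k \<omega> = cxi \<beta> N i k \<omega> - cxi \<beta> m i k \<omega> - e i" for i k \<omega>
  define c where "c = 2 * \<beta> * c0 * sd"
  define G where "G = approx_err m"
  \<comment> \<open>The tails at levels \<open>N\<close> and \<open>m\<close> give the factor 2 in
    \<open>c\<close>. At \<open>s = 0\<close> the time is \<open>i\<close> itself and nothing is
    averaged, so \<open>G\<close> has to bound the term; keeping the tail there as well makes
    \<open>g\<close> antitone.\<close>
  define g where "g s = c * A_coef a (\<lambda>\<tau>. 2 ^ s \<tau> - 1) + (if s = (\<lambda>_. 0) then G else 0)" for s :: "'d \<Rightarrow> nat"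
  let ?B = "PiE (UNIV :: 'd set) (\<lambda>_. {..R})"
  have finB: "finite ?B" by (intro finite_PiE) auto
  have c0: "0 \<le> c" using b constants_nonneg sd_nonneg by (simp add: c_def)
  have G0: "0 \<le> G" using constants_nonneg sd_nonneg B_coef_nonneg by (simp add: G_def)
  have VL2: "V i k \<in> L2" for i k
    unfolding V_def[abs_def] by (intro L2_diff cxi_L2 L2_const)
  let ?D = "\<lambda>i k \<omega>. cxi \<beta> N i k \<omega> - cxi \<beta> m i k \<omega>"
  have DL2: "?D i k \<in> L2" for i k by (intro L2_diff cxi_L2)
  have Dmean: "expectation (?D i k) = e i" for i k
    using L2_integrable[OF cxi_L2] by (simp add: e_def cxi_mean)
  \<comment> \<open>The expansion leads to four inner products of \<open>cxi\<close>, with possibly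
    different truncation levels, each of which depends only on the minimum of the times by
    \<open>cxi_inner\<close>.\<close>
  have Vinner: "expectation (\<lambda>\<omega>. V i k \<omega> * V j l \<omega>)
      = expectation (\<lambda>\<omega>. cxi \<beta> N i k \<omega> * cxi \<beta> N j l \<omega>) - expectation (\<lambda>\<omega>. cxi \<beta> N i k \<omega> * cxi \<beta> m j l \<omega>)
      - expectation (\<lambda>\<omega>. cxi \<beta> m i k \<omega> * cxi \<beta> N j l \<omega>) + expectation (\<lambda>\<omega>. cxi \<beta> m i k \<omega> * cxi \<beta> m j l \<omega>) - e i * e j"
    for i j k l
  proof -
    have "expectation (\<lambda>\<omega>. V i k \<omega> * V j l \<omega>)
        = expectation (\<lambda>\<omega>. ?D i k \<omega> * ?D j l \<omega> - e j * ?D i k \<omega> - e i * ?D j l \<omega> + e i * e j)"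
      by (intro Bochner_Integration.integral_cong refl) (simp add: V_def algebra_simps)
    also have "\<dots> = expectation (\<lambda>\<omega>. ?D i k \<omega> * ?D j l \<omega>) - e j * expectation (?D i k) - e i * expectation (?D j l) + e i * e j"
      using L2_mult[OF DL2 DL2] L2_integrable[OF DL2] by (simp add: prob_space del: Bochner_Integration.integral_diff) simp
    also have "\<dots> = expectation (\<lambda>\<omega>. ?D i k \<omega> * ?D j l \<omega>) - e i * e j"
      unfolding Dmean by simp
    also have "expectation (\<lambda>\<omega>. ?D i k \<omega> * ?D j l \<omega>) = expectation (\<lambda>\<omega>. cxi \<beta> N i k \<omega> * cxi \<beta> N j l \<omega>
        - cxi \<beta> N i k \<omega> * cxi \<beta> m j l \<omega> - cxi \<beta> m i k \<omega> * cxi \<beta> N j l \<omega> + cxi \<beta> m i k \<omega> * cxi \<beta> m j l \<omega>)"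
      by (intro Bochner_Integration.integral_cong refl) (simp add: algebra_simps)
    finally show ?thesis by (simp add: L2_mult cxi_L2)
  qed
  define \<Phi> where "\<Phi> i j u = expectation (\<lambda>\<omega>. V i u \<omega> * V j u \<omega>)" for i j u
  have inner: "expectation (\<lambda>\<omega>. V i k \<omega> * V j l \<omega>)
      = \<Phi> i j (\<lambda>\<tau>. min (k \<tau>) (l \<tau>))" for i j k l
    unfolding Vinner \<Phi>_def by (simp only: cxi_inner[of \<beta> N i k N j l] cxi_inner[of \<beta> N i k m j l]
        cxi_inner[of \<beta> m i k N j l] cxi_inner[of \<beta> m i k m j l])
  have bound: "l2 (V i (\<lambda>\<tau>. i \<tau> - 2 ^ s \<tau> + 1)) \<le> g s" for i s
  proof (cases "s = (\<lambda>_. 0)")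
    case True
    then have k: "(\<lambda>\<tau>. i \<tau> - 2 ^ s \<tau> + 1) = i" by simp
    have dL2: "(\<lambda>\<omega>. xi \<beta> N i \<omega> - xi \<beta> m i \<omega>) \<in> L2" by (intro L2_diff xi_L2)
    have "expectation (\<lambda>\<omega>. xi \<beta> N i \<omega> - xi \<beta> m i \<omega>) = e i"
      using L2_integrable[OF xi_L2] by (simp add: e_def)
    then have "l2 (V i i) \<le> l2 (\<lambda>\<omega>. xi \<beta> N i \<omega> - xi \<beta> m i \<omega>)"
      using variance_le_square[OF dL2, of 0] by (simp add: l2_def V_def cxi_self)
    also have "\<dots> \<le> G" unfolding G_def by (rule l2_xi_diff_le[OF m mN b])
    also have "\<dots> \<le> g s" using True c0 A_coef_nonneg[of a "\<lambda>_. 0"] by (simp add: g_def)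
    finally show ?thesis by (simp only: k)
  next
    case False
    let ?k = "\<lambda>\<tau>. i \<tau> - 2 ^ s \<tau> + 1"
    have le: "?k \<tau> \<le> i \<tau>" for \<tau> by simp
    obtain t where "s t \<noteq> 0" using False by auto
    then have "?k t \<noteq> i t" by simp
    then have ne: "?k \<noteq> i" by metis
    have l: "lag i ?k = (\<lambda>\<tau>. 2 ^ s \<tau> - 1)" by (simp add: lag_def fun_eq_iff)
    have N1: "N \<ge> 1" using m mN by simp
    have "V i ?k = (\<lambda>\<omega>. (cxi \<beta> N i ?k \<omega> - expectation (xi \<beta> N i)) - (cxi \<beta> m i ?k \<omega> - expectation (xi \<beta> m i)))"
      by (simp add: V_def e_def fun_eq_iff)
    then have "l2 (V i ?k) \<le> l2 (\<lambda>\<omega>. cxi \<beta> N i ?k \<omega> - expectation (xi \<beta> N i)) + l2 (\<lambda>\<omega>. cxi \<beta> m i ?k \<omega> - expectation (xi \<beta> m i))"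
      by (simp only:) (intro l2_diff L2_diff cxi_L2 L2_const)
    also have "\<dots> \<le> \<beta> * c0 * (sd * A_coef a (lag i ?k)) + \<beta> * c0 * (sd * A_coef a (lag i ?k))"
      by (intro add_mono cxi_l2 N1 m b le ne)
    also have "\<dots> = g s" using False by (simp add: g_def c_def l)
    finally show ?thesis .
  qed
  have anti: "g s \<le> g r" if "\<And>\<tau>. r \<tau> \<le> s \<tau>" for r s
  proof -
    have "A_coef a (\<lambda>\<tau>. 2 ^ s \<tau> - 1) \<le> A_coef a (\<lambda>\<tau>. 2 ^ r \<tau> - 1)"
      using that by (intro A_coef_antimono[OF a_sq] diff_right_mono power_increasing) auto
    then have "c * A_coef a (\<lambda>\<tau>. 2 ^ s \<tau> - 1) \<le> c * A_coef a (\<lambda>\<tau>. 2 ^ r \<tau> - 1)"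
      using c0 by (rule mult_left_mono)
    moreover have "s = (\<lambda>_. 0) \<Longrightarrow> r = (\<lambda>_. 0)" using that by (auto simp: fun_eq_iff)
    ultimately show ?thesis using G0 by (auto simp: g_def)
  qed
  let ?P = "\<lambda>r :: 'd \<Rightarrow> nat. \<Prod>\<tau>\<in>UNIV. sqrt (2 ^ r \<tau>)"
  have "l2 (\<lambda>\<omega>. \<Sum>i\<in>box 1 (int n). V i i \<omega>)
      \<le> (\<Sum>r\<in>?B. sqrt (real n ^ CARD('d) * (\<Prod>\<tau>\<in>UNIV. 2 * 2 ^ r \<tau>)) * (2 ^ CARD('d) * g r))"
    by (rule l2_box_sum_dyadic[where V = V and \<Phi> = \<Phi> and g = g]) (fact VL2 inner bound anti R(2))+
  also have "\<dots> = sqrt (real n ^ CARD('d)) * (sqrt (2 ^ CARD('d)) * 2 ^ CARD('d)) * (\<Sum>r\<in>?B. ?P r * g r)"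
    unfolding sum_distrib_left by (intro sum.cong refl) (simp add: prod.distrib real_sqrt_mult sqrt_prod)
  also have "(\<Sum>r\<in>?B. ?P r * g r) = c * (\<Sum>r\<in>?B. ?P r * A_coef a (\<lambda>\<tau>. 2 ^ r \<tau> - 1)) + (\<Sum>r\<in>?B. if r = (\<lambda>_. 0) then G else 0)"
    unfolding sum_distrib_left sum.distrib[symmetric] g_def
    by (intro sum.cong refl) (auto simp: algebra_simps)
  also have "(\<Sum>r\<in>?B. if r = (\<lambda>_. 0) then G else 0) = G"
    using finB by (simp add: PiE_UNIV_iff)
  \<comment> \<open>The constant \<open>8 ^ CARD('d)\<close> has three sources of
    \<open>2 ^ CARD('d)\<close> each: the neighbour counts, rounded up from their square root, the
    corners of a mixed increment, and the dyadic condensation.\<close>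
  also have "sqrt (real n ^ CARD('d)) * (sqrt (2 ^ CARD('d)) * 2 ^ CARD('d)) * (c * (\<Sum>r\<in>?B. ?P r * A_coef a (\<lambda>\<tau>. 2 ^ r \<tau> - 1)) + G)
      \<le> sqrt (real n ^ CARD('d)) * (2 ^ CARD('d) * 2 ^ CARD('d)) * (c * (2 ^ CARD('d) * Delta a n) + G)"
  proof (intro mult_mono mult_left_mono add_mono sum_dyadic_le_Delta[OF a_sq R(1)])
    have "(2::real) ^ CARD('d) \<ge> 1" by simp
    then show "sqrt (2 ^ CARD('d)) \<le> 2 ^ CARD('d)" by (intro real_le_lsqrt) (auto simp: power2_eq_square)
  qed (use c0 G0 A_coef_nonneg in \<open>auto intro!: add_nonneg_nonneg mult_nonneg_nonneg sum_nonneg prod_nonneg\<close>)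
  also have "\<dots> \<le> sqrt (real n ^ CARD('d)) * (2 ^ CARD('d) * 2 ^ CARD('d)) * (2 ^ CARD('d) * (c * Delta a n + G))"
    using G0 mult_left_mono[OF one_le_power[of "2::real" "CARD('d)"] G0]
    by (intro mult_left_mono) (auto simp: algebra_simps)
  also have "\<dots> = sqrt (real n ^ CARD('d)) * 8 ^ CARD('d) * (c * Delta a n + G)"
    by (simp add: power_mult_distrib[symmetric])
  finally show ?thesis by (simp add: V_def cxi_self c_def e_def G_def)
qed

section \<open>Covariances of finite range\<close>

lemma xi_mult_far:
  assumes "j \<notin> near m i"
  shows "expectation (\<lambda>\<omega>. xi \<beta> m i \<omega> * xi \<beta> m j \<omega>) = expectation (xi \<beta> m i) * expectation (xi \<beta> m j)"
proof -
  let ?G = "\<lambda>z :: real \<times> real \<times> real. h \<beta> (fst z) * h \<beta> (snd (snd z))"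
  have "expectation (\<lambda>\<omega>. xi \<beta> m i \<omega> * xi \<beta> m j \<omega>)
      = expectation (\<lambda>\<omega>. ?G (lin (win m i) (co i) \<omega>, lin {} (co i) \<omega>, lin (win m j) (co j) \<omega>))"
    by (simp add: xi_def Xtrunc_eq_lin)
  also have "\<dots> = expectation (\<lambda>\<omega>. expectation (\<lambda>\<omega>'. ?G (lin (win m i) (co i) \<omega>, lin {} (co i) \<omega>, lin (win m j) (co j) \<omega>')))"
  proof (rule expectation_lin_indep[where B = "B * B"])
    show "?G \<in> borel_measurable borel"
      by (intro borel_measurable_times measurable_compose[OF _ h_measurable]
          borel_measurable_continuous_onI continuous_intros)
    show "\<bar>?G z\<bar> \<le> B * B" for z
      unfolding abs_mult using h_bounded constants_nonneg by (intro mult_mono) auto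
  qed (use win_disjoint[OF assms] in auto)
  also have "\<dots> = expectation (xi \<beta> m i) * expectation (xi \<beta> m j)"
    by (simp add: xi_def[abs_def] Xtrunc_eq_lin)
  finally show ?thesis .
qed

lemma xi_mean_const: "m \<ge> 1 \<Longrightarrow> expectation (xi \<beta> m i) = expectation (xi \<beta> m zero_idx)"
  and xi_sq_const: "m \<ge> 1 \<Longrightarrow> expectation (\<lambda>\<omega>. (xi \<beta> m i \<omega>)\<^sup>2) = expectation (\<lambda>\<omega>. (xi \<beta> m zero_idx \<omega>)\<^sup>2)"
  using expectation_Xtrunc[of "h \<beta>" m] expectation_Xtrunc[of "\<lambda>u. (h \<beta> u)\<^sup>2" m]
  by (simp_all add: xi_def[abs_def])

lemma xi_cov:
  "expectation (\<lambda>\<omega>. (xi \<beta> m i \<omega> - expectation (xi \<beta> m i)) * (xi \<beta> m j \<omega> - expectation (xi \<beta> m j)))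
    = expectation (\<lambda>\<omega>. xi \<beta> m i \<omega> * xi \<beta> m j \<omega>) - expectation (xi \<beta> m i) * expectation (xi \<beta> m j)"
proof -
  let ?e = "\<lambda>i. expectation (xi \<beta> m i)"
  have "expectation (\<lambda>\<omega>. (xi \<beta> m i \<omega> - ?e i) * (xi \<beta> m j \<omega> - ?e j))
      = expectation (\<lambda>\<omega>. xi \<beta> m i \<omega> * xi \<beta> m j \<omega> - ?e j * xi \<beta> m i \<omega> - ?e i * xi \<beta> m j \<omega> + ?e i * ?e j)"
    by (intro Bochner_Integration.integral_cong refl) (simp add: algebra_simps)
  then show ?thesis
    using L2_mult[OF xi_L2 xi_L2] L2_integrable[OF xi_L2] by (simp add: prob_space)
qed

text \<open>As the means are nonnegative, each covariance is at most the raw product moment: order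
  \<open>\<beta>\<close> on the diagonal, order \<open>\<beta>\<^sup>2\<close> for the at most
  \<open>(2 * m) ^ CARD('d)\<close> near sites, and zero once the windows are disjoint.\<close>

lemma xi_sum_variance_le:
  assumes m: "m \<ge> 1" and b: "0 < \<beta>" and S: "finite S"
  shows "expectation (\<lambda>\<omega>. (\<Sum>i\<in>S. xi \<beta> m i \<omega> - expectation (xi \<beta> m i))\<^sup>2)
    \<le> real (card S) * (B * C * \<beta> + (2 * real m) ^ CARD('d) * (C * \<beta>\<^sup>2))"
proof -
  let ?Y = "\<lambda>i \<omega>. xi \<beta> m i \<omega> - expectation (xi \<beta> m i)"
  have YL2: "?Y i \<in> L2" for i by (intro L2_diff xi_L2 L2_const)
  have "expectation (\<lambda>\<omega>. (\<Sum>i\<in>S. ?Y i \<omega>)\<^sup>2) = (\<Sum>i\<in>S. \<Sum>j\<in>S. expectation (\<lambda>\<omega>. ?Y i \<omega> * ?Y j \<omega>))"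
    unfolding power2_eq_square sum_product
    by (simp add: Bochner_Integration.integral_sum
        Bochner_Integration.integrable_sum L2_mult YL2 del: Bochner_Integration.integral_diff)
  also have "\<dots> \<le> (\<Sum>i\<in>S. B * C * \<beta> + (2 * real m) ^ CARD('d) * (C * \<beta>\<^sup>2))"
  proof (rule sum_mono)
    fix i assume i: "i \<in> S"
    have "(\<Sum>j\<in>S. expectation (\<lambda>\<omega>. ?Y i \<omega> * ?Y j \<omega>))
        \<le> (\<Sum>j\<in>S. (if j = i then B * C * \<beta> else 0) + (if j \<in> near m i then C * \<beta>\<^sup>2 else 0))"
    proof (rule sum_mono)
      fix j assume "j \<in> S"
      have "expectation (\<lambda>\<omega>. ?Y i \<omega> * ?Y j \<omega>) \<le> expectation (\<lambda>\<omega>. xi \<beta> m i \<omega> * xi \<beta> m j \<omega>)"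
        unfolding xi_cov using xi_mean_nonneg by simp
      moreover have "j = i \<Longrightarrow> expectation (\<lambda>\<omega>. xi \<beta> m i \<omega> * xi \<beta> m j \<omega>) \<le> B * C * \<beta>"
        using xi_sq_le[OF m b, of i] by (simp add: power2_eq_square)
      moreover have "j \<noteq> i \<Longrightarrow> expectation (\<lambda>\<omega>. xi \<beta> m i \<omega> * xi \<beta> m j \<omega>) \<le> C * \<beta>\<^sup>2"
        using xi_mult_le[OF m b, of i j] by auto
      moreover have "j \<notin> near m i \<Longrightarrow> expectation (\<lambda>\<omega>. ?Y i \<omega> * ?Y j \<omega>) = 0"
        unfolding xi_cov by (simp add: xi_mult_far)
      moreover have "0 \<le> C * \<beta>\<^sup>2" "0 \<le> B * C * \<beta>" using constants_nonneg b by auto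
      ultimately show "expectation (\<lambda>\<omega>. ?Y i \<omega> * ?Y j \<omega>)
          \<le> (if j = i then B * C * \<beta> else 0) + (if j \<in> near m i then C * \<beta>\<^sup>2 else 0)"
        by (auto simp del: Bochner_Integration.integral_diff)
    qed
    also have "\<dots> = B * C * \<beta> + real (card (S \<inter> near m i)) * (C * \<beta>\<^sup>2)"
      using S i by (simp add: sum.distrib sum.inter_restrict[symmetric])
    also have "\<dots> \<le> B * C * \<beta> + (2 * real m) ^ CARD('d) * (C * \<beta>\<^sup>2)"
    proof (intro add_left_mono mult_right_mono)
      have "card (S \<inter> near m i) \<le> card (near m i)" by (intro card_mono) auto
      also have "\<dots> \<le> (2 * m) ^ CARD('d)" by (rule card_near)
      finally have "real (card (S \<inter> near m i)) \<le> real ((2 * m) ^ CARD('d))" by (rule of_nat_mono)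
      then show "real (card (S \<inter> near m i)) \<le> (2 * real m) ^ CARD('d)" by simp
    qed (use constants_nonneg in auto)
    finally show "(\<Sum>j\<in>S. expectation (\<lambda>\<omega>. ?Y i \<omega> * ?Y j \<omega>)) \<le> B * C * \<beta> + (2 * real m) ^ CARD('d) * (C * \<beta>\<^sup>2)" .
  qed
  finally show ?thesis by simp
qed

end

subsection \<open>Characteristic functions of block sums\<close>

text \<open>Both \<open>\<phi> n\<close> and \<open>exp (- y n)\<close> lie in the unit disc, so
  their powers differ by at most \<open>N n\<close> times the difference of the bases, and
  \<open>exp (- y n)\<close> agrees with \<open>1 - y n\<close> up to
  \<open>(y n)\<^sup>2\<close>.\<close>

lemma power_limit_exp:
  fixes \<phi> :: "nat \<Rightarrow> complex" and N :: "nat \<Rightarrow> nat" and s2 r :: "nat \<Rightarrow> real"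
  assumes \<phi>: "\<And>n. cmod (\<phi> n) \<le> 1" and s2: "\<And>n. 0 \<le> s2 n"
    and approx: "\<And>n. cmod (\<phi> n - (1 - t\<^sup>2 * s2 n / 2)) \<le> r n"
    and Ns2: "(\<lambda>n. real (N n) * s2 n) \<longlonglongrightarrow> \<sigma>2" and Nr: "(\<lambda>n. real (N n) * r n) \<longlonglongrightarrow> 0"
    and s20: "s2 \<longlonglongrightarrow> 0"
  shows "(\<lambda>n. \<phi> n ^ N n) \<longlonglongrightarrow> complex_of_real (exp (- (t\<^sup>2 * \<sigma>2 / 2)))"
proof -
  define y where "y n = t\<^sup>2 * s2 n / 2" for n
  have y0: "0 \<le> y n" for n using s2 by (simp add: y_def)
  have exp_y: "\<bar>exp (- y n) - (1 - y n)\<bar> \<le> (y n)\<^sup>2" for n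
  proof -
    have lo: "1 - y n \<le> exp (- y n)" using exp_ge_add_one_self[of "- y n"] by simp
    have "exp (- y n) \<le> 1 / (1 + y n)"
      using exp_ge_add_one_self[of "y n"] y0[of n] by (simp add: exp_minus inverse_eq_divide frac_le)
    moreover have "1 / (1 + y n) \<le> 1 - y n + (y n)\<^sup>2"
    proof -
      \<comment> \<open>The product equals \<open>1 + y n ^ 3\<close>.\<close>
      have "1 \<le> (1 - y n + (y n)\<^sup>2) * (1 + y n)"
        using y0[of n] by (simp add: power2_eq_square algebra_simps)
      then show ?thesis using y0[of n] by (simp add: pos_divide_le_eq)
    qed
    ultimately show ?thesis using lo by simp
  qed
  have bound: "cmod (\<phi> n ^ N n - complex_of_real (exp (- (real (N n) * y n)))) \<le> real (N n) * r n + real (N n) * y n * y n" for n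
  proof -
    have "complex_of_real (exp (- (real (N n) * y n))) = complex_of_real (exp (- y n)) ^ N n"
      by (simp add: exp_of_nat_mult[symmetric] flip: of_real_power)
    then have "cmod (\<phi> n ^ N n - complex_of_real (exp (- (real (N n) * y n))))
        \<le> real (N n) * cmod (\<phi> n - complex_of_real (exp (- y n)))"
      using norm_power_diff[of "\<phi> n" "complex_of_real (exp (- y n))" "N n"] \<phi>[of n] y0[of n] by simp
    also have "\<dots> \<le> real (N n) * (r n + (y n)\<^sup>2)"
    proof (rule mult_left_mono)
      have "cmod (\<phi> n - complex_of_real (exp (- y n)))
        \<le> cmod (\<phi> n - (1 - t\<^sup>2 * s2 n / 2)) + cmod (complex_of_real (1 - y n) - complex_of_real (exp (- y n)))"
      using norm_triangle_ineq[of "\<phi> n - (1 - t\<^sup>2 * s2 n / 2)" "complex_of_real (1 - y n) - complex_of_real (exp (- y n))"]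
      by (simp add: y_def)
      also have "\<dots> \<le> r n + (y n)\<^sup>2"
        using approx[of n] exp_y[of n] unfolding of_real_diff[symmetric] norm_of_real by (simp add: abs_minus_commute)
      finally show "cmod (\<phi> n - complex_of_real (exp (- y n))) \<le> r n + (y n)\<^sup>2" .
    qed simp
    finally show ?thesis by (simp add: power2_eq_square algebra_simps)
  qed
  have Ny: "(\<lambda>n. real (N n) * y n) \<longlonglongrightarrow> t\<^sup>2 * \<sigma>2 / 2"
    using tendsto_mult_left[OF Ns2, of "t\<^sup>2 / 2"] by (simp add: y_def mult_ac)
  have "y \<longlonglongrightarrow> 0" using tendsto_mult_left[OF s20, of "t\<^sup>2 / 2"] by (simp add: y_def[abs_def])
  from tendsto_add[OF Nr tendsto_mult[OF Ny this]]
  have "(\<lambda>n. real (N n) * r n + real (N n) * y n * y n) \<longlonglongrightarrow> 0" by simp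
  then have "(\<lambda>n. \<phi> n ^ N n - complex_of_real (exp (- (real (N n) * y n)))) \<longlonglongrightarrow> 0"
    by (rule Lim_null_comparison[OF always_eventually, rotated]) (use bound in auto)
  moreover have "(\<lambda>n. complex_of_real (exp (- (real (N n) * y n)))) \<longlonglongrightarrow> complex_of_real (exp (- (t\<^sup>2 * \<sigma>2 / 2)))"
    by (intro tendsto_intros Ny)
  ultimately show ?thesis using tendsto_add by fastforce
qed

context prob_space
begin

text \<open>\<open>iexp\<close> has Lipschitz constant 1, so mean-square approximations pass
  directly to characteristic functions.\<close>

lemma char_diff_le:
  assumes T: "T \<in> L2" and G: "G \<in> L2"
  shows "cmod (char (distr M borel T) t - char (distr M borel G) t) \<le> \<bar>t\<bar> * l2 (\<lambda>\<omega>. T \<omega> - G \<omega>)"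
proof -
  have [measurable]: "T \<in> borel_measurable M" "G \<in> borel_measurable M"
    using T G by (auto simp: L2_def)
  have eq: "char (distr M borel F) t = expectation (\<lambda>\<omega>. iexp (t * F \<omega>))" if "F \<in> borel_measurable M" for F
    using that by (simp add: char_def integral_distr)
  have int: "integrable M (\<lambda>\<omega>. iexp (t * F \<omega>))" if [measurable]: "F \<in> borel_measurable M" for F
    by (rule integrable_const_bound[where B = 1]) auto
  have lip: "cmod (iexp u - iexp v) \<le> \<bar>u - v\<bar>" for u v :: real
  proof -
    have "iexp u - iexp v = iexp v * (iexp (u - v) - 1)"
      by (simp add: algebra_simps exp_add[symmetric])
    then have "cmod (iexp u - iexp v) = cmod (iexp (u - v) - 1)" by (simp add: norm_mult)
    also have "\<dots> \<le> \<bar>u - v\<bar>" using iexp_approx1[of "u - v" 0] by simp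
    finally show ?thesis .
  qed
  have "cmod (char (distr M borel T) t - char (distr M borel G) t)
      = cmod (expectation (\<lambda>\<omega>. iexp (t * T \<omega>) - iexp (t * G \<omega>)))"
    by (simp only: eq[OF L2_measurable[OF T]] eq[OF L2_measurable[OF G]]
        Bochner_Integration.integral_diff[OF int[OF L2_measurable[OF T]] int[OF L2_measurable[OF G]]])
  also have "\<dots> \<le> expectation (\<lambda>\<omega>. cmod (iexp (t * T \<omega>) - iexp (t * G \<omega>)))"
    by (rule integral_norm_bound)
  also have "\<dots> \<le> expectation (\<lambda>\<omega>. \<bar>t\<bar> * \<bar>T \<omega> - G \<omega>\<bar>)"
  proof (rule integral_mono)
    show "integrable M (\<lambda>\<omega>. \<bar>t\<bar> * \<bar>T \<omega> - G \<omega>\<bar>)"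
      using L2_integrable[OF L2_diff[OF T G]] by simp
    show "cmod (iexp (t * T \<omega>) - iexp (t * G \<omega>)) \<le> \<bar>t\<bar> * \<bar>T \<omega> - G \<omega>\<bar>" for \<omega>
      using lip[of "t * T \<omega>" "t * G \<omega>"] by (simp add: abs_mult[symmetric] right_diff_distrib)
  qed (use int in auto)
  also have "\<dots> \<le> \<bar>t\<bar> * l2 (\<lambda>\<omega>. T \<omega> - G \<omega>)"
    using expectation_abs_le_l2[OF L2_diff[OF T G]] by (simp add: mult_left_mono)
  finally show ?thesis .
qed

end

context linear_field
begin

section \<open>Variance and Lindeberg bound of a single block sum\<close>

definition block_sum :: "real \<Rightarrow> nat \<Rightarrow> ('d \<Rightarrow> int) set \<Rightarrow> 'a \<Rightarrow> real" where
  "block_sum \<beta> m S \<omega> = (\<Sum>i\<in>S. xi \<beta> m i \<omega> - expectation (xi \<beta> m i))"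

lemma block_sum_L2: "block_sum \<beta> m S \<in> L2"
  unfolding block_sum_def[abs_def] by (intro L2_sum L2_diff xi_L2 L2_const)

lemma block_sum_mean: "expectation (block_sum \<beta> m S) = 0"
  unfolding block_sum_def[abs_def]
  by (subst Bochner_Integration.integral_sum) (auto simp: L2_integrable[OF xi_L2] prob_space)

context
  fixes \<beta> :: real and m :: nat and S :: "('d \<Rightarrow> int) set"
  assumes m: "m \<ge> 1" and b: "0 < \<beta>" and S: "finite S"
begin

text \<open>The squares are taken of the uncentred sum \<open>tot\<close>: since \<open>xi\<close>
  is nonnegative, so are \<open>off\<close>, \<open>diag\<close> and \<open>tot\<close>, and pairs
  can be bounded by raw product moments. The centring \<open>mu\<close>, of order
  \<open>card S * \<beta>\<close>, is carried along separately.\<close>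

private definition "off \<omega> = (\<Sum>i\<in>S. \<Sum>j\<in>S - {i}. xi \<beta> m i \<omega> * xi \<beta> m j \<omega>)"
private definition "diag \<omega> = (\<Sum>i\<in>S. (xi \<beta> m i \<omega>)\<^sup>2)"
private definition "tot \<omega> = (\<Sum>i\<in>S. xi \<beta> m i \<omega>)"
private definition "mu = (\<Sum>i\<in>S. expectation (xi \<beta> m i))"

private lemma block_sum_eq: "block_sum \<beta> m S \<omega> = tot \<omega> - mu"
  by (simp add: block_sum_def tot_def mu_def sum_subtractf)

private lemma off_integrable: "integrable M off"
  unfolding off_def[abs_def] by (intro Bochner_Integration.integrable_sum L2_mult xi_L2)

private lemma diag_integrable: "integrable M diag"
  unfolding diag_def[abs_def] by (intro Bochner_Integration.integrable_sum L2_square xi_L2)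

private lemma off_nonneg: "0 \<le> off \<omega>" and diag_nonneg: "0 \<le> diag \<omega>" and tot_nonneg: "0 \<le> tot \<omega>"
  by (auto simp: off_def diag_def tot_def intro!: sum_nonneg mult_nonneg_nonneg xi_nonneg)

private lemma tot_sq: "(tot \<omega>)\<^sup>2 = diag \<omega> + off \<omega>"
proof -
  have "(tot \<omega>)\<^sup>2 = (\<Sum>i\<in>S. \<Sum>j\<in>S. xi \<beta> m i \<omega> * xi \<beta> m j \<omega>)"
    by (simp add: tot_def power2_eq_square sum_product)
  also have "\<dots> = (\<Sum>i\<in>S. (xi \<beta> m i \<omega>)\<^sup>2 + (\<Sum>j\<in>S - {i}. xi \<beta> m i \<omega> * xi \<beta> m j \<omega>))"
    using S by (intro sum.cong refl) (simp add: sum.remove power2_eq_square)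
  finally show ?thesis by (simp add: diag_def off_def sum.distrib)
qed

text \<open>Bounding one factor of each square by \<open>B\<close> lowers the cubic expression to
  \<open>B * (tot \<omega>)\<^sup>2\<close>.\<close>

private lemma diag_tot: "diag \<omega> * tot \<omega> \<le> B * diag \<omega> + B * off \<omega>"
proof -
  have "diag \<omega> * tot \<omega> = (\<Sum>i\<in>S. \<Sum>j\<in>S. (xi \<beta> m i \<omega>)\<^sup>2 * xi \<beta> m j \<omega>)"
    by (simp add: diag_def tot_def sum_product)
  also have "\<dots> \<le> (\<Sum>i\<in>S. \<Sum>j\<in>S. B * (xi \<beta> m i \<omega> * xi \<beta> m j \<omega>))"
    using xi_nonneg xi_le by (intro sum_mono) (auto simp: power2_eq_square mult.assoc intro!: mult_right_mono)
  also have "\<dots> = B * (tot \<omega>)\<^sup>2"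
    unfolding tot_def power2_eq_square sum_product by (simp only: sum_distrib_left)
  finally show ?thesis by (simp add: tot_sq algebra_simps)
qed

private lemma off_mean: "expectation off \<le> (real (card S))\<^sup>2 * (C * \<beta>\<^sup>2)"
proof -
  have "expectation off = (\<Sum>i\<in>S. \<Sum>j\<in>S - {i}. expectation (\<lambda>\<omega>. xi \<beta> m i \<omega> * xi \<beta> m j \<omega>))"
    unfolding off_def[abs_def]
    by (simp add: Bochner_Integration.integral_sum
        Bochner_Integration.integrable_sum L2_mult xi_L2)
  also have "\<dots> \<le> (\<Sum>i\<in>S. \<Sum>j\<in>S - {i}. C * \<beta>\<^sup>2)"
    by (intro sum_mono xi_mult_le m b) auto
  also have "\<dots> \<le> (\<Sum>i\<in>S. \<Sum>j\<in>S. C * \<beta>\<^sup>2)"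
    using S constants_nonneg by (intro sum_mono sum_mono2) auto
  finally show ?thesis by (simp add: power2_eq_square)
qed

private lemma diag_mean: "expectation diag = real (card S) * expectation (\<lambda>\<omega>. (xi \<beta> m zero_idx \<omega>)\<^sup>2)"
proof -
  have "expectation diag = (\<Sum>i\<in>S. expectation (\<lambda>\<omega>. (xi \<beta> m i \<omega>)\<^sup>2))"
    unfolding diag_def[abs_def] by (simp add: Bochner_Integration.integral_sum L2_square xi_L2)
  also have "\<dots> = (\<Sum>i\<in>S. expectation (\<lambda>\<omega>. (xi \<beta> m zero_idx \<omega>)\<^sup>2))"
    by (intro sum.cong refl xi_sq_const m)
  finally show ?thesis by simp
qed

private lemma mu_bounds: "0 \<le> mu" "mu \<le> real (card S) * (C * \<beta>)"
proof -
  show "0 \<le> mu" unfolding mu_def by (intro sum_nonneg xi_mean_nonneg)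
  have "mu \<le> (\<Sum>i\<in>S. C * \<beta>)" unfolding mu_def by (intro sum_mono xi_mean_le m b)
  then show "mu \<le> real (card S) * (C * \<beta>)" by simp
qed

text \<open>The variance differs from the diagonal by \<open>expectation off - mu\<^sup>2\<close>,
  and both terms are of order \<open>(card S * \<beta>)\<^sup>2\<close>.\<close>

lemma block_sum_second_moment:
  "\<bar>expectation (\<lambda>\<omega>. (block_sum \<beta> m S \<omega>)\<^sup>2) - real (card S) * expectation (\<lambda>\<omega>. (xi \<beta> m zero_idx \<omega>)\<^sup>2)\<bar>
    \<le> (real (card S) * \<beta>)\<^sup>2 * (C + C\<^sup>2)"
proof -
  have totL2: "tot \<in> L2" unfolding tot_def[abs_def] by (intro L2_sum xi_L2)
  have tot_mean: "expectation tot = mu"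
    unfolding tot_def[abs_def] mu_def by (simp add: Bochner_Integration.integral_sum L2_integrable xi_L2)
  have "expectation (\<lambda>\<omega>. (block_sum \<beta> m S \<omega>)\<^sup>2) = expectation (\<lambda>\<omega>. (tot \<omega>)\<^sup>2 - 2 * mu * tot \<omega> + mu\<^sup>2)"
    by (intro Bochner_Integration.integral_cong refl) (simp add: block_sum_eq power2_diff algebra_simps)
  also have "\<dots> = expectation (\<lambda>\<omega>. (tot \<omega>)\<^sup>2) - 2 * mu * mu + mu\<^sup>2"
    using L2_square[OF totL2] L2_integrable[OF totL2] by (simp add: prob_space tot_mean)
  also have "expectation (\<lambda>\<omega>. (tot \<omega>)\<^sup>2) = expectation diag + expectation off"
    unfolding tot_sq using diag_integrable off_integrable by simp
  finally have "expectation (\<lambda>\<omega>. (block_sum \<beta> m S \<omega>)\<^sup>2) - expectation diag = expectation off - mu\<^sup>2"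
    by (simp add: power2_eq_square)
  moreover have "0 \<le> expectation off" using off_nonneg by simp
  moreover have "mu\<^sup>2 \<le> (real (card S) * (C * \<beta>))\<^sup>2" using mu_bounds by (intro power_mono)
  moreover have "0 \<le> mu\<^sup>2" by simp
  moreover note off_mean
  moreover have "(real (card S) * \<beta>)\<^sup>2 * (C + C\<^sup>2) = (real (card S))\<^sup>2 * (C * \<beta>\<^sup>2) + (real (card S) * (C * \<beta>))\<^sup>2"
    by (simp add: power_mult_distrib algebra_simps)
  moreover have "0 \<le> (real (card S))\<^sup>2 * (C * \<beta>\<^sup>2)" using constants_nonneg by simp
  ultimately show ?thesis unfolding diag_mean abs_le_iff by linarith
qed

text \<open>
  The off-diagonal part of the squared sum of the nonnegative \<^term>\<open>xi\<close> is negligible when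
  \<^term>\<open>real (card S) * \<beta>\<close> is small; the diagonal part is controlled by weighting it with the sum
  itself, which again produces only off-diagonal terms.
\<close>
lemma block_sum_lindeberg:
  assumes c: "0 < c"
  shows "expectation (\<lambda>\<omega>. min (6 * (block_sum \<beta> m S \<omega> / c)\<^sup>2) (\<bar>t\<bar> * \<bar>block_sum \<beta> m S \<omega> / c\<bar> ^ 3))
    \<le> (2 / c\<^sup>2) * (real (card S) * \<beta>) * (6 * (C\<^sup>2 + C) * (real (card S) * \<beta>)
        + (\<bar>t\<bar> / c) * (B\<^sup>2 * C + (B * C + B * C\<^sup>2) * (real (card S) * \<beta>)))"
proof -
  define U where "U \<omega> = block_sum \<beta> m S \<omega> / c" for \<omega>
  define s where "s = \<bar>t\<bar> / c"
  define Q where "Q \<omega> = 6 * mu\<^sup>2 + 6 * off \<omega> + s * (B * diag \<omega> + B * off \<omega> + mu * diag \<omega>)" for \<omega>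
  have s0: "0 \<le> s" using c by (simp add: s_def)
  have Q_int: "integrable M Q" unfolding Q_def[abs_def] using off_integrable diag_integrable by simp
  have pt: "min (6 * (U \<omega>)\<^sup>2) (\<bar>t\<bar> * \<bar>U \<omega>\<bar> ^ 3) \<le> (2 / c\<^sup>2) * Q \<omega>" for \<omega>
  proof -
    \<comment> \<open>The minimum factors as \<open>(U \<omega>)\<^sup>2 * w\<close>. For the
      \<open>mu\<close> and \<open>off\<close> parts of the square \<open>w \<le> 6\<close> is
      enough; the diagonal part is not small by itself and takes the linear bound \<open>wU\<close>,
      which supplies a further factor \<open>1 / c\<close>.\<close>
    define w where "w = min 6 (\<bar>t\<bar> * \<bar>U \<omega>\<bar>)"
    have w0: "0 \<le> w" and w6: "w \<le> 6" by (auto simp: w_def)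
    have wU: "w \<le> s * (tot \<omega> + mu)"
    proof -
      have "\<bar>U \<omega>\<bar> \<le> (tot \<omega> + mu) / c"
        using tot_nonneg[of \<omega>] mu_bounds c by (auto simp: U_def block_sum_eq abs_le_iff field_simps)
      then have "\<bar>t\<bar> * \<bar>U \<omega>\<bar> \<le> \<bar>t\<bar> * ((tot \<omega> + mu) / c)" by (intro mult_left_mono) auto
      then show ?thesis by (simp add: w_def s_def min_le_iff_disj)
    qed
    have "min (6 * (U \<omega>)\<^sup>2) (\<bar>t\<bar> * \<bar>U \<omega>\<bar> ^ 3) = (U \<omega>)\<^sup>2 * w"
    proof -
      have "\<bar>U \<omega>\<bar> ^ 3 = (\<bar>U \<omega>\<bar> * \<bar>U \<omega>\<bar>) * \<bar>U \<omega>\<bar>" by (simp only: power3_eq_cube)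
      also have "\<bar>U \<omega>\<bar> * \<bar>U \<omega>\<bar> = (U \<omega>)\<^sup>2" by (simp add: power2_eq_square)
      finally have cube: "\<bar>U \<omega>\<bar> ^ 3 = (U \<omega>)\<^sup>2 * \<bar>U \<omega>\<bar>" .
      show ?thesis unfolding w_def cube by (simp add: min_mult_distrib_left mult_ac)
    qed
    also have "(U \<omega>)\<^sup>2 \<le> (2 / c\<^sup>2) * ((tot \<omega>)\<^sup>2 + mu\<^sup>2)"
    proof -
      have "(tot \<omega> - mu)\<^sup>2 \<le> 2 * ((tot \<omega>)\<^sup>2 + mu\<^sup>2)"
        using zero_le_power2[of "tot \<omega> + mu"] by (simp add: power2_eq_square algebra_simps)
      then show ?thesis using c by (simp add: U_def block_sum_eq power_divide divide_right_mono)
    qed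
    also have "(2 / c\<^sup>2) * ((tot \<omega>)\<^sup>2 + mu\<^sup>2) * w = (2 / c\<^sup>2) * (mu\<^sup>2 * w + off \<omega> * w + diag \<omega> * w)"
      by (simp add: tot_sq algebra_simps)
    also have "\<dots> \<le> (2 / c\<^sup>2) * (mu\<^sup>2 * 6 + off \<omega> * 6 + diag \<omega> * (s * (tot \<omega> + mu)))"
      using w6 wU off_nonneg diag_nonneg by (intro mult_left_mono add_mono) auto
    also have "\<dots> \<le> (2 / c\<^sup>2) * Q \<omega>"
    proof (rule mult_left_mono)
      have "s * (diag \<omega> * tot \<omega>) \<le> s * (B * diag \<omega> + B * off \<omega>)"
        by (rule mult_left_mono[OF diag_tot s0])
      then show "mu\<^sup>2 * 6 + off \<omega> * 6 + diag \<omega> * (s * (tot \<omega> + mu)) \<le> Q \<omega>"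
        by (simp add: Q_def algebra_simps)
    qed (use c in simp)
    finally show ?thesis using w0 by (simp add: mult_right_mono)
  qed
  have "expectation (\<lambda>\<omega>. min (6 * (U \<omega>)\<^sup>2) (\<bar>t\<bar> * \<bar>U \<omega>\<bar> ^ 3)) \<le> expectation (\<lambda>\<omega>. (2 / c\<^sup>2) * Q \<omega>)"
  proof (rule integral_mono')
    show "0 \<le> (2 / c\<^sup>2) * Q \<omega>" for \<omega>
      using off_nonneg diag_nonneg mu_bounds constants_nonneg s0 by (simp add: Q_def)
  qed (use Q_int pt in auto)
  also have "\<dots> = (2 / c\<^sup>2) * (6 * mu\<^sup>2 + 6 * expectation off + s * (B * expectation diag + B * expectation off + mu * expectation diag))"
    unfolding Q_def using off_integrable diag_integrable by (simp add: prob_space)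
  also have "\<dots> \<le> (2 / c\<^sup>2) * (6 * (real (card S) * (C * \<beta>))\<^sup>2 + 6 * ((real (card S))\<^sup>2 * (C * \<beta>\<^sup>2))
      + s * (B * (real (card S) * (B * C * \<beta>)) + B * ((real (card S))\<^sup>2 * (C * \<beta>\<^sup>2))
        + real (card S) * (C * \<beta>) * (real (card S) * (B * C * \<beta>))))"
  proof -
    have d: "expectation diag \<le> real (card S) * (B * C * \<beta>)"
      unfolding diag_mean by (intro mult_left_mono xi_sq_le m b) simp
    have d0: "0 \<le> expectation diag" using diag_nonneg by simp
    show ?thesis
      using mu_bounds off_mean d d0 s0 constants_nonneg c
      by (intro mult_left_mono add_mono power_mono mult_mono) (auto intro!: add_nonneg_nonneg mult_nonneg_nonneg simp: off_nonneg)
  qed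
  also have "\<dots> = (2 / c\<^sup>2) * (real (card S) * \<beta>) * (6 * (C\<^sup>2 + C) * (real (card S) * \<beta>)
        + s * (B\<^sup>2 * C + (B * C + B * C\<^sup>2) * (real (card S) * \<beta>)))"
    by (simp add: power2_eq_square algebra_simps)
  finally show ?thesis by (simp add: U_def s_def)
qed

end

section \<open>Identically distributed, independent cubes separated by corridors of width
  \<open>m\<close>\<close>

definition blk :: "nat \<Rightarrow> nat \<Rightarrow> ('d \<Rightarrow> int) \<Rightarrow> ('d \<Rightarrow> int) set" where
  "blk l m v = shift (\<lambda>\<tau>. v \<tau> * int (l + m)) ` box 1 (int l)"

lemma inj_shift: "inj_on (shift u) T"
  by (rule inj_onI) (auto simp: shift_def fun_eq_iff)

text \<open>The block sum is one fixed functional of the innovations shifted by the corner of the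
  cube; the mean is the same at every site, so the centring is a constant of that
  functional.\<close>

lemma block_sum_distr:
  assumes m: "m \<ge> 1"
  shows "char (distr M borel (\<lambda>\<omega>. block_sum \<beta> m (blk l m v) \<omega> / c)) t
    = char (distr M borel (\<lambda>\<omega>. block_sum \<beta> m (box 1 (int l)) \<omega> / c)) t"
proof -
  let ?u = "\<lambda>\<tau>. v \<tau> * int (l + m)"
  define e where "e = expectation (xi \<beta> m zero_idx)"
  have e: "expectation (xi \<beta> m i) = e" for i unfolding e_def by (rule xi_mean_const[OF m])
  let ?\<Psi> = "\<lambda>w. iexp (t * ((\<Sum>i\<in>box 1 (int l). h \<beta> (Xtrunc a (\<lambda>j w. w j) m i w) - e) / c))"
  note Xtrunc_measurable_PiM[measurable]
  have m\<Psi>: "?\<Psi> \<in> borel_measurable (PiM UNIV (\<lambda>_. borel))" by measurable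
  have id: "Xtrunc a (\<lambda>j w. w j) m i (\<lambda>j. eps j \<omega>) = Xtrunc a eps m i \<omega>" for i \<omega>
    by (simp add: Xtrunc_def)
  have L2m: "block_sum \<beta> m S \<in> borel_measurable M" for S using block_sum_L2 by (rule L2_measurable)
  have char: "char (distr M borel (\<lambda>\<omega>. block_sum \<beta> m S \<omega> / c)) t
      = expectation (\<lambda>\<omega>. iexp (t * (block_sum \<beta> m S \<omega> / c)))" for S
    using L2m[of S] by (simp add: char_def integral_distr)
  have "block_sum \<beta> m (blk l m v) \<omega> / c
      = (\<Sum>i\<in>box 1 (int l). h \<beta> (Xtrunc a (\<lambda>j w. w j) m i (\<lambda>j. eps (shift ?u j) \<omega>)) - e) / c" for \<omega>
    unfolding block_sum_def blk_def sum.reindex[OF inj_shift] by (simp only: o_def e xi_def Xtrunc_shift)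
  then have "char (distr M borel (\<lambda>\<omega>. block_sum \<beta> m (blk l m v) \<omega> / c)) t = expectation (\<lambda>\<omega>. ?\<Psi> (\<lambda>j. eps (shift ?u j) \<omega>))"
    unfolding char by (simp only:)
  also have "\<dots> = expectation (\<lambda>\<omega>. ?\<Psi> (\<lambda>j. eps j \<omega>))" by (rule expectation_shift[OF m\<Psi>])
  also have "\<dots> = char (distr M borel (\<lambda>\<omega>. block_sum \<beta> m (box 1 (int l)) \<omega> / c)) t"
    unfolding char unfolding block_sum_def by (simp only: e id xi_def)
  finally show ?thesis .
qed

text \<open>The windows extend a cube by \<open>m - 1\<close> towards smaller indices only, so with
  period \<open>l + m\<close> the innovation sets \<open>W v\<close> of different cubes are
  disjoint.\<close>

lemma block_sum_indep:
  "indep_vars (\<lambda>_. borel) (\<lambda>v \<omega>. block_sum \<beta> m (blk l m v) \<omega> / c) V"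
proof -
  define W where "W v = (\<Union>i\<in>blk l m v. win m i)" for v
  have W: "v \<tau> * int (l + m) + 1 - int m < j \<tau> \<and> j \<tau> \<le> v \<tau> * int (l + m) + int l" if jW: "j \<in> W v" for j v \<tau>
  proof -
    obtain i where "i \<in> box 1 (int l)" "j \<in> win m (shift (\<lambda>\<tau>. v \<tau> * int (l + m)) i)"
      using jW unfolding W_def blk_def by blast
    then show ?thesis unfolding box_def win_iff shift_def by (smt (verit) mem_Collect_eq)
  qed
  have "disjoint_family_on W V"
    unfolding disjoint_family_on_def
  proof (intro ballI impI)
    fix u v :: "'d \<Rightarrow> int" assume "u \<noteq> v"
    then obtain t where t: "u t \<noteq> v t" by auto
    have aux: False if "j \<in> W u" "j \<in> W v" "u t < v t" for j u v
    proof -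
      have "(u t + 1) * int (l + m) \<le> v t * int (l + m)"
        using that by (intro mult_right_mono) auto
      then have "u t * int (l + m) + int (l + m) \<le> v t * int (l + m)" by (simp add: distrib_right)
      moreover have "j t \<le> u t * int (l + m) + int l" "v t * int (l + m) + 1 - int m < j t"
        using W[OF that(1), of t] W[OF that(2), of t] by auto
      ultimately show False by (simp add: algebra_simps)
    qed
    show "W u \<inter> W v = {}" using aux[of _ u v] aux[of _ v u] t by (metis disjoint_iff linorder_neqE)
  qed
  then have ind: "indep_vars (\<lambda>v. PiM (W v) (\<lambda>_. borel)) (\<lambda>v \<omega>. restrict (\<lambda>j. eps j \<omega>) (W v)) V"
    by (intro indep_vars_restrict[OF indep]) auto
  let ?Y = "\<lambda>v w. (\<Sum>i\<in>blk l m v. h \<beta> (\<Sum>j\<in>win m i. co i j * w j) - expectation (xi \<beta> m i)) / c"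
  have "indep_vars (\<lambda>_. borel) (\<lambda>v \<omega>. ?Y v (restrict (\<lambda>j. eps j \<omega>) (W v))) V"
  proof (rule indep_vars_compose2[OF ind])
    fix v
    have "(\<lambda>w. w j) \<in> borel_measurable (PiM (W v) (\<lambda>_. borel))" if "i \<in> blk l m v" "j \<in> win m i" for i j
      by (rule measurable_component_singleton) (use that in \<open>auto simp: W_def\<close>)
    then show "?Y v \<in> borel_measurable (PiM (W v) (\<lambda>_. borel))"
      by (intro borel_measurable_divide borel_measurable_sum borel_measurable_diff borel_measurable_const
          measurable_compose[OF _ h_measurable] borel_measurable_times) auto
  qed
  moreover have "?Y v (restrict (\<lambda>j. eps j \<omega>) (W v)) = block_sum \<beta> m (blk l m v) \<omega> / c" for v \<omega>
  proof -
    have "(\<Sum>j\<in>win m i. co i j * restrict (\<lambda>j. eps j \<omega>) (W v) j) = (\<Sum>j\<in>win m i. co i j * eps j \<omega>)"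
      if "i \<in> blk l m v" for i
      using that by (intro sum.cong refl) (auto simp: W_def)
    then show ?thesis by (simp add: block_sum_def xi_def Xtrunc_eq_lin lin_def cong: sum.cong)
  qed
  ultimately show ?thesis by (simp only:)
qed

lemma char_blocks:
  assumes m: "m \<ge> 1"
  shows "char (distr M borel (\<lambda>\<omega>. \<Sum>v\<in>box 0 (int q - 1). block_sum \<beta> m (blk l m v) \<omega> / c)) t
    = char (distr M borel (\<lambda>\<omega>. block_sum \<beta> m (box 1 (int l)) \<omega> / c)) t ^ (q ^ CARD('d))"
  by (subst char_distr_sum[OF block_sum_indep]) (simp add: block_sum_distr[OF m] card_box)

end

subsection \<open>Convergence of the block sums\<close>

text \<open>\<open>s n\<close> is the largest \<open>k \<le> n\<close> with
  \<open>k ^ Suc d * w n \<le> 1\<close>. Every fixed \<open>k\<close> is eventually admissible, so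
  \<open>s\<close> tends to infinity, and the spare power leaves \<open>inverse (s n)\<close> as a
  bound for \<open>s n ^ d * w n\<close>.\<close>

lemma slow_growth_exists:
  fixes w :: "nat \<Rightarrow> real"
  assumes w: "w \<longlonglongrightarrow> 0" and w0: "\<And>n. 0 \<le> w n"
  obtains s :: "nat \<Rightarrow> nat" where "filterlim s at_top sequentially" "(\<lambda>n. real (s n) ^ d * w n) \<longlonglongrightarrow> 0"
proof -
  define A where "A n = {k. k \<le> n \<and> real k ^ Suc d * w n \<le> 1}" for n
  define s where "s n = Max (A n)" for n
  have fin: "finite (A n)" for n by (rule finite_subset[of _ "{..n}"]) (auto simp: A_def)
  have "0 \<in> A n" for n by (simp add: A_def)
  then have sA: "s n \<in> A n" for n unfolding s_def using fin by (intro Max_in) auto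
  have top: "filterlim s at_top sequentially"
    unfolding filterlim_at_top
  proof
    fix k
    have "(\<lambda>n. real k ^ Suc d * w n) \<longlonglongrightarrow> 0" using tendsto_mult_left[OF w, of "real k ^ Suc d"] by simp
    then have "\<forall>\<^sub>F n in sequentially. real k ^ Suc d * w n < 1" by (rule order_tendstoD) simp
    with eventually_ge_at_top[of k] show "\<forall>\<^sub>F n in sequentially. k \<le> s n"
    proof eventually_elim
      case (elim n)
      then have "k \<in> A n" by (simp add: A_def)
      then show ?case unfolding s_def using fin by (intro Max_ge)
    qed
  qed
  have "(\<lambda>n. inverse (real (s n))) \<longlonglongrightarrow> 0"
    by (rule tendsto_inverse_0_at_top, rule filterlim_compose[OF filterlim_real_sequentially top])
  moreover have "\<forall>\<^sub>F n in sequentially. real (s n) ^ d * w n \<le> inverse (real (s n))"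
  proof -
    have "\<forall>\<^sub>F n in sequentially. s n \<ge> 1" using top by (simp add: filterlim_at_top)
    then show ?thesis
    proof eventually_elim
      case (elim n)
      have "real (s n) * (real (s n) ^ d * w n) \<le> 1" using sA[of n] by (simp add: A_def mult.assoc)
      then show ?case using elim by (simp add: field_simps)
    qed
  qed
  ultimately have "(\<lambda>n. real (s n) ^ d * w n) \<longlonglongrightarrow> 0"
    using w0 by (intro Lim_null_comparison[of "\<lambda>n. real (s n) ^ d * w n"]) (simp_all add: mult_nonneg_nonneg)
  then show ?thesis by (rule that[OF top])
qed

text \<open>Take \<open>l = m * s\<close> with \<open>s\<close> growing slowly. Adding the two null
  sequences in \<open>w\<close> lets one \<open>s\<close> serve both: \<open>s ^ d * w\<close>
  dominates \<open>l ^ d * b\<close> as well as \<open>l / n\<close>, while \<open>m / l\<close> is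
  \<open>1 / s\<close>.\<close>

lemma block_length_exists:
  fixes m :: "nat \<Rightarrow> nat" and b :: "nat \<Rightarrow> real" and d :: nat
  assumes d: "d \<ge> 1" and m: "\<And>n. m n \<ge> 1" and b: "\<And>n. 0 < b n"
    and mb: "(\<lambda>n. real (m n) ^ d * b n) \<longlonglongrightarrow> 0" and mn: "(\<lambda>n. real (m n) / real n) \<longlonglongrightarrow> 0"
  obtains l q :: "nat \<Rightarrow> nat" where "(\<lambda>n. real (l n) ^ d * b n) \<longlonglongrightarrow> 0"
    "\<And>n. q n * (l n + m n) \<le> n" "(\<lambda>n. real (q n) * real (l n) / real n) \<longlonglongrightarrow> 1"
proof -
  define w where "w n = real (m n) ^ d * b n + real (m n) / real n" for n
  have w0: "0 \<le> w n" for n using b[of n] by (simp add: w_def)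
  have "w \<longlonglongrightarrow> 0" using tendsto_add[OF mb mn] by (simp add: w_def[abs_def])
  then obtain s :: "nat \<Rightarrow> nat" where s: "filterlim s at_top sequentially" and sw: "(\<lambda>n. real (s n) ^ d * w n) \<longlonglongrightarrow> 0"
    using w0 by (rule slow_growth_exists)
  define l where "l n = m n * s n" for n
  define q where "q n = n div (l n + m n)" for n
  have lb: "(\<lambda>n. real (l n) ^ d * b n) \<longlonglongrightarrow> 0"
  proof (rule tendsto_sandwich[OF _ _ tendsto_const sw])
    show "\<forall>\<^sub>F n in sequentially. 0 \<le> real (l n) ^ d * b n" using b[THEN less_imp_le] by (auto intro!: always_eventually mult_nonneg_nonneg)
    show "\<forall>\<^sub>F n in sequentially. real (l n) ^ d * b n \<le> real (s n) ^ d * w n"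
      by (intro always_eventually allI) (auto simp: l_def w_def power_mult_distrib algebra_simps)
  qed
  have ln: "(\<lambda>n. real (l n) / real n) \<longlonglongrightarrow> 0"
  proof (rule tendsto_sandwich[OF _ _ tendsto_const sw])
    show "\<forall>\<^sub>F n in sequentially. real (l n) / real n \<le> real (s n) ^ d * w n"
    proof (intro always_eventually allI)
      fix n
      have "s n \<le> s n ^ d" using d by (cases "s n = 0") (auto intro: self_le_power)
      then have "real (s n) \<le> real (s n) ^ d" by (metis of_nat_le_iff of_nat_power)
      then have "real (s n) * (real (m n) / real n) \<le> real (s n) ^ d * w n"
        using b[of n] by (intro mult_mono) (auto simp: w_def)
      then show "real (l n) / real n \<le> real (s n) ^ d * w n" by (simp add: l_def mult.commute)
    qed
  qed (auto intro!: always_eventually)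
  have sinv: "(\<lambda>n. inverse (real (s n))) \<longlonglongrightarrow> 0"
    by (rule tendsto_inverse_0_at_top, rule filterlim_compose[OF filterlim_real_sequentially s])
  have qle: "q n * (l n + m n) \<le> n" for n by (simp add: q_def)
  have "(\<lambda>n. real (q n) * real (l n) / real n) \<longlonglongrightarrow> 1"
  proof (rule tendsto_sandwich)
    \<comment> \<open>The lower bound comes from \<open>n < q * (l + m) + (l + m)\<close> together
      with \<open>l + m = l * (1 + inverse s)\<close>, which holds once
      \<open>s \<ge> 1\<close>.\<close>
    let ?low = "\<lambda>n. (1 - real (l n) / real n - real (m n) / real n) / (1 + inverse (real (s n)))"
    have "?low \<longlonglongrightarrow> (1 - 0 - 0) / (1 + 0)"
      by (intro tendsto_intros ln mn sinv) auto
    then show "?low \<longlonglongrightarrow> 1" by simp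
    have s1: "\<forall>\<^sub>F n in sequentially. s n \<ge> 1" using s by (simp add: filterlim_at_top)
    show "\<forall>\<^sub>F n in sequentially. ?low n \<le> real (q n) * real (l n) / real n"
      using s1 eventually_ge_at_top[of 1]
    proof eventually_elim
      case (elim n)
      have "n < q n * (l n + m n) + (l n + m n)"
        using dividend_less_div_times[of "l n + m n" n] m[of n] by (simp add: q_def)
      then have "real n < real (q n * (l n + m n) + (l n + m n))" by (rule of_nat_less_iff[THEN iffD2])
      then have 1: "real n - real (l n) - real (m n) \<le> real (q n) * (real (l n) + real (m n))" by (simp add: algebra_simps)
      have sm: "real (l n) + real (m n) = real (l n) * (1 + inverse (real (s n)))"
        using elim by (simp add: l_def field_simps)
      have "(real n - real (l n) - real (m n)) / real n \<le> real (q n) * (real (l n) + real (m n)) / real n"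
        using 1 by (rule divide_right_mono) simp
      then have "(1 - real (l n) / real n - real (m n) / real n) \<le> real (q n) * real (l n) / real n * (1 + inverse (real (s n)))"
        using elim by (simp add: sm diff_divide_distrib mult.assoc)
      then show ?case by (simp add: pos_divide_le_eq add_pos_nonneg)
    qed
    show "\<forall>\<^sub>F n in sequentially. real (q n) * real (l n) / real n \<le> 1"
      using eventually_ge_at_top[of 1]
    proof eventually_elim
      case (elim n)
      have "q n * l n \<le> n" using qle[of n] by (simp add: distrib_left)
      then have "real (q n * l n) \<le> real n" by (rule of_nat_mono)
      then show ?case using elim by simp
    qed
  qed (rule tendsto_const)
  then show ?thesis by (rule that[OF lb qle])
qed

lemma lipschitz_imp_continuous:
  assumes "lipschitz_with c f"
  shows "isCont f z"
proof -
  have "((\<lambda>y. c * \<bar>y - z\<bar>) \<longlongrightarrow> c * \<bar>z - z\<bar>) (at z)" by (intro tendsto_intros)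
  then have "((\<lambda>y. f y - f z) \<longlongrightarrow> 0) (at z)"
    by (intro Lim_null_comparison[of "\<lambda>y. f y - f z" "\<lambda>y. c * \<bar>y - z\<bar>"])
      (use assms in \<open>auto simp: lipschitz_with_def intro!: always_eventually\<close>)
  then show ?thesis by (simp add: isCont_def LIM_zero_iff)
qed

context linear_field
begin

section \<open>Cubes inside the box and the sites outside them\<close>

lemma blk_iff: "i \<in> blk l m v \<longleftrightarrow> (\<forall>\<tau>. v \<tau> * int (l + m) + 1 \<le> i \<tau> \<and> i \<tau> \<le> v \<tau> * int (l + m) + int l)"
proof
  assume "i \<in> blk l m v"
  then show "\<forall>\<tau>. v \<tau> * int (l + m) + 1 \<le> i \<tau> \<and> i \<tau> \<le> v \<tau> * int (l + m) + int l"
    unfolding blk_def box_def shift_def by auto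
next
  assume *: "\<forall>\<tau>. v \<tau> * int (l + m) + 1 \<le> i \<tau> \<and> i \<tau> \<le> v \<tau> * int (l + m) + int l"
  define j where "j = (\<lambda>\<tau>. i \<tau> - v \<tau> * int (l + m))"
  have "j \<in> box 1 (int l)"
    unfolding box_def
  proof (intro CollectI allI)
    fix \<tau> show "1 \<le> j \<tau> \<and> j \<tau> \<le> int l" using *[rule_format, of \<tau>] by (simp add: j_def)
  qed
  moreover have "i = shift (\<lambda>\<tau>. v \<tau> * int (l + m)) j" by (simp add: shift_def j_def)
  ultimately show "i \<in> blk l m v" unfolding blk_def by blast
qed

lemma finite_blk [simp]: "finite (blk l m v)"
  by (simp add: blk_def)

lemma card_blk: "card (blk l m v) = l ^ CARD('d)"
  by (simp add: blk_def card_image inj_shift card_box)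

lemma blk_disjoint: "u \<noteq> v \<Longrightarrow> blk l m u \<inter> blk l m v = {}"
proof -
  assume "u \<noteq> v"
  then obtain t where t: "u t \<noteq> v t" by auto
  have aux: False if "i \<in> blk l m u" "i \<in> blk l m v" "u t < v t" for i u v
  proof -
    have "(u t + 1) * int (l + m) \<le> v t * int (l + m)"
      using that by (intro mult_right_mono) auto
    then have "u t * int (l + m) + int (l + m) \<le> v t * int (l + m)" by (simp add: distrib_right)
    moreover have "i t \<le> u t * int (l + m) + int l" "v t * int (l + m) + 1 \<le> i t"
      using that blk_iff by auto
    ultimately show False by linarith
  qed
  show ?thesis using aux[of _ u v] aux[of _ v u] t by (metis disjoint_iff linorder_neqE)
qed

lemma blk_subset_box:
  assumes "q * (l + m) \<le> n" "v \<in> box 0 (int q - 1)"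
  shows "blk l m v \<subseteq> box 1 (int n)"
proof
  fix i assume i: "i \<in> blk l m v"
  have "1 \<le> i \<tau> \<and> i \<tau> \<le> int n" for \<tau>
  proof
    have "0 \<le> v \<tau> \<and> v \<tau> \<le> int q - 1" using assms(2) unfolding box_def by blast
    then have v: "0 \<le> v \<tau>" "v \<tau> + 1 \<le> int q" by auto
    have "0 \<le> v \<tau> * int (l + m)" using v by simp
    then show "1 \<le> i \<tau>" using i blk_iff[of i l m v] by (smt (verit))
    have "(v \<tau> + 1) * int (l + m) \<le> int q * int (l + m)" using v by (intro mult_right_mono) auto
    also have "\<dots> \<le> int n" using assms(1) by (metis of_nat_le_iff of_nat_mult)
    finally have "v \<tau> * int (l + m) + int l \<le> int n" by (simp add: distrib_right)
    then show "i \<tau> \<le> int n" using i blk_iff[of i l m v] by (smt (verit))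
  qed
  then show "i \<in> box 1 (int n)" by (simp add: box_def)
qed

text \<open>The sites outside the cubes form the corridors and the strip left over by the division
  of \<open>n\<close> by \<open>l + m\<close>. \<open>xi_sum_variance_le\<close> asks only for their
  number, not for their shape.\<close>

lemma block_sum_remainder:
  assumes m: "m \<ge> 1" and b: "0 < \<beta>" and q: "q * (l + m) \<le> n"
  shows "l2 (\<lambda>\<omega>. block_sum \<beta> m (box 1 (int n)) \<omega> - (\<Sum>v\<in>box 0 (int q - 1). block_sum \<beta> m (blk l m v) \<omega>))
    \<le> sqrt ((real n ^ CARD('d) - (real q * real l) ^ CARD('d)) * (B * C * \<beta> + (2 * real m) ^ CARD('d) * (C * \<beta>\<^sup>2)))"
proof -
  let ?V = "box 0 (int q - 1) :: ('d \<Rightarrow> int) set" and ?I = "box 1 (int n) :: ('d \<Rightarrow> int) set"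
  let ?U = "\<Union>v\<in>?V. blk l m v"
  have sub: "?U \<subseteq> ?I" using blk_subset_box[OF q] by blast
  have sumU: "(\<Sum>v\<in>?V. block_sum \<beta> m (blk l m v) \<omega>) = block_sum \<beta> m ?U \<omega>" for \<omega>
    unfolding block_sum_def by (subst sum.UNION_disjoint) (use blk_disjoint in auto)
  have diff: "block_sum \<beta> m ?I \<omega> - block_sum \<beta> m ?U \<omega> = block_sum \<beta> m (?I - ?U) \<omega>" for \<omega>
    unfolding block_sum_def using sub by (subst sum_diff) auto
  have "card ?U = (\<Sum>v\<in>?V. card (blk l m v))"
    by (rule card_UN_disjoint) (use blk_disjoint in auto)
  also have "\<dots> = q ^ CARD('d) * l ^ CARD('d)" by (simp add: card_blk card_box)
  finally have cU: "card ?U = (q * l) ^ CARD('d)" by (simp add: power_mult_distrib)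
  have "card (?I - ?U) = n ^ CARD('d) - (q * l) ^ CARD('d)"
    using sub by (subst card_Diff_subset) (auto simp: cU card_box intro: finite_subset)
  moreover have "(q * l) ^ CARD('d) \<le> n ^ CARD('d)"
    using q by (intro power_mono) (auto simp: distrib_left)
  ultimately have c: "real (card (?I - ?U)) = real n ^ CARD('d) - (real q * real l) ^ CARD('d)"
    by (simp add: of_nat_diff)
  have "expectation (\<lambda>\<omega>. (block_sum \<beta> m (?I - ?U) \<omega>)\<^sup>2)
      \<le> real (card (?I - ?U)) * (B * C * \<beta> + (2 * real m) ^ CARD('d) * (C * \<beta>\<^sup>2))"
    unfolding block_sum_def by (rule xi_sum_variance_le[OF m b]) simp
  then show ?thesis
    unfolding sumU diff l2_def c by (rule real_sqrt_le_mono)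
qed

text \<open>By the identity \<open>q\<rho>\<close>, the \<open>q n ^ CARD('d)\<close> cubes together
  turn a first order term in \<open>y n\<close> per cube into \<open>\<rho> n\<close>, which tends
  to 1. The variance is of first order; the errors carry a further factor \<open>y n\<close> or
  \<open>inverse (c n)\<close> and vanish.\<close>

lemma char_blocks_tendsto:
  fixes b :: "nat \<Rightarrow> real" and mm ll q :: "nat \<Rightarrow> nat"
  assumes b: "\<And>n. 0 < b n" and nb: "filterlim (\<lambda>n. real n ^ CARD('d) * b n) at_top sequentially"
    and mm: "\<And>n. mm n \<ge> 1" and lb: "(\<lambda>n. real (ll n) ^ CARD('d) * b n) \<longlonglongrightarrow> 0"
    and ql: "(\<lambda>n. real (q n) * real (ll n) / real n) \<longlonglongrightarrow> 1"
    and var: "(\<lambda>n. expectation (\<lambda>\<omega>. (xi (b n) (mm n) zero_idx \<omega>)\<^sup>2) / b n) \<longlonglongrightarrow> \<sigma>2"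
  shows "(\<lambda>n. char (distr M borel (\<lambda>\<omega>. \<Sum>v\<in>box 0 (int (q n) - 1).
        block_sum (b n) (mm n) (blk (ll n) (mm n) v) \<omega> / sqrt (real n ^ CARD('d) * b n))) t)
      \<longlonglongrightarrow> complex_of_real (exp (- (t\<^sup>2 * \<sigma>2 / 2)))"
proof -
  define c where "c n = sqrt (real n ^ CARD('d) * b n)" for n
  define U where "U n \<omega> = block_sum (b n) (mm n) (box 1 (int (ll n))) \<omega> / c n" for n \<omega>
  define s2 where "s2 n = expectation (\<lambda>\<omega>. (U n \<omega>)\<^sup>2)" for n
  \<comment> \<open>Remainder of the third order expansion in the form of
    \<open>char_approx3'\<close>, which is where the factors 6 come from.\<close>
  define r where "r n = (t\<^sup>2 / 6) * expectation (\<lambda>\<omega>. min (6 * (U n \<omega>)\<^sup>2) (\<bar>t\<bar> * \<bar>U n \<omega>\<bar> ^ 3))" for n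
  define y where "y n = real (ll n) ^ CARD('d) * b n" for n
  define \<rho> where "\<rho> n = (real (q n) * real (ll n) / real n) ^ CARD('d)" for n
  define v where "v n = expectation (\<lambda>\<omega>. (xi (b n) (mm n) zero_idx \<omega>)\<^sup>2)" for n
  define er where "er n = expectation (\<lambda>\<omega>. (block_sum (b n) (mm n) (box 1 (int (ll n))) \<omega>)\<^sup>2) - real (ll n) ^ CARD('d) * v n" for n
  have y: "y \<longlonglongrightarrow> 0" using lb by (simp add: y_def[abs_def])
  have y0: "0 \<le> y n" for n using b[of n] by (simp add: y_def)
  have \<rho>: "\<rho> \<longlonglongrightarrow> 1" using tendsto_power[OF ql, of "CARD('d)"] by (simp add: \<rho>_def[abs_def])
  have \<rho>0: "0 \<le> \<rho> n" for n by (simp add: \<rho>_def)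
  have csq: "(c n)\<^sup>2 = real n ^ CARD('d) * b n" for n using b[of n] by (simp add: c_def)
  have cpos: "0 < c n" if "n \<ge> 1" for n using that b[of n] by (simp add: c_def)
  have c_top: "filterlim c at_top sequentially"
    unfolding c_def[abs_def] by (rule filterlim_compose[OF sqrt_at_top nb])
  have cinv: "(\<lambda>n. inverse (c n)) \<longlonglongrightarrow> 0" by (rule tendsto_inverse_0_at_top[OF c_top])
  have card: "real (card (box 1 (int (ll n)) :: ('d \<Rightarrow> int) set)) * b n = y n" for n
    by (simp add: card_box y_def)
  \<comment> \<open>At \<open>n = 0\<close> the norming \<open>c n\<close> is zero, so this identity
    and the comparisons built on it hold from \<open>n = 1\<close> on.\<close>
  have q\<rho>: "real (q n ^ CARD('d)) * y n / (c n)\<^sup>2 = \<rho> n" if "n \<ge> 1" for n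
    using that b[of n] by (simp add: y_def csq \<rho>_def power_divide power_mult_distrib)
  have er: "\<bar>er n\<bar> \<le> (y n)\<^sup>2 * (C + C\<^sup>2)" for n
    using block_sum_second_moment[OF mm b, of "box 1 (int (ll n))" n]
    unfolding card by (simp add: er_def v_def card_box)
  have UL2: "U n \<in> L2" for n
    using L2_cmult[OF block_sum_L2, of "1 / c n"] by (simp add: U_def[abs_def])
  have Umean: "expectation (U n) = 0" for n
    by (simp add: U_def[abs_def] block_sum_mean)
  have s2_eq: "s2 n = (real (ll n) ^ CARD('d) * v n + er n) / (c n)\<^sup>2" for n
    by (simp add: s2_def U_def er_def power_divide)
  have lv: "real (ll n) ^ CARD('d) * v n = y n * (v n / b n)" for n
    using b[of n] by (simp add: y_def)
  have er_lim: "er \<longlonglongrightarrow> 0"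
  proof (rule Lim_null_comparison[OF always_eventually])
    show "\<forall>n. norm (er n) \<le> (y n)\<^sup>2 * (C + C\<^sup>2)" using er by simp
    have "(\<lambda>n. (y n)\<^sup>2 * (C + C\<^sup>2)) \<longlonglongrightarrow> 0\<^sup>2 * (C + C\<^sup>2)" by (intro tendsto_intros y)
    then show "(\<lambda>n. (y n)\<^sup>2 * (C + C\<^sup>2)) \<longlonglongrightarrow> 0" by simp
  qed
  have var': "(\<lambda>n. v n / b n) \<longlonglongrightarrow> \<sigma>2" using var by (simp add: v_def)
  have "(\<lambda>n. char (distr M borel (U n)) t ^ (q n ^ CARD('d))) \<longlonglongrightarrow> complex_of_real (exp (- (t\<^sup>2 * \<sigma>2 / 2)))"
  proof (rule power_limit_exp)
    show "cmod (char (distr M borel (U n)) t) \<le> 1" for n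
    proof -
      have "real_distribution (distr M borel (U n))"
        by (rule real_distribution_distr) (use UL2 in \<open>auto simp: L2_def\<close>)
      then show ?thesis by (rule real_distribution.cmod_char_le_1)
    qed
    show "0 \<le> s2 n" for n by (simp add: s2_def)
    show "cmod (char (distr M borel (U n)) t - (1 - t\<^sup>2 * s2 n / 2)) \<le> r n" for n
      unfolding r_def
      by (rule char_approx3') (use UL2 L2_integrable[OF UL2] L2_square[OF UL2] Umean in \<open>auto simp: L2_def s2_def\<close>)
    show "s2 \<longlonglongrightarrow> 0"
    proof -
      have "(\<lambda>n. (y n * (v n / b n) + er n) * (inverse (c n))\<^sup>2) \<longlonglongrightarrow> (0 * \<sigma>2 + 0) * 0\<^sup>2"
        by (intro tendsto_intros y var' er_lim cinv)
      then show ?thesis by (simp add: s2_eq[abs_def] lv divide_inverse power_inverse)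
    qed
    show "(\<lambda>n. real (q n ^ CARD('d)) * s2 n) \<longlonglongrightarrow> \<sigma>2"
    proof -
      have e: "(\<lambda>n. real (q n ^ CARD('d)) * er n / (c n)\<^sup>2) \<longlonglongrightarrow> 0"
      proof (rule Lim_null_comparison)
        show "\<forall>\<^sub>F n in sequentially. norm (real (q n ^ CARD('d)) * er n / (c n)\<^sup>2) \<le> \<rho> n * y n * (C + C\<^sup>2)"
          using eventually_ge_at_top[of 1]
        proof eventually_elim
          case (elim n)
          have "norm (real (q n ^ CARD('d)) * er n / (c n)\<^sup>2) = real (q n ^ CARD('d)) * \<bar>er n\<bar> / (c n)\<^sup>2"
            by (simp add: abs_mult)
          also have "\<dots> \<le> real (q n ^ CARD('d)) * ((y n)\<^sup>2 * (C + C\<^sup>2)) / (c n)\<^sup>2"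
            using er[of n] by (intro divide_right_mono mult_left_mono) auto
          also have "\<dots> = (real (q n ^ CARD('d)) * y n / (c n)\<^sup>2) * y n * (C + C\<^sup>2)"
            by (simp add: power2_eq_square)
          finally show ?case unfolding q\<rho>[OF elim] .
        qed
        have "(\<lambda>n. \<rho> n * y n * (C + C\<^sup>2)) \<longlonglongrightarrow> 1 * 0 * (C + C\<^sup>2)" by (intro tendsto_intros \<rho> y)
        then show "(\<lambda>n. \<rho> n * y n * (C + C\<^sup>2)) \<longlonglongrightarrow> 0" by simp
      qed
      have "(\<lambda>n. \<rho> n * (v n / b n) + real (q n ^ CARD('d)) * er n / (c n)\<^sup>2) \<longlonglongrightarrow> 1 * \<sigma>2 + 0"
        by (intro tendsto_intros \<rho> var' e)
      moreover have "\<forall>\<^sub>F n in sequentially. \<rho> n * (v n / b n) + real (q n ^ CARD('d)) * er n / (c n)\<^sup>2 = real (q n ^ CARD('d)) * s2 n"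
        using eventually_ge_at_top[of 1]
      proof eventually_elim
        case (elim n)
        show ?case unfolding q\<rho>[OF elim, symmetric] s2_eq lv by (simp add: add_divide_distrib distrib_left mult_ac)
      qed
      ultimately show ?thesis by (simp add: tendsto_cong)
    qed
    show "(\<lambda>n. real (q n ^ CARD('d)) * r n) \<longlonglongrightarrow> 0"
    proof (rule Lim_null_comparison)
      let ?E = "\<lambda>n. 6 * (C\<^sup>2 + C) * y n + \<bar>t\<bar> * inverse (c n) * (B\<^sup>2 * C + (B * C + B * C\<^sup>2) * y n)"
      show "(\<lambda>n. t\<^sup>2 / 3 * (\<rho> n * ?E n)) \<longlonglongrightarrow> 0"
      proof -
        have "(\<lambda>n. t\<^sup>2 / 3 * (\<rho> n * ?E n)) \<longlonglongrightarrow> t\<^sup>2 / 3 * (1 * (6 * (C\<^sup>2 + C) * 0 + \<bar>t\<bar> * 0 * (B\<^sup>2 * C + (B * C + B * C\<^sup>2) * 0)))"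
          by (intro tendsto_intros \<rho> y cinv)
        then show ?thesis by simp
      qed
      show "\<forall>\<^sub>F n in sequentially. norm (real (q n ^ CARD('d)) * r n) \<le> t\<^sup>2 / 3 * (\<rho> n * ?E n)"
        using eventually_ge_at_top[of 1]
      proof eventually_elim
        case (elim n)
        have "expectation (\<lambda>\<omega>. min (6 * (U n \<omega>)\<^sup>2) (\<bar>t\<bar> * \<bar>U n \<omega>\<bar> ^ 3)) \<le> (2 / (c n)\<^sup>2) * y n * ?E n"
          using block_sum_lindeberg[OF mm[of n] b[of n] finite_box cpos[OF elim], of 1 "int (ll n)" t]
          unfolding card U_def by (simp add: divide_inverse)
        then have "real (q n ^ CARD('d)) * r n \<le> real (q n ^ CARD('d)) * ((t\<^sup>2 / 6) * ((2 / (c n)\<^sup>2) * y n * ?E n))"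
          unfolding r_def by (intro mult_left_mono) auto
        also have "\<dots> = t\<^sup>2 / 3 * ((real (q n ^ CARD('d)) * y n / (c n)\<^sup>2) * ?E n)"
          by simp
        also have "\<dots> = t\<^sup>2 / 3 * (\<rho> n * ?E n)" unfolding q\<rho>[OF elim] ..
        finally have "real (q n ^ CARD('d)) * r n \<le> t\<^sup>2 / 3 * (\<rho> n * ?E n)" .
        moreover have "0 \<le> r n" unfolding r_def by (intro mult_nonneg_nonneg integral_nonneg_AE) auto
        ultimately show ?case by simp
      qed
    qed
  qed
  then show ?thesis unfolding U_def[abs_def] c_def[symmetric] char_blocks[OF mm] .
qed

end

subsection \<open>The kernel density estimator\<close>

lemma char_normal_law:
  assumes "0 \<le> s2"
  shows "char (normal_law 0 s2) t = complex_of_real (exp (- (t\<^sup>2 * s2 / 2)))"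
proof (cases "s2 = 0")
  case True
  then show ?thesis by (simp add: normal_law_def char_def integral_return)
next
  case False
  define s where "s = sqrt s2"
  have s: "0 < s" "s\<^sup>2 = s2" using assms False by (auto simp: s_def)
  have scale: "s * normal_density 0 s (0 + s * u) = std_normal_density u" for u
    using s(1) by (simp add: normal_density_def power_mult_distrib real_sqrt_mult field_simps)
  have "char (normal_law 0 s2) t = (CLINT u|lborel. normal_density 0 s u *\<^sub>R iexp (t * u))"
    using False by (simp add: normal_law_def char_def integral_density s_def)
  also have "\<dots> = \<bar>s\<bar> *\<^sub>R (CLINT u|lborel. normal_density 0 s (0 + s * u) *\<^sub>R iexp (t * (0 + s * u)))"
    by (rule lborel_integral_real_affine) (use s in simp)
  also have "\<dots> = (CLINT u|lborel. s *\<^sub>R (normal_density 0 s (0 + s * u) *\<^sub>R iexp (t * (0 + s * u))))"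
    unfolding integral_scaleR_right using s by simp
  also have "\<dots> = (CLINT u|lborel. std_normal_density u *\<^sub>R iexp ((t * s) * u))"
    unfolding scaleR_scaleR scale by (simp add: mult.assoc)
  also have "\<dots> = char std_normal_distribution (t * s)"
    by (simp add: char_def integral_density)
  also have "\<dots> = complex_of_real (exp (- (t\<^sup>2 * s2 / 2)))"
    by (simp add: char_std_normal_distribution power_mult_distrib s)
  finally show ?thesis .
qed

lemma real_distribution_normal_law:
  assumes "0 \<le> s2"
  shows "real_distribution (normal_law 0 s2)"
proof (cases "s2 = 0")
  case True
  have "prob_space (return borel (0 :: real))" by (rule prob_space_return) simp
  with True show ?thesis by (simp add: normal_law_def real_distribution_def real_distribution_axioms_def)
next
  case False
  then have "prob_space (density lborel (\<lambda>u. ennreal (normal_density 0 (sqrt s2) u)))"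
    using assms by (intro prob_space_normal_density) simp
  with False show ?thesis by (simp add: normal_law_def real_distribution_def real_distribution_axioms_def)
qed

context prob_space
begin

lemma l2_center_le:
  assumes "f \<in> L2"
  shows "l2 (\<lambda>\<omega>. f \<omega> - expectation f) \<le> l2 f"
  using variance_le_square[OF assms, of 0] by (simp add: l2_def)

end

context linear_field
begin

context
  fixes X :: "('d \<Rightarrow> int) \<Rightarrow> 'a \<Rightarrow> real" and b :: "nat \<Rightarrow> real"
  assumes X_rv [measurable]: "\<And>i. X i \<in> borel_measurable M"
    and X_L2int: "\<And>i m. integrable M (\<lambda>\<omega>. (X i \<omega> - Xtrunc a eps m i \<omega>)\<^sup>2)"
    and X_L2lim: "\<And>i. (\<lambda>m. expectation (\<lambda>\<omega>. (X i \<omega> - Xtrunc a eps m i \<omega>)\<^sup>2)) \<longlonglongrightarrow> 0"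
begin

definition eta :: "real \<Rightarrow> ('d \<Rightarrow> int) \<Rightarrow> 'a \<Rightarrow> real" where
  "eta \<beta> i \<omega> = h \<beta> (X i \<omega>)"

lemma eta_L2: "eta \<beta> i \<in> L2"
  unfolding eta_def[abs_def] by (rule L2_bounded[where B = B]) (use h_bounded in auto)

lemma l2_eta_trunc_le:
  assumes b: "0 < \<beta>"
  shows "l2 (\<lambda>\<omega>. eta \<beta> i \<omega> - xi \<beta> N i \<omega>) \<le> L / \<beta> * l2 (\<lambda>\<omega>. X i \<omega> - Xtrunc a eps N i \<omega>)"
proof (rule l2_leI)
  have "expectation (\<lambda>\<omega>. (eta \<beta> i \<omega> - xi \<beta> N i \<omega>)\<^sup>2)
      \<le> expectation (\<lambda>\<omega>. (L / \<beta>)\<^sup>2 * (X i \<omega> - Xtrunc a eps N i \<omega>)\<^sup>2)"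
  proof (rule integral_mono)
    show "integrable M (\<lambda>\<omega>. (eta \<beta> i \<omega> - xi \<beta> N i \<omega>)\<^sup>2)"
      by (rule L2_square[OF L2_diff[OF eta_L2 xi_L2]])
    fix \<omega>
    have "\<bar>eta \<beta> i \<omega> - xi \<beta> N i \<omega>\<bar>\<^sup>2 \<le> (L / \<beta> * \<bar>X i \<omega> - Xtrunc a eps N i \<omega>\<bar>)\<^sup>2"
      unfolding eta_def xi_def by (intro power_mono h_lip[OF b]) auto
    then show "(eta \<beta> i \<omega> - xi \<beta> N i \<omega>)\<^sup>2 \<le> (L / \<beta>)\<^sup>2 * (X i \<omega> - Xtrunc a eps N i \<omega>)\<^sup>2"
      unfolding power_mult_distrib power2_abs .
  qed (use X_L2int in simp)
  also have "\<dots> = (L / \<beta> * l2 (\<lambda>\<omega>. X i \<omega> - Xtrunc a eps N i \<omega>))\<^sup>2"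
    unfolding power_mult_distrib l2_square by simp
  finally show "expectation (\<lambda>\<omega>. (eta \<beta> i \<omega> - xi \<beta> N i \<omega>)\<^sup>2) \<le> (L / \<beta> * l2 (\<lambda>\<omega>. X i \<omega> - Xtrunc a eps N i \<omega>))\<^sup>2" .
qed (use constants_nonneg b l2_nonneg in auto)

text \<open>For a fixed bandwidth the crude factor \<open>L / \<beta>\<close> is harmless:
  mean-square convergence of \<open>Xtrunc\<close> makes the finite sum as small as desired.\<close>

lemma truncation_exists:
  assumes b: "0 < \<beta>" and I: "finite I" and \<delta>: "0 < \<delta>"
  obtains N where "N \<ge> m" "(\<Sum>i\<in>I. l2 (\<lambda>\<omega>. eta \<beta> i \<omega> - xi \<beta> N i \<omega>)) \<le> \<delta>"
proof -
  have "(\<lambda>N. \<Sum>i\<in>I. L / \<beta> * l2 (\<lambda>\<omega>. X i \<omega> - Xtrunc a eps N i \<omega>)) \<longlonglongrightarrow> (\<Sum>i\<in>I. L / \<beta> * sqrt 0)"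
    unfolding l2_def by (intro tendsto_intros X_L2lim)
  then have "\<forall>\<^sub>F N in sequentially. (\<Sum>i\<in>I. L / \<beta> * l2 (\<lambda>\<omega>. X i \<omega> - Xtrunc a eps N i \<omega>)) < \<delta>"
    using \<delta> by (intro order_tendstoD) auto
  with eventually_ge_at_top[of m]
  have "\<forall>\<^sub>F N in sequentially. N \<ge> m \<and> (\<Sum>i\<in>I. L / \<beta> * l2 (\<lambda>\<omega>. X i \<omega> - Xtrunc a eps N i \<omega>)) < \<delta>"
    by eventually_elim simp
  then obtain N where N: "N \<ge> m" "(\<Sum>i\<in>I. L / \<beta> * l2 (\<lambda>\<omega>. X i \<omega> - Xtrunc a eps N i \<omega>)) < \<delta>"
    using eventually_happens'[OF sequentially_bot] by blast
  have "(\<Sum>i\<in>I. l2 (\<lambda>\<omega>. eta \<beta> i \<omega> - xi \<beta> N i \<omega>)) \<le> (\<Sum>i\<in>I. L / \<beta> * l2 (\<lambda>\<omega>. X i \<omega> - Xtrunc a eps N i \<omega>))"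
    by (intro sum_mono l2_eta_trunc_le b)
  with N show ?thesis by (intro that[of N]) auto
qed

text \<open>The bound on the distance of \<open>xi\<close> at levels \<open>N\<close> and
  \<open>m\<close> is free of \<open>N\<close>, so reaching the full field within
  \<open>\<delta>\<close> and letting \<open>\<delta>\<close> tend to 0 transfers it to
  \<open>eta\<close>.\<close>

lemma l2_eta_xi_le:
  assumes m: "m \<ge> 1" and b: "0 < \<beta>"
  shows "l2 (\<lambda>\<omega>. eta \<beta> i \<omega> - xi \<beta> m i \<omega>) \<le> approx_err m"
proof (rule field_le_epsilon)
  fix \<delta> :: real assume "0 < \<delta>"
  then obtain N where N: "N \<ge> m" "(\<Sum>i\<in>{i}. l2 (\<lambda>\<omega>. eta \<beta> i \<omega> - xi \<beta> N i \<omega>)) \<le> \<delta>"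
    using truncation_exists[OF b, of "{i}" \<delta> m] by auto
  have "l2 (\<lambda>\<omega>. (eta \<beta> i \<omega> - xi \<beta> N i \<omega>) + (xi \<beta> N i \<omega> - xi \<beta> m i \<omega>))
      \<le> l2 (\<lambda>\<omega>. eta \<beta> i \<omega> - xi \<beta> N i \<omega>) + l2 (\<lambda>\<omega>. xi \<beta> N i \<omega> - xi \<beta> m i \<omega>)"
    by (intro l2_add L2_diff eta_L2 xi_L2)
  then show "l2 (\<lambda>\<omega>. eta \<beta> i \<omega> - xi \<beta> m i \<omega>) \<le> approx_err m + \<delta>"
    using N(2) l2_xi_diff_le[OF m N(1) b, of i] by simp
qed

text \<open>Centring does not increase the \<open>l2\<close> norm, so the passage to level
  \<open>N\<close> costs at most \<open>\<delta>\<close> in total; \<open>l2_long_range\<close>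
  bounds the rest uniformly in \<open>N\<close>.\<close>

lemma l2_kde_block_sum_le:
  assumes m: "m \<ge> 1" and b: "0 < \<beta>" and n: "n \<ge> 1"
  shows "l2 (\<lambda>\<omega>. (\<Sum>i\<in>box 1 (int n). eta \<beta> i \<omega> - expectation (eta \<beta> i)) - block_sum \<beta> m (box 1 (int n)) \<omega>)
    \<le> sqrt (real n ^ CARD('d)) * 8 ^ CARD('d) * (2 * \<beta> * c0 * sd * Delta a n + approx_err m)"
    (is "?lhs \<le> ?rhs")
proof (rule field_le_epsilon)
  let ?I = "box 1 (int n) :: ('d \<Rightarrow> int) set"
  fix \<delta> :: real assume "0 < \<delta>"
  then obtain N where N: "N \<ge> m" "(\<Sum>i\<in>?I. l2 (\<lambda>\<omega>. eta \<beta> i \<omega> - xi \<beta> N i \<omega>)) \<le> \<delta>"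
    using truncation_exists[OF b, of ?I \<delta> m] by auto
  let ?P = "\<lambda>i \<omega>. eta \<beta> i \<omega> - xi \<beta> N i \<omega> - expectation (\<lambda>\<omega>. eta \<beta> i \<omega> - xi \<beta> N i \<omega>)"
  let ?Q = "\<lambda>i \<omega>. xi \<beta> N i \<omega> - xi \<beta> m i \<omega> - (expectation (xi \<beta> N i) - expectation (xi \<beta> m i))"
  have DL2: "(\<lambda>\<omega>. eta \<beta> i \<omega> - xi \<beta> N i \<omega>) \<in> L2" for i by (intro L2_diff eta_L2 xi_L2)
  have PL2: "?P i \<in> L2" for i by (intro L2_diff[OF DL2] L2_const)
  have QL2: "?Q i \<in> L2" for i by (intro L2_diff xi_L2 L2_const)
  have "expectation (\<lambda>\<omega>. eta \<beta> i \<omega> - xi \<beta> N i \<omega>) = expectation (eta \<beta> i) - expectation (xi \<beta> N i)" for i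
    using L2_integrable[OF eta_L2] L2_integrable[OF xi_L2] by simp
  then have "(\<Sum>i\<in>?I. eta \<beta> i \<omega> - expectation (eta \<beta> i)) - block_sum \<beta> m ?I \<omega>
      = (\<Sum>i\<in>?I. ?P i \<omega>) + (\<Sum>i\<in>?I. ?Q i \<omega>)" for \<omega>
    unfolding block_sum_def sum_subtractf[symmetric] sum.distrib[symmetric] by (intro sum.cong refl) simp
  then have "?lhs = l2 (\<lambda>\<omega>. (\<Sum>i\<in>?I. ?P i \<omega>) + (\<Sum>i\<in>?I. ?Q i \<omega>))" by (simp only:)
  also have "\<dots> \<le> l2 (\<lambda>\<omega>. \<Sum>i\<in>?I. ?P i \<omega>) + l2 (\<lambda>\<omega>. \<Sum>i\<in>?I. ?Q i \<omega>)"
    by (intro l2_add L2_sum PL2 QL2)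
  also have "l2 (\<lambda>\<omega>. \<Sum>i\<in>?I. ?P i \<omega>) \<le> (\<Sum>i\<in>?I. l2 (?P i))"
    by (intro l2_sum PL2)
  also have "\<dots> \<le> (\<Sum>i\<in>?I. l2 (\<lambda>\<omega>. eta \<beta> i \<omega> - xi \<beta> N i \<omega>))"
    by (intro sum_mono l2_center_le DL2)
  also have "\<dots> \<le> \<delta>" by (rule N(2))
  also have "l2 (\<lambda>\<omega>. \<Sum>i\<in>?I. ?Q i \<omega>) \<le> ?rhs"
    by (rule l2_long_range[OF m N(1) b n])
  finally show "?lhs \<le> ?rhs + \<delta>" by simp
qed

text \<open>On division by \<open>c n\<close> the long-range bound becomes a multiple of
  \<open>sqrt (b n) * Delta a n\<close> plus the root of a multiple of
  \<open>B_coef a (mm n) / b n\<close>, and the sites outside the cubes become a vanishing fraction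
  with a bounded variance per site. \<open>var\<close> speaks of the full field because its limit
  involves the density of \<open>X\<close>.\<close>

lemma kde_char_tendsto:
  fixes mm :: "nat \<Rightarrow> nat"
  assumes b: "\<And>n. 0 < b n" and nb: "filterlim (\<lambda>n. real n ^ CARD('d) * b n) at_top sequentially"
    and mm: "\<And>n. mm n \<ge> 1"
    and C1: "(\<lambda>n. sqrt (b n) * Delta a n) \<longlonglongrightarrow> 0"
    and C2: "(\<lambda>n. B_coef a (mm n) / b n) \<longlonglongrightarrow> 0"
    and C3: "(\<lambda>n. real (mm n) ^ CARD('d) * b n) \<longlonglongrightarrow> 0"
    and mn: "(\<lambda>n. real (mm n) / real n) \<longlonglongrightarrow> 0"
    and var: "(\<lambda>n. expectation (\<lambda>\<omega>. (eta (b n) zero_idx \<omega>)\<^sup>2) / b n) \<longlonglongrightarrow> \<sigma>2"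
  shows "(\<lambda>n. char (distr M borel (\<lambda>\<omega>. sqrt (real n ^ CARD('d) * b n) *
      (kde K b X n x \<omega> - expectation (kde K b X n x)))) t) \<longlonglongrightarrow> complex_of_real (exp (- (t\<^sup>2 * \<sigma>2 / 2)))"
proof -
  have d: "1 \<le> CARD('d)" by (simp add: Suc_leI)
  obtain l q :: "nat \<Rightarrow> nat" where lb: "(\<lambda>n. real (l n) ^ CARD('d) * b n) \<longlonglongrightarrow> 0"
    and q: "\<And>n. q n * (l n + mm n) \<le> n" and ql: "(\<lambda>n. real (q n) * real (l n) / real n) \<longlonglongrightarrow> 1"
    by (rule block_length_exists[OF d mm b C3 mn]) (rule that, assumption, blast, assumption)
  define c where "c n = sqrt (real n ^ CARD('d) * b n)" for n
  define T where "T n \<omega> = c n * (kde K b X n x \<omega> - expectation (kde K b X n x))" for n \<omega>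
  define G where "G n \<omega> = (\<Sum>v\<in>box 0 (int (q n) - 1). block_sum (b n) (mm n) (blk (l n) (mm n) v) \<omega> / c n)" for n \<omega>
  define err where "err n = sqrt (2 * C * L * (sd * (B_coef a (mm n) / b n)))" for n
  have err: "err \<longlonglongrightarrow> 0"
  proof -
    have "err \<longlonglongrightarrow> sqrt (2 * C * L * (sd * 0))" unfolding err_def[abs_def] by (intro tendsto_intros C2)
    then show ?thesis by simp
  qed
  have approx_err: "approx_err (mm n) / sqrt (b n) = err n" for n
    by (simp add: err_def real_sqrt_divide[symmetric])
  have csq: "(c n)\<^sup>2 = real n ^ CARD('d) * b n" for n using b[of n] by (simp add: c_def)
  have cpos: "0 < c n" if "n \<ge> 1" for n using that b[of n] by (simp add: c_def)

  \<comment> \<open>Norms are compared instead of second moments: the reverse triangle inequality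
    bounds their difference by \<open>approx_err\<close>, which division by
    \<open>sqrt (b n)\<close> turns into \<open>err n\<close>.\<close>
  have var_xi: "(\<lambda>n. expectation (\<lambda>\<omega>. (xi (b n) (mm n) zero_idx \<omega>)\<^sup>2) / b n) \<longlonglongrightarrow> \<sigma>2"
  proof -
    define e where "e n = l2 (eta (b n) zero_idx) / sqrt (b n)" for n
    define z where "z n = l2 (xi (b n) (mm n) zero_idx) / sqrt (b n)" for n
    have z_sq: "(z n)\<^sup>2 = expectation (\<lambda>\<omega>. (xi (b n) (mm n) zero_idx \<omega>)\<^sup>2) / b n" for n
      using b[of n] by (simp add: z_def power_divide l2_square)
    have e_sq: "(e n)\<^sup>2 = expectation (\<lambda>\<omega>. (eta (b n) zero_idx \<omega>)\<^sup>2) / b n" for n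
      using b[of n] by (simp add: e_def power_divide l2_square)
    have e0: "0 \<le> e n" for n using b[of n] by (simp add: e_def l2_nonneg)
    have e_lim: "e \<longlonglongrightarrow> sqrt \<sigma>2"
    proof -
      have "e = (\<lambda>n. sqrt ((e n)\<^sup>2))" using e0 by simp
      then show ?thesis using tendsto_real_sqrt[OF var] by (simp add: e_sq)
    qed
    have "\<bar>z n - e n\<bar> \<le> err n" for n
    proof -
      let ?x = "xi (b n) (mm n) zero_idx" and ?e = "eta (b n) zero_idx"
      have d: "l2 (\<lambda>\<omega>. ?e \<omega> - ?x \<omega>) \<le> approx_err (mm n)" by (rule l2_eta_xi_le[OF mm b])
      have "l2 ?e \<le> l2 (\<lambda>\<omega>. ?e \<omega> - ?x \<omega>) + l2 ?x"
        using l2_add[OF L2_diff[OF eta_L2[of "b n" zero_idx] xi_L2[of "b n" "mm n" zero_idx]] xi_L2[of "b n" "mm n" zero_idx]] by simp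
      moreover have "l2 ?x \<le> l2 ?e + l2 (\<lambda>\<omega>. ?e \<omega> - ?x \<omega>)"
        using l2_diff[OF eta_L2[of "b n" zero_idx] L2_diff[OF eta_L2[of "b n" zero_idx] xi_L2[of "b n" "mm n" zero_idx]]] by simp
      ultimately have "\<bar>l2 ?x - l2 ?e\<bar> \<le> approx_err (mm n)" using d by linarith
      then have "\<bar>l2 ?x - l2 ?e\<bar> / sqrt (b n) \<le> approx_err (mm n) / sqrt (b n)"
        using b[of n] by (intro divide_right_mono) auto
      then show ?thesis unfolding approx_err using b[of n] by (simp add: z_def e_def diff_divide_distrib[symmetric])
    qed
    then have "(\<lambda>n. z n - e n) \<longlonglongrightarrow> 0" by (intro Lim_null_comparison[OF always_eventually err]) auto
    from tendsto_add[OF this e_lim] have "z \<longlonglongrightarrow> sqrt \<sigma>2" by simp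
    from tendsto_power[OF this, of 2] have "(\<lambda>n. (z n)\<^sup>2) \<longlonglongrightarrow> (sqrt \<sigma>2)\<^sup>2" .
    \<comment> \<open>Turns the limit \<open>(sqrt \<sigma>2)\<^sup>2\<close> back into
      \<open>\<sigma>2\<close>.\<close>
    moreover have "0 \<le> \<sigma>2"
      by (rule LIMSEQ_le_const[OF var]) (use b in \<open>auto intro!: exI[of _ 0] divide_nonneg_pos\<close>)
    ultimately show ?thesis by (simp add: z_sq)
  qed
  have G_lim: "(\<lambda>n. char (distr M borel (G n)) t) \<longlonglongrightarrow> complex_of_real (exp (- (t\<^sup>2 * \<sigma>2 / 2)))"
    unfolding G_def[abs_def] c_def by (rule char_blocks_tendsto[OF b nb mm lb ql var_xi])

  have kde_eq: "kde K b X n x \<omega> = (1 / (c n)\<^sup>2) * (\<Sum>i\<in>box 1 (int n). eta (b n) i \<omega>)" for n \<omega>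
    by (simp add: kde_def csq eta_def h_def)
  have kdeL2: "kde K b X n x \<in> L2" for n
    unfolding kde_eq[abs_def] by (intro L2_cmult L2_sum eta_L2)
  have TL2: "T n \<in> L2" for n
    unfolding T_def[abs_def] by (intro L2_cmult L2_diff kdeL2 L2_const)
  have GL2: "G n \<in> L2" for n
  proof -
    have "(\<lambda>\<omega>. block_sum \<beta> m S \<omega> / c') \<in> L2" for \<beta> m S c'
      using L2_cmult[OF block_sum_L2, of "1 / c'" \<beta> m S] by simp
    then show ?thesis unfolding G_def[abs_def] by (intro L2_sum)
  qed
  define W where "W n = 8 ^ CARD('d) * (2 * c0 * sd * (sqrt (b n) * Delta a n) + err n)
      + sqrt ((1 - (real (q n) * real (l n) / real n) ^ CARD('d)) * (B * C + 2 ^ CARD('d) * C * (real (mm n) ^ CARD('d) * b n)))" for n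
  have W_lim: "W \<longlonglongrightarrow> 0"
  proof -
    have "W \<longlonglongrightarrow> 8 ^ CARD('d) * (2 * c0 * sd * 0 + 0) + sqrt ((1 - 1 ^ CARD('d)) * (B * C + 2 ^ CARD('d) * C * 0))"
      unfolding W_def[abs_def] by (intro tendsto_intros C1 C3 err ql)
    then show ?thesis by simp
  qed
  have TG: "l2 (\<lambda>\<omega>. T n \<omega> - G n \<omega>) \<le> W n" if n: "n \<ge> 1" for n
  proof -
    let ?I = "box 1 (int n) :: ('d \<Rightarrow> int) set"
    let ?P = "\<lambda>\<omega>. (\<Sum>i\<in>?I. eta (b n) i \<omega> - expectation (eta (b n) i)) - block_sum (b n) (mm n) ?I \<omega>"
    let ?R = "\<lambda>\<omega>. block_sum (b n) (mm n) ?I \<omega> - (\<Sum>v\<in>box 0 (int (q n) - 1). block_sum (b n) (mm n) (blk (l n) (mm n) v) \<omega>)"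
    have PL2: "?P \<in> L2" by (intro L2_diff L2_sum eta_L2 L2_const block_sum_L2)
    have RL2: "?R \<in> L2" by (intro L2_diff L2_sum block_sum_L2)
    have "expectation (kde K b X n x) = (1 / (c n)\<^sup>2) * (\<Sum>i\<in>?I. expectation (eta (b n) i))"
      unfolding kde_eq[abs_def] using L2_integrable[OF eta_L2] by (simp add: Bochner_Integration.integral_sum)
    then have "T n \<omega> = (1 / c n) * (\<Sum>i\<in>?I. eta (b n) i \<omega> - expectation (eta (b n) i))" for \<omega>
      using cpos[OF n] by (simp add: T_def kde_eq sum_subtractf power2_eq_square field_simps)
    then have "T n \<omega> - G n \<omega> = (1 / c n) * (?P \<omega> + ?R \<omega>)" for \<omega>
      by (simp add: G_def sum_divide_distrib diff_divide_distrib)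
    then have "l2 (\<lambda>\<omega>. T n \<omega> - G n \<omega>) = \<bar>1 / c n\<bar> * l2 (\<lambda>\<omega>. ?P \<omega> + ?R \<omega>)"
      by (simp only: l2_cmult)
    also have "\<dots> \<le> (1 / c n) * (l2 ?P + l2 ?R)"
      using cpos[OF n] l2_add[OF PL2 RL2] by (simp add: divide_right_mono)
    also have "\<dots> \<le> (1 / c n) * (sqrt (real n ^ CARD('d)) * 8 ^ CARD('d) * (2 * b n * c0 * sd * Delta a n + approx_err (mm n))
        + sqrt ((real n ^ CARD('d) - (real (q n) * real (l n)) ^ CARD('d)) * (B * C * b n + (2 * real (mm n)) ^ CARD('d) * (C * (b n)\<^sup>2))))"
      using cpos[OF n] by (intro mult_left_mono add_mono l2_kde_block_sum_le block_sum_remainder mm b n q) auto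
    also have "\<dots> = W n"
    proof -
      have 1: "(1 / c n) * (sqrt (real n ^ CARD('d)) * 8 ^ CARD('d) * (2 * b n * c0 * sd * Delta a n + approx_err (mm n)))
          = 8 ^ CARD('d) * (2 * c0 * sd * (sqrt (b n) * Delta a n) + err n)"
      proof -
        have r: "sqrt (real n ^ CARD('d)) / c n = 1 / sqrt (b n)" using n b[of n] by (simp add: c_def real_sqrt_mult)
        have "(2 * b n * c0 * sd * Delta a n) / sqrt (b n) = 2 * c0 * sd * (b n / sqrt (b n) * Delta a n)" by simp
        also have "b n / sqrt (b n) = sqrt (b n)" using b[of n] by (intro real_div_sqrt) simp
        finally have D: "(2 * b n * c0 * sd * Delta a n) / sqrt (b n) = 2 * c0 * sd * (sqrt (b n) * Delta a n)" .
        have "(1 / c n) * (sqrt (real n ^ CARD('d)) * 8 ^ CARD('d) * (y + z)) = 8 ^ CARD('d) * (sqrt (real n ^ CARD('d)) / c n * (y + z))" for y z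
          by simp
        then have "(1 / c n) * (sqrt (real n ^ CARD('d)) * 8 ^ CARD('d) * (y + z)) = 8 ^ CARD('d) * (y / sqrt (b n) + z / sqrt (b n))" for y z
          unfolding r by (simp add: add_divide_distrib)
        then show ?thesis unfolding D[symmetric] approx_err[symmetric] .
      qed
      have 2: "(1 / c n) * sqrt ((real n ^ CARD('d) - (real (q n) * real (l n)) ^ CARD('d)) * (B * C * b n + (2 * real (mm n)) ^ CARD('d) * (C * (b n)\<^sup>2)))
          = sqrt ((1 - (real (q n) * real (l n) / real n) ^ CARD('d)) * (B * C + 2 ^ CARD('d) * C * (real (mm n) ^ CARD('d) * b n)))"
      proof -
        have "(1 - (real (q n) * real (l n) / real n) ^ CARD('d)) * (B * C + 2 ^ CARD('d) * C * (real (mm n) ^ CARD('d) * b n))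
          = ((real n ^ CARD('d) - (real (q n) * real (l n)) ^ CARD('d)) * (B * C * b n + (2 * real (mm n)) ^ CARD('d) * (C * (b n)\<^sup>2))) / (real n ^ CARD('d) * b n)"
          using n b[of n] by (simp add: power_divide power_mult_distrib power2_eq_square field_simps)
        then show ?thesis by (simp add: real_sqrt_divide c_def)
      qed
      show ?thesis unfolding W_def by (rule trans[OF distrib_left arg_cong2[where f = "(+)", OF 1 2]])
    qed
    finally show ?thesis .
  qed
  have "(\<lambda>n. char (distr M borel (T n)) t - char (distr M borel (G n)) t) \<longlonglongrightarrow> 0"
  proof (rule Lim_null_comparison)
    show "\<forall>\<^sub>F n in sequentially. cmod (char (distr M borel (T n)) t - char (distr M borel (G n)) t) \<le> \<bar>t\<bar> * W n"
      using eventually_ge_at_top[of 1]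
    proof eventually_elim
      case (elim n)
      have "cmod (char (distr M borel (T n)) t - char (distr M borel (G n)) t) \<le> \<bar>t\<bar> * l2 (\<lambda>\<omega>. T n \<omega> - G n \<omega>)"
        by (rule char_diff_le[OF TL2 GL2])
      also have "\<dots> \<le> \<bar>t\<bar> * W n" by (intro mult_left_mono TG elim) simp
      finally show ?case .
    qed
    show "(\<lambda>n. \<bar>t\<bar> * W n) \<longlonglongrightarrow> 0" using tendsto_mult_left[OF W_lim, of "\<bar>t\<bar>"] by simp
  qed
  from tendsto_add[OF this G_lim]
  have "(\<lambda>n. char (distr M borel (T n)) t) \<longlonglongrightarrow> complex_of_real (exp (- (t\<^sup>2 * \<sigma>2 / 2)))" by simp
  then show ?thesis unfolding T_def[abs_def] c_def .
qed

end

end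

section \<open>The limiting variance and the continuity theorem\<close>

theorem theorem1:
  fixes M :: "'a measure"
    and eps :: "('d::finite \<Rightarrow> int) \<Rightarrow> 'a \<Rightarrow> real"
    and a :: "('d \<Rightarrow> int) \<Rightarrow> real"
    and X :: "('d \<Rightarrow> int) \<Rightarrow> 'a \<Rightarrow> real"
    and K :: "real \<Rightarrow> real"
    and b :: "nat \<Rightarrow> real"
    and p :: "real \<Rightarrow> real"
    and pm :: "nat \<Rightarrow> real \<Rightarrow> real"
    and pj :: "('d \<Rightarrow> int) \<Rightarrow> real \<Rightarrow> real \<Rightarrow> real"
    and pjm :: "nat \<Rightarrow> ('d \<Rightarrow> int) \<Rightarrow> real \<Rightarrow> real \<Rightarrow> real"
    and c0 :: real
    and x :: real
  assumes prob: "prob_space M"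
    (* i.i.d. innovations, mean zero, finite second moment, finite alpha-moment, alpha > 2 *)
    and indep: "prob_space.indep_vars M (\<lambda>_. borel) eps UNIV"
    and ident: "\<And>i. distr M borel (eps i) = distr M borel (eps zero_idx)"
    and int_eps: "integrable M (eps zero_idx)"
    and mean0: "prob_space.expectation M (eps zero_idx) = 0"
    and sq_int: "integrable M (\<lambda>\<omega>. (eps zero_idx \<omega>)\<^sup>2)"
    and moment: "\<exists>\<alpha>>2. integrable M (\<lambda>\<omega>. \<bar>eps zero_idx \<omega>\<bar> powr \<alpha>)"
    (* square-summable coefficients; X_i = sum_{k \<succeq> 0} a_k eps_{i-k} as L2-limit *)
    and a_sq: "(\<lambda>k. (a k)\<^sup>2) summable_on nonneg_idx"
    and X_rv: "\<And>i. X i \<in> borel_measurable M"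
    and X_L2int: "\<And>i m. integrable M (\<lambda>\<omega>. (X i \<omega> - Xtrunc a eps m i \<omega>)\<^sup>2)"
    and X_L2lim: "\<And>i. (\<lambda>m. prob_space.expectation M (\<lambda>\<omega>. (X i \<omega> - Xtrunc a eps m i \<omega>)\<^sup>2))
                        \<longlonglongrightarrow> 0"
    (* kernel: bounded Lipschitz probability density *)
    and K_nonneg: "\<And>s. 0 \<le> K s"
    and K_int: "integrable lborel K"
    and K_one: "integral\<^sup>L lborel K = 1"
    and K_bdd: "\<exists>B. \<forall>s. \<bar>K s\<bar> \<le> B"
    and K_lip: "\<exists>L. lipschitz_with L K"
    (* bandwidths *)
    and b_pos: "\<And>n. 0 < b n"
    and b_lim: "b \<longlonglongrightarrow> 0"
    and nb_lim: "filterlim (\<lambda>n. real n ^ CARD('d) * b n) at_top sequentially"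
    (* Condition D (i) *)
    and p_nonneg: "\<And>y. 0 \<le> p y"
    and p_dens: "distributed M lborel (X zero_idx) (\<lambda>y. ennreal (p y))"
    and pm_nonneg: "\<And>m y. 0 \<le> pm m y"
    and pm_dens: "\<And>m. m \<ge> 1 \<Longrightarrow>
        distributed M lborel (Xtrunc a eps m zero_idx) (\<lambda>y. ennreal (pm m y))"
    and p_lip: "lipschitz_with c0 p"
    and pm_lip: "\<And>m. m \<ge> 1 \<Longrightarrow> lipschitz_with c0 (pm m)"
    and p_bdd: "\<exists>C. \<forall>y. p y \<le> C"
    and pm_bdd: "\<exists>C. \<forall>m\<ge>1. \<forall>y. pm m y \<le> C"
    (* Condition D (ii) *)
    and pj_nonneg: "\<And>i y z. 0 \<le> pj i y z"
    and pj_dens: "\<And>i. i \<noteq> zero_idx \<Longrightarrow>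
        distributed M lborel (\<lambda>\<omega>. (X zero_idx \<omega>, X i \<omega>)) (\<lambda>w. ennreal (pj i (fst w) (snd w)))"
    and pjm_nonneg: "\<And>m i y z. 0 \<le> pjm m i y z"
    and pjm_dens: "\<And>m i. m \<ge> 1 \<Longrightarrow> i \<noteq> zero_idx \<Longrightarrow>
        distributed M lborel (\<lambda>\<omega>. (Xtrunc a eps m zero_idx \<omega>, Xtrunc a eps m i \<omega>))
          (\<lambda>w. ennreal (pjm m i (fst w) (snd w)))"
    and pj_bdd: "\<exists>C. \<forall>i. i \<noteq> zero_idx \<longrightarrow> (\<forall>y z. pj i y z \<le> C)"
    and pjm_bdd: "\<exists>C. \<forall>m\<ge>1. \<forall>i. i \<noteq> zero_idx \<longrightarrow> (\<forall>y z. pjm m i y z \<le> C)"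
    (* Condition C *)
    and condC: "\<exists>mn :: nat \<Rightarrow> nat. (\<forall>n. mn n \<ge> 1) \<and> filterlim mn at_top sequentially
        \<and> (\<lambda>n. sqrt (b n) * Delta a n) \<longlonglongrightarrow> 0
        \<and> (\<lambda>n. B_coef a (mn n) / b n) \<longlonglongrightarrow> 0
        \<and> (\<lambda>n. real (mn n) ^ CARD('d) * b n) \<longlonglongrightarrow> 0
        \<and> (\<lambda>n. real (mn n) ^ CARD('d) * (ln (real n)) ^ CARD('d) / (real n ^ CARD('d) * b n))
             \<longlonglongrightarrow> 0"
  shows "weak_conv_m
     (\<lambda>n. distr M borel (\<lambda>\<omega>. sqrt (real n ^ CARD('d) * b n) *
              (kde K b X n x \<omega> - prob_space.expectation M (kde K b X n x))))
     (normal_law 0 (p x * integral\<^sup>L lborel (\<lambda>s. (K s)\<^sup>2)))"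
proof -
  interpret prob_space M by (rule prob)
  interpret iid_field M eps
    by unfold_locales (fact indep ident mean0 sq_int)+
  obtain B where B: "\<And>s. \<bar>K s\<bar> \<le> B" using K_bdd by blast
  obtain L where L: "lipschitz_with L K" using K_lip by blast
  obtain Cp where Cp: "\<And>y. p y \<le> Cp" using p_bdd by blast
  obtain C1 where C1: "\<And>m y. m \<ge> 1 \<Longrightarrow> pm m y \<le> C1" using pm_bdd by blast
  obtain C2 where C2: "\<And>m i y z. m \<ge> 1 \<Longrightarrow> i \<noteq> zero_idx \<Longrightarrow> pjm m i y z \<le> C2" using pjm_bdd by blast
  have K_le: "K s \<le> B" for s using B[of s] by simp
  interpret linear_field M eps a pm pjm c0 "max C1 C2" K B L x
  proof unfold_locales
    show "pm m y \<le> max C1 C2" if "m \<ge> 1" for m y using C1[OF that, of y] by simp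
    show "pjm m i y z \<le> max C1 C2" if "m \<ge> 1" "i \<noteq> zero_idx" for m i y z using C2[OF that, of y z] by simp
  qed (fact a_sq pm_nonneg pm_dens pm_lip pjm_nonneg pjm_dens K_nonneg K_int K_one K_le L)+
  obtain mm where mm: "\<And>n. mm n \<ge> 1"
    and D1: "(\<lambda>n. sqrt (b n) * Delta a n) \<longlonglongrightarrow> 0"
    and D2: "(\<lambda>n. B_coef a (mm n) / b n) \<longlonglongrightarrow> 0"
    and D3: "(\<lambda>n. real (mm n) ^ CARD('d) * b n) \<longlonglongrightarrow> 0"
    and D4: "(\<lambda>n. real (mm n) ^ CARD('d) * (ln (real n)) ^ CARD('d) / (real n ^ CARD('d) * b n)) \<longlonglongrightarrow> 0"
    using condC by blast
  let ?s2 = "p x * integral\<^sup>L lborel (\<lambda>s. (K s)\<^sup>2)"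
  have s2: "0 \<le> ?s2" using p_nonneg[of x] by simp

  \<comment> \<open>Eventually \<open>b n < 1\<close> and \<open>ln (real n) \<ge> 1\<close>, so the
    power \<open>(mm n / n) ^ CARD('d)\<close> is at most the quantity in (C4).\<close>
  have mn: "(\<lambda>n. real (mm n) / real n) \<longlonglongrightarrow> 0"
  proof (rule LIMSEQ_I)
    fix r :: real assume r: "0 < r"
    have "\<forall>\<^sub>F n in sequentially. real (mm n) ^ CARD('d) * (ln (real n)) ^ CARD('d) / (real n ^ CARD('d) * b n) < r ^ CARD('d)"
      using r by (intro order_tendstoD(2)[OF D4]) simp
    moreover have "\<forall>\<^sub>F n in sequentially. b n < 1" by (intro order_tendstoD(2)[OF b_lim]) simp
    moreover have "\<forall>\<^sub>F n in sequentially. 1 \<le> ln (real n)"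
      using filterlim_compose[OF ln_at_top filterlim_real_sequentially] by (simp add: filterlim_at_top)
    ultimately have "\<forall>\<^sub>F n in sequentially. norm (real (mm n) / real n - 0) < r"
      using eventually_ge_at_top[of 1]
    proof eventually_elim
      case (elim n)
      have "(real (mm n) / real n) ^ CARD('d) = real (mm n) ^ CARD('d) * 1 / (real n ^ CARD('d) * 1)"
        by (simp add: power_divide)
      also have "\<dots> \<le> real (mm n) ^ CARD('d) * (ln (real n)) ^ CARD('d) / (real n ^ CARD('d) * b n)"
        using elim b_pos[of n] by (intro frac_le mult_left_mono one_le_power) auto
      also have "\<dots> < r ^ CARD('d)" by (rule elim(1))
      finally have "real (mm n) / real n < r" by (rule power_less_imp_less_base) (use r in simp)
      then show ?case by simp
    qed
    then show "\<exists>no. \<forall>n\<ge>no. norm (real (mm n) / real n - 0) < r" by (simp add: eventually_sequentially)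
  qed

  have K_cont: "isCont K z" for z by (rule lipschitz_imp_continuous[OF L])
  have p_cont: "isCont p z" for z by (rule lipschitz_imp_continuous[OF p_lip])
  have [measurable]: "p \<in> borel_measurable borel"
    using p_cont by (intro borel_measurable_continuous_onI continuous_at_imp_continuous_on) simp
  \<comment> \<open>The substitution \<open>y = x - b n * s\<close> turns \<open>h (b n) y\<close>
    into \<open>K s\<close> and releases the factor \<open>b n\<close> that is divided out.\<close>
  have eta_var: "expectation (\<lambda>\<omega>. (eta X (b n) zero_idx \<omega>)\<^sup>2) / b n = (\<integral>s. p (x - b n * s) * (K s)\<^sup>2 \<partial>lborel)" for n
  proof -
    have "expectation (\<lambda>\<omega>. (eta X (b n) zero_idx \<omega>)\<^sup>2) = (\<integral>y. p y * (h (b n) y)\<^sup>2 \<partial>lborel)"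
      unfolding eta_def[OF X_rv X_L2int X_L2lim] by (rule distributed_integral[OF p_dens, symmetric]) (use p_nonneg in auto)
    also have "\<dots> = \<bar>- b n\<bar> *\<^sub>R (\<integral>s. p (x + (- b n) * s) * (h (b n) (x + (- b n) * s))\<^sup>2 \<partial>lborel)"
      by (rule lborel_integral_real_affine) (use b_pos[of n] in simp)
    finally show ?thesis using b_pos[of n] by (simp add: h_def)
  qed
  \<comment> \<open>Dominated convergence: \<open>p\<close> is continuous by its Lipschitz bound,
    and the majorant \<open>Cp * (K s)\<^sup>2\<close> is integrable because \<open>K\<close> is
    bounded and integrable.\<close>
  have var: "(\<lambda>n. expectation (\<lambda>\<omega>. (eta X (b n) zero_idx \<omega>)\<^sup>2) / b n) \<longlonglongrightarrow> ?s2"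
  proof -
    have K2_int: "integrable lborel (\<lambda>s. (K s)\<^sup>2)"
    proof (rule Bochner_Integration.integrable_bound)
      show "integrable lborel (\<lambda>s. B * K s)" using K_int by simp
      show "AE s in lborel. norm ((K s)\<^sup>2) \<le> norm (B * K s)"
        using K_nonneg K_le by (auto simp: power2_eq_square abs_mult intro!: mult_right_mono order_trans[OF K_le abs_ge_self])
    qed simp
    have "(\<lambda>n. \<integral>s. p (x - b n * s) * (K s)\<^sup>2 \<partial>lborel) \<longlonglongrightarrow> (\<integral>s. p x * (K s)\<^sup>2 \<partial>lborel)"
    proof (rule integral_dominated_convergence[where w = "\<lambda>s. Cp * (K s)\<^sup>2"])
      show "AE s in lborel. (\<lambda>n. p (x - b n * s) * (K s)\<^sup>2) \<longlonglongrightarrow> p x * (K s)\<^sup>2"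
      proof (rule AE_I2)
        fix s
        have "(\<lambda>n. x - b n * s) \<longlonglongrightarrow> x - 0 * s" by (intro tendsto_intros b_lim)
        then have "(\<lambda>n. p (x - b n * s)) \<longlonglongrightarrow> p x" by (intro isCont_tendsto_compose[OF p_cont]) simp
        then show "(\<lambda>n. p (x - b n * s) * (K s)\<^sup>2) \<longlonglongrightarrow> p x * (K s)\<^sup>2" by (intro tendsto_intros)
      qed
      show "AE s in lborel. norm (p (x - b n * s) * (K s)\<^sup>2) \<le> Cp * (K s)\<^sup>2" for n
        using p_nonneg Cp by (auto simp: abs_mult intro!: mult_right_mono)
      show "integrable lborel (\<lambda>s. Cp * (K s)\<^sup>2)" using K2_int by simp
    qed simp_all
    then show ?thesis by (simp add: eta_var)
  qed

  show ?thesis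
  proof (rule levy_continuity)
    show "real_distribution (normal_law 0 ?s2)" by (rule real_distribution_normal_law[OF s2])
    show "real_distribution (distr M borel (\<lambda>\<omega>. sqrt (real n ^ CARD('d) * b n) *
              (kde K b X n x \<omega> - expectation (kde K b X n x))))" for n
    proof -
      note X_rv[measurable]
      have [measurable]: "kde K b X n x \<in> borel_measurable M" unfolding kde_def[abs_def] by measurable
      show ?thesis by (intro real_distribution_distr) measurable
    qed
    show "(\<lambda>n. char (distr M borel (\<lambda>\<omega>. sqrt (real n ^ CARD('d) * b n) *
              (kde K b X n x \<omega> - expectation (kde K b X n x)))) t) \<longlonglongrightarrow> char (normal_law 0 ?s2) t" for t
      unfolding char_normal_law[OF s2]
      by (rule kde_char_tendsto[OF X_rv X_L2int X_L2lim b_pos nb_lim mm D1 D2 D3 mn var])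
  qed
qed

end
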